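(* Let $\Sigma$ be a complete immersed self-expander hypersurface in $\mathbb{R}^{n+1}$, and let $\mu_1$ be the bottom of the spectrum of the stability operator $L=\Delta+\frac12\langle x,\nabla\cdot\rangle+|A|^2-\frac12$ on $\Sigma$. Then $$\mu_1\ge\frac{n+1}{2}+\inf_{x\in\Sigma}Scal_\Sigma,$$ where $\inf_{x\in\Sigma}Scal_\Sigma$ denotes the infimum of the scalar curvature $Scal_\Sigma=H^2-|A|^2$ of $\Sigma$. Moreover, equality holds in this inequality if $\Sigma$ is also properly immersed, has constant scalar curvature and satisfies $|H|(x)\le a|x|+b$ for all $x\in\Sigma$, for some constants $0\le a<\frac{1}{2\sqrt2}$ and $b>0$.
   Context: $x$ denotes the position vector. For an immersed hypersurface $\Sigma$ with induced metric, volume form $d\sigma$, gradient $\nabla$ and Laplacian $\Delta$, the second fundamental form is $A(X,Y)=(\overline\nabla_XY)^\perp$ ($\overline\nabla$ the Euclidean connection), the mean curvature vector $\mathbf{H}$ is its trace, and $\Sigma$ is a self-expander if $\mathbf{H}=\frac12x^\perp$ ($x^\perp$ the normal component of $x$). The mean curvature $H$ is defined by $\mathbf{H}=-H\mathbf{n}$, $\mathbf{n}$ the unit normal. $\Sigma$ is properly immersed if the preimage under the immersion of every compact subset of $\mathbb{R}^{n+1}$ is compact. The bottom of the (weighted $L^2$) spectrum of $L$ is $$\mu_1=\inf\left\{\frac{\int_\Sigma\left(|\nabla\varphi|^2-(|A|^2-\frac12)\varphi^2\right)e^{\frac{|x|^2}{4}}d\sigma}{\int_\Sigma\varphi^2e^{\frac{|x|^2}{4}}d\sigma}:\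 \varphi\in C_0^\infty(\Sigma),\ \int_\Sigma\varphi^2e^{\frac{|x|^2}{4}}d\sigma\ne0\right\}\in[-\infty,\infty).$$ *)

theory Defs
  imports "HOL-Analysis.Analysis"
begin

text \<open>Smooth maps between Euclidean spaces. The set is meant to be open.\<close>

primrec Ck_on :: "nat \<Rightarrow> ('a::euclidean_space \<Rightarrow> 'b::euclidean_space) \<Rightarrow> 'a set \<Rightarrow> bool" where
  "Ck_on 0 f S \<longleftrightarrow> continuous_on S f"
| "Ck_on (Suc k) f S \<longleftrightarrow>
     (\<forall>x\<in>S. f differentiable (at x)) \<and> (\<forall>v. Ck_on k (\<lambda>x. frechet_derivative f (at x) v) S)"

definition smooth_on :: "('a::euclidean_space \<Rightarrow> 'b::euclidean_space) \<Rightarrow> 'a set \<Rightarrow> bool" where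
  "smooth_on f S \<longleftrightarrow> (\<forall>k. Ck_on k f S)"

text \<open>
  The manifold is the whole type \<open>'m\<close>, a Hausdorff and second countable space, with a
  (not necessarily maximal) smooth atlas of charts \<open>(U, \<phi>)\<close>, where only the values of \<open>\<phi>\<close> on the
  open set \<open>U\<close> matter. It need not be connected.
\<close>

type_synonym ('m, 'n) chart = "'m set \<times> ('m \<Rightarrow> real^'n)"

definition chart_inv :: "('m, 'n) chart \<Rightarrow> real^'n \<Rightarrow> 'm" where
  "chart_inv c = inv_into (fst c) (snd c)"

definition smooth_atlas :: "('m::topological_space, 'n::finite) chart set \<Rightarrow> bool" where
  "smooth_atlas \<A> \<longleftrightarrow>
     (\<Union>c\<in>\<A>. fst c) = UNIV \<and>
     (\<forall>(U, \<phi>)\<in>\<A>. open U \<and> open (\<phi> ` U) \<and> homeomorphism U (\<phi> ` U) \<phi> (chart_inv (U, \<phi>))) \<and>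
     (\<forall>(U, \<phi>)\<in>\<A>. \<forall>(V, \<psi>)\<in>\<A>. smooth_on (\<psi> \<circ> chart_inv (U, \<phi>)) (\<phi> ` (U \<inter> V)))"

definition smooth_map ::
    "('m::topological_space, 'n::finite) chart set \<Rightarrow> ('m \<Rightarrow> 'b::euclidean_space) \<Rightarrow> bool" where
  "smooth_map \<A> f \<longleftrightarrow> (\<forall>(U, \<phi>)\<in>\<A>. smooth_on (f \<circ> chart_inv (U, \<phi>)) (\<phi> ` U))"

definition immersed_hypersurface ::
    "('m::{t2_space,second_countable_topology}, 'n::finite) chart set \<Rightarrow>
     ('m \<Rightarrow> real^('n + 1)) \<Rightarrow> bool" where
  "immersed_hypersurface \<A> F \<longleftrightarrow>
     smooth_atlas \<A> \<and> smooth_map \<A> F \<and>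
     (\<forall>(U, \<phi>)\<in>\<A>. \<forall>u\<in>\<phi> ` U. inj (frechet_derivative (F \<circ> chart_inv (U, \<phi>)) (at u)))"

text \<open>
  Tangent vectors at \<open>p\<close> are represented by their images under \<open>dF\<close>, so that the induced metric
  is the restriction of the Euclidean inner product to \<open>tangent_space \<A> F p\<close>. At each point a
  chart is selected; none of the notions below depends on the selection.
\<close>

definition chart_at :: "('m, 'n) chart set \<Rightarrow> 'm \<Rightarrow> ('m, 'n) chart" where
  "chart_at \<A> p = (SOME c. c \<in> \<A> \<and> p \<in> fst c)"

definition deriv_at ::
    "('m, 'n::finite) chart \<Rightarrow> ('m \<Rightarrow> 'b::euclidean_space) \<Rightarrow> 'm \<Rightarrow> real^'n \<Rightarrow> 'b" where
  "deriv_at c f p = frechet_derivative (f \<circ> chart_inv c) (at (snd c p))"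

definition tangent_space ::
    "('m, 'n::finite) chart set \<Rightarrow> ('m \<Rightarrow> real^('n + 1)) \<Rightarrow> 'm \<Rightarrow> (real^('n + 1)) set" where
  "tangent_space \<A> F p = range (deriv_at (chart_at \<A> p) F p)"

definition coords ::
    "('m, 'n::finite) chart set \<Rightarrow> ('m \<Rightarrow> real^('n + 1)) \<Rightarrow> 'm \<Rightarrow> real^('n + 1) \<Rightarrow> real^'n" where
  "coords \<A> F p X = inv (deriv_at (chart_at \<A> p) F p) X"

text \<open>The derivative of \<open>f\<close> at \<open>p\<close> in the direction of the tangent vector \<open>X\<close>. For a vector field
  \<open>f\<close> along \<open>F\<close> this is the Euclidean connection.\<close>

definition dir_deriv ::
    "('m, 'n::finite) chart set \<Rightarrow> ('m \<Rightarrow> real^('n + 1)) \<Rightarrow> ('m \<Rightarrow> 'b::euclidean_space) \<Rightarrow>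
     'm \<Rightarrow> real^('n + 1) \<Rightarrow> 'b" where
  "dir_deriv \<A> F f p X = deriv_at (chart_at \<A> p) f p (coords \<A> F p X)"

definition normal_part ::
    "('m, 'n::finite) chart set \<Rightarrow> ('m \<Rightarrow> real^('n + 1)) \<Rightarrow> 'm \<Rightarrow> real^('n + 1) \<Rightarrow> real^('n + 1)" where
  "normal_part \<A> F p v =
     (THE w. w \<in> orthogonal_comp (tangent_space \<A> F p) \<and> v - w \<in> tangent_space \<A> F p)"

definition tangent_onb ::
    "('m, 'n::finite) chart set \<Rightarrow> ('m \<Rightarrow> real^('n + 1)) \<Rightarrow> 'm \<Rightarrow> (real^('n + 1)) set" where
  "tangent_onb \<A> F p =
     (SOME B. pairwise orthogonal B \<and> (\<forall>e\<in>B. norm e = 1) \<and> span B = tangent_space \<A> F p)"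

text \<open>To form \<open>\<nabla>\<^sub>X Y\<close> the vector \<open>Y\<close> has to be extended to a tangent vector field near \<open>p\<close>; the
  normal part does not depend on the extension, and we take the one with constant
  coordinates in the chart at \<open>p\<close>.\<close>

definition extend_field ::
    "('m, 'n::finite) chart set \<Rightarrow> ('m \<Rightarrow> real^('n + 1)) \<Rightarrow> 'm \<Rightarrow> real^('n + 1) \<Rightarrow>
     'm \<Rightarrow> real^('n + 1)" where
  "extend_field \<A> F p Y q = deriv_at (chart_at \<A> p) F q (coords \<A> F p Y)"

definition second_fundamental_form ::
    "('m, 'n::finite) chart set \<Rightarrow> ('m \<Rightarrow> real^('n + 1)) \<Rightarrow> 'm \<Rightarrow>
     real^('n + 1) \<Rightarrow> real^('n + 1) \<Rightarrow> real^('n + 1)" where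
  "second_fundamental_form \<A> F p X Y =
     normal_part \<A> F p (dir_deriv \<A> F (extend_field \<A> F p Y) p X)"

definition mean_curvature_vector ::
    "('m, 'n::finite) chart set \<Rightarrow> ('m \<Rightarrow> real^('n + 1)) \<Rightarrow> 'm \<Rightarrow> real^('n + 1)" where
  "mean_curvature_vector \<A> F p =
     (\<Sum>e\<in>tangent_onb \<A> F p. second_fundamental_form \<A> F p e e)"

definition norm_A_sq :: "('m, 'n::finite) chart set \<Rightarrow> ('m \<Rightarrow> real^('n + 1)) \<Rightarrow> 'm \<Rightarrow> real" where
  "norm_A_sq \<A> F p =
     (\<Sum>e\<in>tangent_onb \<A> F p. \<Sum>e'\<in>tangent_onb \<A> F p.
        (norm (second_fundamental_form \<A> F p e e'))\<^sup>2)"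

text \<open>The unit normal is chosen pointwise, since the hypersurface need not be two-sided. Hence the
  sign of \<open>mean_curvature\<close> is arbitrary; only its square and absolute value are meaningful.\<close>

definition unit_normal ::
    "('m, 'n::finite) chart set \<Rightarrow> ('m \<Rightarrow> real^('n + 1)) \<Rightarrow> 'm \<Rightarrow> real^('n + 1)" where
  "unit_normal \<A> F p = (SOME \<nu>. norm \<nu> = 1 \<and> \<nu> \<in> orthogonal_comp (tangent_space \<A> F p))"

definition mean_curvature :: "('m, 'n::finite) chart set \<Rightarrow> ('m \<Rightarrow> real^('n + 1)) \<Rightarrow> 'm \<Rightarrow> real" where
  "mean_curvature \<A> F p =
     (THE h. mean_curvature_vector \<A> F p = - (h *\<^sub>R unit_normal \<A> F p))"

definition scalar_curvature ::
    "('m, 'n::finite) chart set \<Rightarrow> ('m \<Rightarrow> real^('n + 1)) \<Rightarrow> 'm \<Rightarrow> real" where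
  "scalar_curvature \<A> F p = (mean_curvature \<A> F p)\<^sup>2 - norm_A_sq \<A> F p"

definition self_expander :: "('m, 'n::finite) chart set \<Rightarrow> ('m \<Rightarrow> real^('n + 1)) \<Rightarrow> bool" where
  "self_expander \<A> F \<longleftrightarrow>
     (\<forall>p. mean_curvature_vector \<A> F p = (1/2) *\<^sub>R normal_part \<A> F p (F p))"

text \<open>
  Piecewise \<open>C\<^sup>1\<close> curves \<open>\<gamma>\<close> in the manifold: as \<open>F\<close> is an immersion, a continuous \<open>\<gamma>\<close> is \<open>C\<^sup>1\<close> exactly
  where \<open>F \<circ> \<gamma>\<close> is, and its speed in the induced metric is that of \<open>F \<circ> \<gamma>\<close>. The library's
  piecewise \<open>C\<^sup>1\<close> condition allows unbounded derivatives at the breakpoints, so the length is taken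
  in \<open>ennreal\<close>. The distance between points in different components is \<open>\<infinity>\<close>.
\<close>

definition curve_length :: "('m \<Rightarrow> 'b::euclidean_space) \<Rightarrow> (real \<Rightarrow> 'm) \<Rightarrow> ennreal" where
  "curve_length F \<gamma> =
     (\<integral>\<^sup>+t\<in>{0..1}. ennreal (norm (vector_derivative (F \<circ> \<gamma>) (at t))) \<partial>lborel)"

definition induced_dist ::
    "('m::topological_space \<Rightarrow> 'b::euclidean_space) \<Rightarrow> 'm \<Rightarrow> 'm \<Rightarrow> ennreal" where
  "induced_dist F p q =
     (INF \<gamma>\<in>{\<gamma>. path \<gamma> \<and> pathstart \<gamma> = p \<and> pathfinish \<gamma> = q \<and>
                (F \<circ> \<gamma>) piecewise_C1_differentiable_on {0..1}}. curve_length F \<gamma>)"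

definition complete_immersion :: "('m::topological_space \<Rightarrow> 'b::euclidean_space) \<Rightarrow> bool" where
  "complete_immersion F \<longleftrightarrow>
     (\<forall>s. (\<forall>\<epsilon>>0. \<exists>N. \<forall>i\<ge>N. \<forall>j\<ge>N. induced_dist F (s i) (s j) < \<epsilon>) \<longrightarrow>
          (\<exists>l. (\<lambda>i. induced_dist F (s i) l) \<longlonglongrightarrow> 0))"

definition properly_immersed :: "('m::topological_space \<Rightarrow> 'b::euclidean_space) \<Rightarrow> bool" where
  "properly_immersed F \<longleftrightarrow> (\<forall>K. compact K \<longrightarrow> compact (F -` K))"

text \<open>The Riemannian volume measure of the induced metric, with density \<open>sqrt (det g)\<close> in charts.\<close>

definition volume_density ::
    "('m, 'n::finite) chart \<Rightarrow> ('m \<Rightarrow> 'b::euclidean_space) \<Rightarrow> real^'n \<Rightarrow> real" where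
  "volume_density c F u =
     (let D = frechet_derivative (F \<circ> chart_inv c) (at u)
      in sqrt (det ((\<chi> i j. D (axis i 1) \<bullet> D (axis j 1)) :: real^'n^'n)))"

definition volume_measure ::
    "('m::topological_space, 'n::finite) chart set \<Rightarrow> ('m \<Rightarrow> 'b::euclidean_space) \<Rightarrow> 'm measure" where
  "volume_measure \<A> F =
     (THE \<sigma>. sets \<sigma> = sets borel \<and>
        (\<forall>c\<in>\<A>. \<forall>E\<in>sets borel. E \<subseteq> fst c \<longrightarrow>
           emeasure \<sigma> E = (\<integral>\<^sup>+u\<in>snd c ` E. ennreal (volume_density c F u) \<partial>lborel)))"

definition gradient ::
    "('m, 'n::finite) chart set \<Rightarrow> ('m \<Rightarrow> real^('n + 1)) \<Rightarrow> ('m \<Rightarrow> real) \<Rightarrow> 'm \<Rightarrow> real^('n + 1)" where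
  "gradient \<A> F f p = (\<Sum>e\<in>tangent_onb \<A> F p. dir_deriv \<A> F f p e *\<^sub>R e)"

definition test_functions ::
    "('m::topological_space, 'n::finite) chart set \<Rightarrow> ('m \<Rightarrow> real) set" where
  "test_functions \<A> = {f. smooth_map \<A> f \<and> compact (closure {p. f p \<noteq> 0})}"

definition weighted_integral ::
    "('m::topological_space, 'n::finite) chart set \<Rightarrow> ('m \<Rightarrow> real^('n + 1)) \<Rightarrow>
     ('m \<Rightarrow> real) \<Rightarrow> real" where
  "weighted_integral \<A> F h = (\<integral>p. h p * exp ((norm (F p))\<^sup>2 / 4) \<partial>volume_measure \<A> F)"

text \<open>The bottom of the weighted \<open>L\<^sup>2\<close> spectrum of the stability operator
  \<open>L = \<Delta> + 1/2 \<langle>x, \<nabla>\<cdot>\<rangle> + |A|\<^sup>2 - 1/2\<close>, an element of \<open>[-\<infinity>, \<infinity>)\<close>.\<close>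

definition bottom_spectrum ::
    "('m::topological_space, 'n::finite) chart set \<Rightarrow> ('m \<Rightarrow> real^('n + 1)) \<Rightarrow> ereal" where
  "bottom_spectrum \<A> F =
     (INF f\<in>{f \<in> test_functions \<A>. weighted_integral \<A> F (\<lambda>p. (f p)\<^sup>2) \<noteq> 0}.
        ereal (weighted_integral \<A> F
                 (\<lambda>p. (norm (gradient \<A> F f p))\<^sup>2 - (norm_A_sq \<A> F p - 1/2) * (f p)\<^sup>2)
               / weighted_integral \<A> F (\<lambda>p. (f p)\<^sup>2)))"

end

theory Submission
  imports Defs
begin

text \<open>
  Write \<open>x\<close> for the position vector, \<open>x\<^sup>T\<close> for its tangential part and \<open>n\<close> for the dimension of \<open>\<Sigma>\<close>. The whole
  proof rests on one integral identity, the first variation formula: if \<open>\<eta>\<close> is smooth with compact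
  support, then \<open>\<integral> (\<eta> (n + \<langle>x, H\<rangle>) + \<langle>\<nabla>\<eta>, x\<rangle>) d\<sigma> = 0\<close> (\<open>first_variation_formula\<close>). It is the divergence
  theorem for \<open>\<eta> x\<^sup>T\<close>. On a self-expander \<open>H = x\<^sup>\<bottom> / 2\<close>, so that \<open>\<langle>x, H\<rangle> = 2 H\<^sup>2\<close> and
  \<open>\<bar>x\<^sup>T\<bar>\<^sup>2 = \<bar>x\<bar>\<^sup>2 - 4 H\<^sup>2\<close>, and every integrand becomes explicit.

  Lower bound. The function \<open>exp (- \<bar>x\<bar>\<^sup>2 / 4)\<close> has gradient \<open>- x\<^sup>T / 2\<close> times itself. Comparing a test
  function \<open>f\<close> with it means completing the square in \<open>\<bar>\<nabla>f\<bar>\<^sup>2\<close>, and the formula for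
  \<open>\<eta> = f\<^sup>2 exp (\<bar>x\<bar>\<^sup>2 / 4)\<close> evaluates the cross terms (\<open>stability_form_identity\<close>):
  \<open>\<integral> (\<bar>\<nabla>f\<bar>\<^sup>2 - (\<bar>A\<bar>\<^sup>2 - 1/2) f\<^sup>2) w = \<integral> \<bar>\<nabla>f + f x\<^sup>T / 2\<bar>\<^sup>2 w + \<integral> ((n + 1) / 2 + Scal) f\<^sup>2 w\<close> with the weight
  \<open>w = exp (\<bar>x\<bar>\<^sup>2 / 4)\<close>. Dropping the square gives the inequality.

  Equality. If \<open>Scal\<close> is constant, only the square has to be made small compared with \<open>\<integral> f\<^sup>2 w\<close>. For
  \<open>f = \<zeta> (\<bar>x\<bar>\<^sup>2 / R) exp (- \<bar>x\<bar>\<^sup>2 / 4)\<close> with a decreasing \<open>\<zeta>\<close> that vanishes beyond \<open>2\<close> the square only sees \<open>\<zeta>'\<close> and is at most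
  a constant times \<open>1 / R\<close> times \<open>\<integral> exp (- \<bar>x\<bar>\<^sup>2 / 4)\<close> over \<open>\<bar>x\<bar>\<^sup>2 \<le> 2 R\<close> (\<open>cutoff_energy\<close>). These integrals stay
  bounded: the first variation formula for \<open>\<eta> = f\<close> and \<open>\<zeta>' \<le> 0\<close> give
  \<open>\<integral> (\<bar>x\<bar>\<^sup>2 / 2 - 4 H\<^sup>2 - n) f \<le> 0\<close>, and \<open>\<bar>H\<bar> \<le> a \<bar>x\<bar> + b\<close> with \<open>8 a\<^sup>2 < 1\<close> makes the bracket at least \<open>1\<close> outside
  a ball (\<open>integral_cutoff_bounded\<close>). Properness makes the cutoffs compactly supported.

  Foundations. The volume measure is specified by its values in charts, so it has to be shown that
  such a measure exists and is unique; this is the change of variables formula on chart overlaps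
  (\<open>ex1_volume_measure\<close>). Curvatures and gradients are defined through one chart and one orthonormal
  basis chosen at each point. They are rewritten as traces with respect to the inverse Gram matrix of an
  arbitrary chart (\<open>trace_onb\<close>, \<open>hess_chart_change\<close>), which makes them continuous and turns the first
  variation formula into a computation in \<open>\<real>\<^sup>n\<close> (\<open>local_first_variation\<close>); a partition of unity
  makes it global.
\<close>

section \<open>Smooth functions on open sets\<close>

named_theorems smooth_intros

lemma frechet_derivative_cong_open:
  assumes "open S" "x \<in> S" "\<And>y. y \<in> S \<Longrightarrow> f y = g y"
  shows "frechet_derivative f (at x) = frechet_derivative g (at x)"
proof -
  have "(f has_derivative f') (at x) \<longleftrightarrow> (g has_derivative f') (at x)" for f'
    using assms has_derivative_transform_within_open[of f f' x UNIV S g]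
      has_derivative_transform_within_open[of g f' x UNIV S f] by auto
  then show ?thesis by (simp add: frechet_derivative_def)
qed

lemma differentiable_cong_open:
  assumes "open S" "x \<in> S" "\<And>y. y \<in> S \<Longrightarrow> f y = g y"
  shows "f differentiable (at x) \<longleftrightarrow> g differentiable (at x)"
  using assms has_derivative_transform_within_open[of f _ x UNIV S g]
      has_derivative_transform_within_open[of g _ x UNIV S f]
  unfolding differentiable_def by auto

lemma Ck_on_cong:
  assumes "open S" "\<And>y. y \<in> S \<Longrightarrow> f y = g y"
  shows "Ck_on k f S \<longleftrightarrow> Ck_on k g S"
  using assms(2)
proof (induction k arbitrary: f g)
  case 0
  then show ?case using continuous_on_cong[of S S f g] by auto
next
  case (Suc k)
  have "Ck_on k (\<lambda>x. frechet_derivative f (at x) v) S \<longleftrightarrow> Ck_on k (\<lambda>x. frechet_derivative g (at x) v) S" for v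
    by (rule Suc.IH) (use frechet_derivative_cong_open[OF assms(1) _ Suc.prems] in auto)
  moreover have "(\<forall>x\<in>S. f differentiable (at x)) \<longleftrightarrow> (\<forall>x\<in>S. g differentiable (at x))"
    using differentiable_cong_open[OF assms(1) _ Suc.prems] by auto
  ultimately show ?case by simp
qed

text \<open>Derivatives are usually known through the relation \<open>has_derivative\<close>; this rule lets every induction
  on the order of smoothness below use the known formula in place of \<open>frechet_derivative\<close>.\<close>

lemma Ck_on_SucI:
  assumes "open S" "\<And>x. x \<in> S \<Longrightarrow> (f has_derivative f' x) (at x)"
    and "\<And>v. Ck_on k (\<lambda>x. f' x v) S"
  shows "Ck_on (Suc k) f S"
proof -
  have *: "frechet_derivative f (at x) = f' x" if "x \<in> S" for x
    using frechet_derivative_at[OF assms(2)[OF that]] by simp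
  have "Ck_on k (\<lambda>x. frechet_derivative f (at x) v) S" for v
    using Ck_on_cong[OF assms(1), of "\<lambda>x. frechet_derivative f (at x) v" "\<lambda>x. f' x v"] assms(3) *
    by auto
  then show ?thesis using assms(2) by (auto simp: differentiable_def)
qed

lemma Ck_on_subset: "Ck_on k f S \<Longrightarrow> T \<subseteq> S \<Longrightarrow> Ck_on k f T"
  by (induction k arbitrary: f) (auto intro: continuous_on_subset)

lemma Ck_on_continuous: "Ck_on k f S \<Longrightarrow> continuous_on S f"
proof (cases k)
  case (Suc j)
  assume "Ck_on k f S"
  then show ?thesis unfolding Suc
    by (intro continuous_at_imp_continuous_on) (auto intro: differentiable_imp_continuous_within)
qed simp

lemma Ck_on_lower: "Ck_on (Suc k) f S \<Longrightarrow> Ck_on k f S"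
proof (induction k arbitrary: f)
  case 0
  then show ?case unfolding Ck_on.simps(1) by (rule Ck_on_continuous)
next
  case (Suc k)
  from Suc.prems have a: "\<forall>x\<in>S. f differentiable (at x)"
    and b: "\<And>v. Ck_on (Suc k) (\<lambda>x. frechet_derivative f (at x) v) S"
    unfolding Ck_on.simps(2)[of "Suc k"] by blast+
  show ?case unfolding Ck_on.simps(2)[of k] using a Suc.IH[OF b] by blast
qed

lemma Ck_on_Un: "open S \<Longrightarrow> open T \<Longrightarrow> Ck_on k f S \<Longrightarrow> Ck_on k f T \<Longrightarrow> Ck_on k f (S \<union> T)"
  by (induction k arbitrary: f) (auto intro: continuous_on_open_Un)

lemma Ck_on_const: "open S \<Longrightarrow> Ck_on k (\<lambda>x. c) S"
proof (induction k arbitrary: c)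
  case (Suc k)
  show ?case by (rule Ck_on_SucI[where f'="\<lambda>_ _. 0"]) (auto simp: Suc)
qed simp

lemma Ck_on_linear: "open S \<Longrightarrow> bounded_linear L \<Longrightarrow> Ck_on k L S"
proof (cases k)
  case (Suc k)
  assume *: "open S" "bounded_linear L"
  show ?thesis unfolding Suc
    by (rule Ck_on_SucI[where f'="\<lambda>_ . L"]) (use * in \<open>auto intro!: bounded_linear_imp_has_derivative Ck_on_const\<close>)
qed (auto simp: linear_continuous_on)

lemma has_derivative_of_Ck:
  "Ck_on (Suc k) f S \<Longrightarrow> x \<in> S \<Longrightarrow> (f has_derivative frechet_derivative f (at x)) (at x)"
  by (auto simp: frechet_derivative_works)

lemma Ck_on_add: "open S \<Longrightarrow> Ck_on k f S \<Longrightarrow> Ck_on k g S \<Longrightarrow> Ck_on k (\<lambda>x. f x + g x) S"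
proof (induction k arbitrary: f g)
  case (Suc k)
  show ?case
  proof (rule Ck_on_SucI[where f'="\<lambda>x v. frechet_derivative f (at x) v + frechet_derivative g (at x) v"])
    show "((\<lambda>x. f x + g x) has_derivative (\<lambda>v. frechet_derivative f (at x) v + frechet_derivative g (at x) v)) (at x)"
      if "x \<in> S" for x
      using Suc.prems that by (intro has_derivative_add has_derivative_of_Ck) auto
  qed (use Suc in auto)
qed (auto intro: continuous_intros)

text \<open>By the product rule the derivative is a sum of two products of the same kind, so the induction has to
  generalize both factors.\<close>

lemma Ck_on_bilinear:
  assumes "bounded_bilinear b" "open S"
  shows "Ck_on k f S \<Longrightarrow> Ck_on k g S \<Longrightarrow> Ck_on k (\<lambda>x. b (f x) (g x)) S"
proof (induction k arbitrary: f g)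
  case 0
  then show ?case using bounded_bilinear.continuous_on[OF assms(1)] by auto
next
  case (Suc k)
  show ?case
  proof (rule Ck_on_SucI[where f'="\<lambda>x v. b (f x) (frechet_derivative g (at x) v) + b (frechet_derivative f (at x) v) (g x)"])
    show "((\<lambda>x. b (f x) (g x)) has_derivative (\<lambda>v. b (f x) (frechet_derivative g (at x) v) + b (frechet_derivative f (at x) v) (g x))) (at x)"
      if "x \<in> S" for x
      using bounded_bilinear.FDERIV[OF assms(1) has_derivative_of_Ck[OF Suc.prems(1) that] has_derivative_of_Ck[OF Suc.prems(2) that]] .
    show "Ck_on k (\<lambda>x. b (f x) (frechet_derivative g (at x) v) + b (frechet_derivative f (at x) v) (g x)) S" for v
      by (intro Ck_on_add Suc.IH assms(2)) (use Suc.prems Ck_on_lower in auto)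
  qed (rule assms(2))
qed

lemma Ck_on_sum:
  "open S \<Longrightarrow> (\<And>i. i \<in> I \<Longrightarrow> Ck_on k (f i) S) \<Longrightarrow> Ck_on k (\<lambda>x. \<Sum>i\<in>I. f i x) S"
  by (induction I rule: infinite_finite_induct) (auto simp: Ck_on_const Ck_on_add)

text \<open>The chain rule makes the derivative a map of two arguments. Expanding the inner derivative in the
  standard basis turns it into a finite sum of products, each of them covered by the induction hypothesis and
  \<open>Ck_on_bilinear\<close>.\<close>

lemma Ck_on_compose:
  assumes "open S" "open T"
  shows "Ck_on k f S \<Longrightarrow> Ck_on k g T \<Longrightarrow> f ` S \<subseteq> T \<Longrightarrow> Ck_on k (\<lambda>x. g (f x)) S"
proof (induction k arbitrary: g)
  case 0
  then show ?case using continuous_on_compose2 by auto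
next
  case (Suc k)
  show ?case
  proof (rule Ck_on_SucI[where f'="\<lambda>x v. \<Sum>i\<in>Basis. (frechet_derivative f (at x) v \<bullet> i) *\<^sub>R frechet_derivative g (at (f x)) i"])
    show "((\<lambda>x. g (f x)) has_derivative (\<lambda>v. \<Sum>i\<in>Basis. (frechet_derivative f (at x) v \<bullet> i) *\<^sub>R frechet_derivative g (at (f x)) i)) (at x)"
      if x: "x \<in> S" for x
    proof -
      have f: "(f has_derivative frechet_derivative f (at x)) (at x)"
        using has_derivative_of_Ck[OF Suc.prems(1) x] .
      have g: "(g has_derivative frechet_derivative g (at (f x))) (at (f x))"
        using has_derivative_of_Ck[OF Suc.prems(2), of "f x"] Suc.prems(3) x by auto
      have *: "frechet_derivative g (at (f x)) w = (\<Sum>i\<in>Basis. (w \<bullet> i) *\<^sub>R frechet_derivative g (at (f x)) i)" for w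
      proof -
        interpret linear "frechet_derivative g (at (f x))" using g has_derivative_linear by auto
        have "frechet_derivative g (at (f x)) w = frechet_derivative g (at (f x)) (\<Sum>i\<in>Basis. (w \<bullet> i) *\<^sub>R i)"
          by (simp add: euclidean_representation)
        then show ?thesis by (simp add: sum scaleR)
      qed
      show ?thesis
        by (rule has_derivative_eq_rhs[OF has_derivative_compose[OF f g]], rule ext, rule *)
    qed
    show "Ck_on k (\<lambda>x. \<Sum>i\<in>Basis. (frechet_derivative f (at x) v \<bullet> i) *\<^sub>R frechet_derivative g (at (f x)) i) S" for v
    proof (rule Ck_on_sum[OF assms(1)])
      fix i :: 'b assume "i \<in> Basis"
      have 1: "Ck_on k (\<lambda>x. frechet_derivative f (at x) v \<bullet> i) S"
        using Suc.prems by (intro Ck_on_bilinear[OF bounded_bilinear_inner assms(1)] Ck_on_const assms(1)) auto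
      have 2: "Ck_on k (\<lambda>x. frechet_derivative g (at (f x)) i) S"
        using Suc.IH[of "\<lambda>y. frechet_derivative g (at y) i"] Ck_on_lower[OF Suc.prems(1)] Suc.prems(2,3) by simp
      show "Ck_on k (\<lambda>x. (frechet_derivative f (at x) v \<bullet> i) *\<^sub>R frechet_derivative g (at (f x)) i) S"
        using Ck_on_bilinear[OF bounded_bilinear_scaleR assms(1) 1 2] .
    qed
  qed (rule assms(1))
qed

lemma smooth_on_cong:
  "open S \<Longrightarrow> (\<And>y. y \<in> S \<Longrightarrow> f y = g y) \<Longrightarrow> smooth_on f S \<longleftrightarrow> smooth_on g S"
  unfolding smooth_on_def using Ck_on_cong by blast

lemma smooth_on_subset: "smooth_on f S \<Longrightarrow> T \<subseteq> S \<Longrightarrow> smooth_on f T"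
  unfolding smooth_on_def using Ck_on_subset by blast

lemma smooth_on_Un: "open S \<Longrightarrow> open T \<Longrightarrow> smooth_on f S \<Longrightarrow> smooth_on f T \<Longrightarrow> smooth_on f (S \<union> T)"
  unfolding smooth_on_def using Ck_on_Un by blast

lemma smooth_on_continuous: "smooth_on f S \<Longrightarrow> continuous_on S f"
  unfolding smooth_on_def using Ck_on_continuous by blast

lemma smooth_on_has_derivative:
  "smooth_on f S \<Longrightarrow> x \<in> S \<Longrightarrow> (f has_derivative frechet_derivative f (at x)) (at x)"
  unfolding smooth_on_def using has_derivative_of_Ck by blast

lemma smooth_on_frechet_derivative:
  "smooth_on f S \<Longrightarrow> smooth_on (\<lambda>x. frechet_derivative f (at x) v) S"
  unfolding smooth_on_def
proof
  fix k assume "\<forall>k. Ck_on k f S"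
  then have "Ck_on (Suc k) f S" by blast
  then show "Ck_on k (\<lambda>x. frechet_derivative f (at x) v) S" by simp
qed

lemma smooth_on_const [smooth_intros]: "open S \<Longrightarrow> smooth_on (\<lambda>x. c) S"
  unfolding smooth_on_def using Ck_on_const by blast

lemma smooth_on_linear: "open S \<Longrightarrow> bounded_linear L \<Longrightarrow> smooth_on L S"
  unfolding smooth_on_def using Ck_on_linear by blast

lemma smooth_on_id [smooth_intros]: "open S \<Longrightarrow> smooth_on (\<lambda>x. x) S"
  by (simp add: smooth_on_linear)

lemma smooth_on_add [smooth_intros]:
  "open S \<Longrightarrow> smooth_on f S \<Longrightarrow> smooth_on g S \<Longrightarrow> smooth_on (\<lambda>x. f x + g x) S"
  unfolding smooth_on_def using Ck_on_add by blast

lemma smooth_on_sum [smooth_intros]: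
  "open S \<Longrightarrow> (\<And>i. i \<in> I \<Longrightarrow> smooth_on (f i) S) \<Longrightarrow> smooth_on (\<lambda>x. \<Sum>i\<in>I. f i x) S"
  unfolding smooth_on_def using Ck_on_sum[of S I] by blast

lemma smooth_on_bilinear:
  "bounded_bilinear b \<Longrightarrow> open S \<Longrightarrow> smooth_on f S \<Longrightarrow> smooth_on g S \<Longrightarrow> smooth_on (\<lambda>x. b (f x) (g x)) S"
  unfolding smooth_on_def using Ck_on_bilinear by blast

lemmas smooth_on_mult [smooth_intros] = smooth_on_bilinear[OF bounded_bilinear_mult]
lemmas smooth_on_inner [smooth_intros] = smooth_on_bilinear[OF bounded_bilinear_inner]
lemmas smooth_on_scaleR [smooth_intros] = smooth_on_bilinear[OF bounded_bilinear_scaleR]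

lemma smooth_on_compose:
  "open S \<Longrightarrow> open T \<Longrightarrow> smooth_on g T \<Longrightarrow> smooth_on f S \<Longrightarrow> (\<And>x. x \<in> S \<Longrightarrow> f x \<in> T) \<Longrightarrow> smooth_on (\<lambda>x. g (f x)) S"
  unfolding smooth_on_def using Ck_on_compose[of S T _ f g] by blast

lemma smooth_on_uminus [smooth_intros]:
  "open S \<Longrightarrow> smooth_on f S \<Longrightarrow> smooth_on (\<lambda>x. - f x) S"
  using smooth_on_compose[of S UNIV uminus f] smooth_on_linear[of UNIV uminus]
  by (auto simp: bounded_linear_minus[OF bounded_linear_ident])

lemma smooth_on_diff [smooth_intros]:
  "open S \<Longrightarrow> smooth_on f S \<Longrightarrow> smooth_on g S \<Longrightarrow> smooth_on (\<lambda>x. f x - g x) S"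
  using smooth_on_add[of S f "\<lambda>x. - g x"] smooth_on_uminus[of S g] by simp

lemma smooth_on_prod [smooth_intros]:
  fixes f :: "'i \<Rightarrow> 'a::euclidean_space \<Rightarrow> real"
  shows "open S \<Longrightarrow> (\<And>i. i \<in> I \<Longrightarrow> smooth_on (f i) S) \<Longrightarrow> smooth_on (\<lambda>x. \<Prod>i\<in>I. f i x) S"
  by (induction I rule: infinite_finite_induct) (auto intro!: smooth_intros)

lemma smooth_on_exp_real: "smooth_on (exp :: real \<Rightarrow> real) UNIV"
  unfolding smooth_on_def
proof
  fix k show "Ck_on k (exp :: real \<Rightarrow> real) UNIV"
  proof (induction k)
    case (Suc k)
    show ?case
      by (rule Ck_on_SucI[where f'="\<lambda>x v. exp x * v"])
        (use Suc in \<open>auto intro!: derivative_eq_intros Ck_on_bilinear[OF bounded_bilinear_mult] Ck_on_const\<close>)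
  qed (simp add: continuous_on_exp)
qed

lemma smooth_on_inverse_real: "smooth_on (inverse :: real \<Rightarrow> real) (- {0})"
  unfolding smooth_on_def
proof
  fix k show "Ck_on k (inverse :: real \<Rightarrow> real) (- {0})"
  proof (induction k)
    case (Suc k)
    show ?case
    proof (rule Ck_on_SucI[where f'="\<lambda>x v. (inverse x * inverse x) * (- v)"])
      show "(inverse has_derivative (\<lambda>v. (inverse x * inverse x) * (- v))) (at x)" if "x \<in> - {0}" for x :: real
        using that by (auto intro!: derivative_eq_intros)
      show "Ck_on k (\<lambda>x. (inverse x * inverse x) * (- v)) (- {0})" for v :: real
        by (intro Ck_on_bilinear[OF bounded_bilinear_mult] Ck_on_const Suc) auto
    qed auto
  qed (auto intro!: continuous_intros)
qed

lemma smooth_on_sqrt_real: "smooth_on (sqrt :: real \<Rightarrow> real) {0<..}"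
  unfolding smooth_on_def
proof
  fix k show "Ck_on k (sqrt :: real \<Rightarrow> real) {0<..}"
  proof (induction k)
    case (Suc k)
    have "Ck_on k (\<lambda>x::real. inverse (sqrt x)) {0<..}"
      by (rule Ck_on_compose[where T="-{0}"]) (use Suc smooth_on_inverse_real in \<open>auto simp: smooth_on_def\<close>)
    then have "Ck_on k (\<lambda>x. inverse (sqrt x) * (v / 2)) {0<..}" for v
      by (intro Ck_on_bilinear[OF bounded_bilinear_mult] Ck_on_const) auto
    then show ?case
      by (intro Ck_on_SucI[where f'="\<lambda>x v. inverse (sqrt x) * (v / 2)"])
        (auto intro!: derivative_eq_intros simp: field_simps)
  qed (auto intro!: continuous_intros)
qed

lemma smooth_on_exp [smooth_intros]:
  fixes f :: "'a::euclidean_space \<Rightarrow> real"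
  shows "open S \<Longrightarrow> smooth_on f S \<Longrightarrow> smooth_on (\<lambda>x. exp (f x)) S"
  using smooth_on_compose[OF _ _ smooth_on_exp_real] by simp

lemma smooth_on_divide [smooth_intros]:
  fixes f g :: "'a::euclidean_space \<Rightarrow> real"
  assumes "open S" "smooth_on f S" "smooth_on g S" "\<And>x. x \<in> S \<Longrightarrow> g x \<noteq> 0"
  shows "smooth_on (\<lambda>x. f x / g x) S"
  unfolding divide_inverse using assms
  by (intro smooth_intros smooth_on_compose[OF _ _ smooth_on_inverse_real]) auto

lemma smooth_on_sqrt [smooth_intros]:
  fixes f :: "'a::euclidean_space \<Rightarrow> real"
  assumes "open S" "smooth_on f S" "\<And>x. x \<in> S \<Longrightarrow> f x > 0"
  shows "smooth_on (\<lambda>x. sqrt (f x)) S"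
  using assms by (intro smooth_on_compose[OF _ _ smooth_on_sqrt_real]) auto

text \<open>For \<open>m = 0\<close> this is the classical smooth function that vanishes on the negative half-line. The factor
  \<open>inverse t ^ m\<close> is there because it makes the family closed under differentiation.\<close>

definition flat_exp :: "nat \<Rightarrow> real \<Rightarrow> real" where
  "flat_exp m t = (if t > 0 then inverse t ^ m * exp (- inverse t) else 0)"

lemma flat_exp_tendsto_0: "(flat_exp m \<longlongrightarrow> 0) (at 0)"
proof -
  have "((\<lambda>x::real. x ^ m / exp x) \<longlongrightarrow> 0) at_top" by (rule tendsto_power_div_exp_0)
  then have "((\<lambda>t::real. inverse t ^ m / exp (inverse t)) \<longlongrightarrow> 0) (at_right 0)"
    using filterlim_compose filterlim_inverse_at_top_right by blast
  then have "(flat_exp m \<longlongrightarrow> 0) (at_right 0)"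
    by (rule Lim_transform_eventually)
      (auto simp: eventually_at_right_field flat_exp_def exp_minus field_simps intro!: exI[of _ 1])
  moreover have "(flat_exp m \<longlongrightarrow> 0) (at_left 0)"
    by (rule Lim_transform_eventually[of "\<lambda>_. 0"])
      (auto simp: eventually_at_left_field flat_exp_def intro!: exI[of _ "-1"])
  ultimately show ?thesis by (simp add: filterlim_split_at)
qed

text \<open>At \<open>0\<close> the difference quotient of \<open>flat_exp m\<close> is \<open>flat_exp (Suc m)\<close>, which tends to \<open>0\<close>.\<close>

lemma flat_exp_DERIV:
  "(flat_exp m has_real_derivative (flat_exp (m + 2) t - m * flat_exp (m + 1) t)) (at t)"
proof -
  consider "t > 0" | "t < 0" | "t = 0" by linarith
  then show ?thesis
  proof cases
    case 1
    have "((\<lambda>t. inverse t ^ m * exp (- inverse t)) has_real_derivative (flat_exp (m + 2) t - m * flat_exp (m + 1) t)) (at t)"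
    proof -
      have "inverse t ^ 2 * inverse t ^ m = inverse t ^ (m + 2)"
        "real m * inverse t ^ (m - 1) * (inverse t ^ 2) = m * inverse t ^ (m + 1)"
        by (cases m; simp add: power_add power2_eq_square)+
      then show ?thesis
        using 1 by (auto intro!: derivative_eq_intros simp: flat_exp_def algebra_simps power2_eq_square)
    qed
    then show ?thesis
      by (rule has_field_derivative_transform_within_open[where S="{0<..}"]) (use 1 in \<open>auto simp: flat_exp_def\<close>)
  next
    case 2
    have "((\<lambda>t. 0) has_real_derivative (flat_exp (m + 2) t - m * flat_exp (m + 1) t)) (at t)"
      using 2 by (auto simp: flat_exp_def)
    then show ?thesis
      by (rule has_field_derivative_transform_within_open[where S="{..<0}"]) (use 2 in \<open>auto simp: flat_exp_def\<close>)
  next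
    case 3
    have "((\<lambda>h. (flat_exp m (0 + h) - flat_exp m 0) / h) \<longlongrightarrow> 0) (at 0)"
      by (rule Lim_transform_eventually[OF flat_exp_tendsto_0[of "Suc m"]])
        (auto simp: flat_exp_def eventually_at_filter field_simps)
    then show ?thesis unfolding 3 DERIV_def by (simp add: flat_exp_def)
  qed
qed

lemma smooth_on_flat_exp: "smooth_on (flat_exp m) UNIV"
proof -
  have "Ck_on k (flat_exp m) UNIV" for k
  proof (induction k arbitrary: m)
    case 0
    have "continuous_on UNIV (flat_exp m)"
      using flat_exp_DERIV DERIV_isCont continuous_at_imp_continuous_on by blast
    then show ?case by simp
  next
    case (Suc k)
    show ?case
    proof (rule Ck_on_SucI[where f'="\<lambda>x v. (flat_exp (m+2) x + (- real m) * flat_exp (m+1) x) * v"])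
      show "(flat_exp m has_derivative (\<lambda>v. (flat_exp (m+2) x + (- real m) * flat_exp (m+1) x) * v)) (at x)" for x
        using flat_exp_DERIV[of m x] by (auto simp: has_field_derivative_def)
      show "Ck_on k (\<lambda>x. (flat_exp (m+2) x + (- real m) * flat_exp (m+1) x) * v) UNIV" for v
        by (intro Ck_on_bilinear[OF bounded_bilinear_mult] Ck_on_add Ck_on_const Suc) auto
    qed auto
  qed
  then show ?thesis by (simp add: smooth_on_def)
qed

lemma flat_exp_0: "flat_exp 0 t = (if t > 0 then exp (- inverse t) else 0)"
  by (simp add: flat_exp_def)

lemma flat_exp_nonneg: "0 \<le> flat_exp m t" by (simp add: flat_exp_def)

lemma flat_exp_0_le_1: "flat_exp 0 t \<le> 1" by (simp add: flat_exp_def)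

lemma flat_exp_0_mono:
  assumes "s \<le> t"
  shows "flat_exp 0 s \<le> flat_exp 0 t"
proof (cases "s > 0")
  case True
  then show ?thesis using assms by (simp add: flat_exp_def le_imp_inverse_le)
qed (simp add: flat_exp_def)

lemma flat_exp_2_le: "flat_exp 2 t \<le> 2"
proof (cases "t > 0")
  case True
  let ?x = "inverse t"
  have "1 + ?x + ?x\<^sup>2 / 2 \<le> exp ?x" using True by (intro exp_lower_Taylor_quadratic) simp
  then have "?x\<^sup>2 \<le> 2 * exp ?x" using True by (smt (verit) inverse_positive_iff_positive field_sum_of_halves)
  then have "?x\<^sup>2 * exp (- ?x) \<le> (2 * exp ?x) * exp (- ?x)" by (rule mult_right_mono) simp
  also have "\<dots> = 2" by (simp add: mult.assoc exp_minus_inverse)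
  finally show ?thesis using True by (simp add: flat_exp_def)
qed (simp add: flat_exp_def)

lemma flat_exp_0_DERIV: "(flat_exp 0 has_real_derivative flat_exp 2 t) (at t)"
  using flat_exp_DERIV[of 0 t] by (simp add: numeral_2_eq_2)

section \<open>Change of variables\<close>

text \<open>The change of variables theorem for \<open>real^'n\<close> uses a well-order on \<open>'n\<close>. This type is a well-ordered copy of an
  arbitrary finite index type; relabelling coordinates along a bijection preserves Lebesgue measure and
  determinants, and transports the theorem.\<close>

typedef ('n::finite) ordered_index = "{..<CARD('n)}"
  by (auto intro!: exI[of _ 0] simp: card_gt_0_iff)

lemma ordered_index_UNIV: "(UNIV :: 'n::finite ordered_index set) = Abs_ordered_index ` {..<CARD('n)}"
  using type_definition.Abs_image[OF type_definition_ordered_index[where 'n='n]] by auto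

instance ordered_index :: (finite) finite
  by standard (simp add: ordered_index_UNIV)

instantiation ordered_index :: (finite) wellorder
begin
definition "x \<le> y \<longleftrightarrow> Rep_ordered_index x \<le> Rep_ordered_index y"
definition "x < y \<longleftrightarrow> Rep_ordered_index x < Rep_ordered_index y"
instance
proof
  fix P :: "'a ordered_index \<Rightarrow> bool" and a
  assume *: "\<And>x. (\<And>y. y < x \<Longrightarrow> P y) \<Longrightarrow> P x"
  show "P a"
  proof (induction "Rep_ordered_index a" arbitrary: a rule: less_induct)
    case less
    show ?case by (rule *) (simp add: less less_ordered_index_def)
  qed
qed (auto simp: less_eq_ordered_index_def less_ordered_index_def Rep_ordered_index_inject)
end

lemma card_ordered_index: "CARD('n::finite ordered_index) = CARD('n)"
  using type_definition.card[OF type_definition_ordered_index[where 'n='n]] by simp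

lemma ex_bij_ordered_index: "\<exists>e :: 'n::finite ordered_index \<Rightarrow> 'n. bij e"
  using bij_betw_iff_card[of "UNIV :: 'n ordered_index set" "UNIV :: 'n set"] card_ordered_index by auto

definition relabel :: "('i \<Rightarrow> 'n) \<Rightarrow> 'a^'n \<Rightarrow> 'a^'i" where
  "relabel e x = (\<chi> i. x $ e i)"

lemma relabel_inv: "bij e \<Longrightarrow> relabel (inv e) (relabel e x) = x" "bij e \<Longrightarrow> relabel e (relabel (inv e) y) = y"
  by (auto simp: relabel_def vec_eq_iff bij_is_inj bij_is_surj surj_f_inv_f)

lemma linear_relabel: "linear (relabel e :: real^'n \<Rightarrow> real^'i)"
  by (rule linearI) (auto simp: relabel_def vec_eq_iff)

lemma measurable_relabel [measurable]:
  "(relabel e :: real^'n \<Rightarrow> real^'i) \<in> borel_measurable borel"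
proof (rule borel_measurable_continuous_onI)
  have "bounded_linear (relabel e :: real^'n \<Rightarrow> real^'i)"
    using linear_relabel linear_conv_bounded_linear by blast
  then show "continuous_on UNIV (relabel e :: real^'n \<Rightarrow> real^'i)"
    by (rule linear_continuous_on)
qed

lemma relabel_axis: "bij e \<Longrightarrow> relabel (inv e) (axis j 1) = axis (e j) 1"
  by (auto simp: relabel_def vec_eq_iff axis_def bij_is_inj bij_is_surj surj_f_inv_f)

lemma prod_Basis_vec: "(\<Prod>b\<in>Basis. x \<bullet> b) = (\<Prod>i\<in>UNIV. x $ i)" for x :: "real^'n"
proof -
  have "(\<Prod>b\<in>Basis. x \<bullet> b) = (\<Prod>b\<in>(\<lambda>i. axis i 1) ` UNIV. x \<bullet> b)"
    by (rule prod.cong) (auto simp: Basis_vec_def)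
  also have "\<dots> = (\<Prod>i\<in>UNIV. x $ i)"
    by (subst prod.reindex) (auto simp: inj_def axis_eq_axis inner_axis)
  finally show ?thesis .
qed

lemma distr_lborel_relabel:
  fixes e :: "'i::finite \<Rightarrow> 'n::finite"
  assumes "bij e"
  shows "distr lborel borel (relabel e :: real^'n \<Rightarrow> real^'i) = lborel"
proof (rule lborel_eqI[symmetric])
  fix l u :: "real^'i" assume lu: "\<And>b. b \<in> Basis \<Longrightarrow> l \<bullet> b \<le> u \<bullet> b"
  let ?l = "relabel (inv e) l" and ?u = "relabel (inv e) u"
  have "relabel e -` box l u = box ?l ?u"
  proof -
    have "(\<forall>i. l $ i < x $ e i \<and> x $ e i < u $ i) \<longleftrightarrow> (\<forall>j. l $ inv e j < x $ j \<and> x $ j < u $ inv e j)" for x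
      using assms by (metis bij_inv_eq_iff)
    then show ?thesis by (auto simp: relabel_def mem_box_cart)
  qed
  moreover have "?l $ j \<le> ?u $ j" for j
    using lu[of "axis (inv e j) 1"] by (auto simp: relabel_def inner_axis)
  ultimately have "emeasure (distr lborel borel (relabel e :: real^'n \<Rightarrow> real^'i)) (box l u) = (\<Prod>b\<in>Basis. (?u - ?l) \<bullet> b)"
    by (subst emeasure_distr) (auto simp: emeasure_lborel_box_eq Basis_vec_def inner_axis)
  also have "(\<Prod>b\<in>Basis. (?u - ?l) \<bullet> b) = (\<Prod>j\<in>UNIV. (u - l) $ inv e j)"
    by (simp add: prod_Basis_vec relabel_def)
  also have "\<dots> = (\<Prod>i\<in>UNIV. (u - l) $ i)"
    using assms by (intro prod.reindex_bij_betw bij_imp_bij_inv)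
  finally show "emeasure (distr lborel borel (relabel e :: real^'n \<Rightarrow> real^'i)) (box l u) = (\<Prod>b\<in>Basis. (u - l) \<bullet> b)"
    by (simp add: prod_Basis_vec)
qed simp

lemma det_relabel:
  fixes A :: "real^'n^'n" and e :: "'i::finite \<Rightarrow> 'n::finite"
  assumes "bij e"
  shows "det (\<chi> i j. A $ e i $ e j) = det A"
proof -
  have inj: "inj e" and im: "bij_betw e UNIV UNIV" using assms by (auto simp: bij_is_inj)
  let ?m = "map_permutation UNIV e"
  have bm: "bij_betw ?m {p. p permutes UNIV} {p. p permutes UNIV}"
  proof (rule bij_betwI[where g="map_permutation UNIV (inv e)"])
    show "?m \<in> {p. p permutes UNIV} \<rightarrow> {p. p permutes UNIV}"
      using map_permutation_permutes[OF im] by auto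
    show "map_permutation UNIV (inv e) \<in> {p. p permutes UNIV} \<rightarrow> {p. p permutes UNIV}"
      using map_permutation_permutes[OF bij_imp_bij_inv[OF assms]] by auto
    show "map_permutation UNIV (inv e) (?m p) = p" if "p \<in> {p. p permutes UNIV}" for p
      using that assms by (intro map_permutation_compose_inv[OF im]) (auto simp: bij_is_inj)
    show "?m (map_permutation UNIV (inv e) p) = p" if "p \<in> {p. p permutes UNIV}" for p
      using that assms by (intro map_permutation_compose_inv[OF bij_imp_bij_inv[OF assms]])
        (auto simp: bij_is_surj surj_f_inv_f)
  qed
  have "det A = (\<Sum>p | p permutes UNIV. of_int (sign (?m p)) * (\<Prod>j\<in>UNIV. A $ j $ (?m p) j))"
    unfolding det_def by (rule sum.reindex_bij_betw[OF bm, symmetric])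
  also have "\<dots> = (\<Sum>p | p permutes UNIV. of_int (sign p) * (\<Prod>i\<in>UNIV. A $ e i $ e (p i)))"
  proof (rule sum.cong[OF refl])
    fix p :: "'i \<Rightarrow> 'i" assume p: "p \<in> {p. p permutes UNIV}"
    have "(\<Prod>j\<in>UNIV. A $ j $ (?m p) j) = (\<Prod>i\<in>UNIV. A $ e i $ (?m p) (e i))"
      using assms by (intro prod.reindex_bij_betw[symmetric])
    then show "of_int (sign (?m p)) * (\<Prod>j\<in>UNIV. A $ j $ (?m p) j) = of_int (sign p) * (\<Prod>i\<in>UNIV. A $ e i $ e (p i))"
      using p sign_map_permutation[OF inj, of p] map_permutation_apply[OF inj] by auto
  qed
  also have "\<dots> = det (\<chi> i j. A $ e i $ e j)" by (simp add: det_def)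
  finally show ?thesis by simp
qed

text \<open>The image has finite measure exactly if the integral is finite, so the equation also holds in the value
  \<open>\<infinity>\<close>.\<close>

lemma emeasure_differentiable_image_wellorder:
  fixes f :: "real^'n::{finite,wellorder} \<Rightarrow> real^'n::_"
  assumes S: "S \<in> sets borel" and fS: "f ` S \<in> sets borel"
    and der: "\<And>x. x \<in> S \<Longrightarrow> (f has_derivative f' x) (at x within S)"
    and inj: "inj_on f S"
    and meas: "(\<lambda>x. indicator S x * \<bar>det (matrix (f' x))\<bar>) \<in> borel_measurable borel"
  shows "emeasure lborel (f ` S) = (\<integral>\<^sup>+x. ennreal (indicator S x * \<bar>det (matrix (f' x))\<bar>) \<partial>lborel)"
proof -
  let ?d = "\<lambda>x. \<bar>det (matrix (f' x))\<bar>"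
  have S': "S \<in> sets lebesgue" using S by auto
  show ?thesis
  proof (cases "?d integrable_on S")
    case True
    then obtain r where r: "(?d has_integral r) S" by (auto simp: integrable_on_def)
    have "f ` S \<in> lmeasurable" "measure lebesgue (f ` S) = r"
      using has_measure_differentiable_image[OF S' der inj] r by auto
    then have "emeasure lebesgue (f ` S) = ennreal r"
      by (metis emeasure_eq_measure2 fmeasurableD2 top.not_eq_extremum)
    then have "emeasure lborel (f ` S) = ennreal r" using fS by simp
    moreover have "(\<integral>\<^sup>+x. ennreal (indicator S x * ?d x) \<partial>lborel) = ennreal r"
      using nn_integral_has_integral_lebesgue[OF _ r] by simp
    ultimately show ?thesis by simp
  next
    case False
    then have "f ` S \<notin> lmeasurable" using measurable_differentiable_image_eq[OF S' der inj] by auto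
    moreover have "emeasure lebesgue (f ` S) = emeasure lborel (f ` S)" "f ` S \<in> sets lebesgue"
      using fS by auto
    ultimately have 1: "emeasure lborel (f ` S) = \<infinity>"
      by (metis fmeasurableI infinity_ennreal_def top.not_eq_extremum)
    have "(\<integral>\<^sup>+x. ennreal (indicator S x * ?d x) \<partial>lborel) = \<infinity>"
    proof (rule ccontr)
      assume "\<not> ?thesis"
      then obtain r where "0 \<le> r" "(\<integral>\<^sup>+x. ennreal (indicator S x * ?d x) \<partial>lborel) = ennreal r"
        by (cases "\<integral>\<^sup>+x. ennreal (indicator S x * ?d x) \<partial>lborel") auto
      then have "((\<lambda>x. indicator S x * ?d x) has_integral r) UNIV"
        using meas by (intro nn_integral_has_integral) auto
      moreover have "(\<lambda>x. indicator S x * ?d x) = (\<lambda>x. if x \<in> S then ?d x else 0)"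
        by (auto simp: indicator_def)
      ultimately have "(?d has_integral r) S"
        using has_integral_restrict_UNIV[of S ?d r] by simp
      with False show False by auto
    qed
    with 1 show ?thesis by simp
  qed
qed

lemma emeasure_differentiable_image:
  fixes f :: "real^'n \<Rightarrow> real^'n"
  assumes S: "S \<in> sets borel" and fS: "f ` S \<in> sets borel"
    and der: "\<And>x. x \<in> S \<Longrightarrow> (f has_derivative f' x) (at x)"
    and inj: "inj_on f S"
    and meas: "(\<lambda>x. indicator S x * \<bar>det (matrix (f' x))\<bar>) \<in> borel_measurable borel"
  shows "emeasure lborel (f ` S) = (\<integral>\<^sup>+x. ennreal (indicator S x * \<bar>det (matrix (f' x))\<bar>) \<partial>lborel)"
proof -
  obtain e :: "'n ordered_index \<Rightarrow> 'n" where e: "bij e" using ex_bij_ordered_index by auto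
  define L M where "L = (relabel e :: real^'n \<Rightarrow> _)" and "M = (relabel (inv e) :: _ \<Rightarrow> real^'n)"
  have LM: "L (M y) = y" "M (L x) = x" for x y using relabel_inv[OF e] by (auto simp: L_def M_def)
  have lin: "bounded_linear L" "bounded_linear M"
    by (auto simp: L_def M_def linear_relabel linear_conv_bounded_linear[symmetric])
  have mL [measurable]: "L \<in> borel_measurable borel" and mM [measurable]: "M \<in> borel_measurable borel"
    by (simp_all add: L_def M_def)
  have dL: "distr lborel borel L = lborel" and dM: "distr lborel borel M = lborel"
    using distr_lborel_relabel[OF e] distr_lborel_relabel[OF bij_imp_bij_inv[OF e]] by (auto simp: L_def M_def)
  define h where "h = (\<lambda>y. L (f (M y)))"
  define h' where "h' = (\<lambda>y v. L (f' (M y) (M v)))"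
  define S' where "S' = M -` S"
  have S': "S' \<in> sets borel" unfolding S'_def using S mM by (metis measurable_sets_borel)
  have hS': "h ` S' = M -` (f ` S)"
  proof (intro set_eqI iffI)
    show "x \<in> M -` f ` S" if "x \<in> h ` S'" for x using that by (auto simp: h_def S'_def LM)
    show "x \<in> h ` S'" if x: "x \<in> M -` f ` S" for x
    proof -
      obtain z where z: "M x = f z" "z \<in> S" using x by auto
      have "x = h (L z)" using z(1) LM by (metis h_def)
      moreover have "L z \<in> S'" using z(2) by (simp add: S'_def LM)
      ultimately show ?thesis by blast
    qed
  qed
  have det_eq: "det (matrix (h' y)) = det (matrix (f' (M y)))" for y
  proof -
    have "matrix (h' y) = (\<chi> i j. matrix (f' (M y)) $ e i $ e j)"
      by (simp add: matrix_def h'_def vec_eq_iff L_def M_def relabel_axis[OF e]) (simp add: relabel_def)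
    then show ?thesis using det_relabel[OF e] by simp
  qed
  have "emeasure lborel (f ` S) = emeasure lborel (M -` (f ` S))"
    using emeasure_distr[of M lborel borel "f ` S"] fS dM by simp
  also have "\<dots> = emeasure lborel (h ` S')" using hS' by simp
  also have "\<dots> = (\<integral>\<^sup>+y. ennreal (indicator S' y * \<bar>det (matrix (h' y))\<bar>) \<partial>lborel)"
  proof (rule emeasure_differentiable_image_wellorder[OF S'])
    show "h ` S' \<in> sets borel" unfolding hS' using fS mM by (metis measurable_sets_borel)
    show "(h has_derivative h' x) (at x within S')" if "x \<in> S'" for x
    proof -
      have "(f has_derivative f' (M x)) (at (M x))" using der that by (auto simp: S'_def)
      then have "((\<lambda>y. f (M y)) has_derivative (\<lambda>v. f' (M x) (M v))) (at x)"
        using has_derivative_compose[OF bounded_linear_imp_has_derivative[OF lin(2)]] by blast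
      then have "(h has_derivative h' x) (at x)"
        unfolding h_def h'_def by (rule bounded_linear.has_derivative[OF lin(1)])
      then show ?thesis by (rule has_derivative_at_withinI)
    qed
    show "inj_on h S'"
      using inj LM unfolding inj_on_def h_def S'_def by (metis vimageE)
    have "(\<lambda>y. indicator S' y * \<bar>det (matrix (h' y))\<bar>) = (\<lambda>x. indicator S x * \<bar>det (matrix (f' x))\<bar>) \<circ> M"
      by (auto simp: det_eq S'_def indicator_def)
    then show "(\<lambda>y. indicator S' y * \<bar>det (matrix (h' y))\<bar>) \<in> borel_measurable borel"
      using meas mM by (simp only: measurable_comp)
  qed
  also have "\<dots> = (\<integral>\<^sup>+y. ennreal (indicator S (M y) * \<bar>det (matrix (f' (M y)))\<bar>) \<partial>lborel)"
    by (simp add: det_eq S'_def indicator_def)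
  also have "\<dots> = (\<integral>\<^sup>+x. ennreal (indicator S x * \<bar>det (matrix (f' x))\<bar>) \<partial>distr lborel borel M)"
    using meas by (subst nn_integral_distr) auto
  finally show ?thesis by (simp only: dM)
qed

text \<open>The measure formula for images says that the density \<open>\<bar>det f'\<bar>\<close> on \<open>U\<close> is pushed forward by \<open>f\<close> to Lebesgue
  measure on \<open>f ` U\<close>; integrating \<open>h\<close> against both measures gives the formula. The continuous inverse \<open>g\<close> provides
  injectivity.\<close>

theorem nn_integral_change_of_variables:
  fixes f :: "real^'n \<Rightarrow> real^'n" and h :: "real^'n \<Rightarrow> ennreal"
  assumes U: "open U" "open (f ` U)"
    and der: "\<And>x. x \<in> U \<Longrightarrow> (f has_derivative f' x) (at x)"
    and det: "continuous_on U (\<lambda>x. det (matrix (f' x)))"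
    and g: "continuous_on (f ` U) g" "\<And>x. x \<in> U \<Longrightarrow> g (f x) = x"
    and h [measurable]: "h \<in> borel_measurable borel"
  shows "(\<integral>\<^sup>+y. indicator (f ` U) y * h y \<partial>lborel) =
         (\<integral>\<^sup>+x. indicator U x * (ennreal \<bar>det (matrix (f' x))\<bar> * h (f x)) \<partial>lborel)"
proof -
  define F where "F = (\<lambda>x. if x \<in> U then f x else 0)"
  define d where "d = (\<lambda>x. if x \<in> U then \<bar>det (matrix (f' x))\<bar> else 0)"
  have [measurable]: "U \<in> sets borel" "f ` U \<in> sets borel" using U by auto
  have cf: "continuous_on U f"
    by (intro continuous_at_imp_continuous_on ballI has_derivative_continuous[OF der])
  have [measurable]: "F \<in> borel_measurable borel" unfolding F_def
    by (intro borel_measurable_continuous_on_if) (auto intro: cf U)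
  have dm [measurable]: "d \<in> borel_measurable borel" unfolding d_def
    by (intro borel_measurable_continuous_on_if) (auto intro!: det U continuous_intros)
  have inj: "inj_on f U" by (rule inj_on_inverseI[of _ g]) (use g in auto)
  have "distr (density lborel d) borel F = density lborel (indicator (f ` U))"
  proof (rule measure_eqI)
    fix B assume "B \<in> sets (distr (density lborel d) borel F)"
    then have B [measurable]: "B \<in> sets borel" by simp
    let ?S = "U \<inter> F -` B"
    have S: "?S \<in> sets borel"
      by (intro sets.Int measurable_sets_borel[of F borel]) auto
    have fS: "f ` ?S = f ` U \<inter> B" by (auto simp: F_def)
    have ind: "indicator ?S x * \<bar>det (matrix (f' x))\<bar> = d x * indicator (F -` B) x" for x
      by (auto simp: d_def indicator_def)
    have [measurable]: "F -` B \<in> sets borel" by (intro measurable_sets_borel[of F borel]) auto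
    have "emeasure lborel (f ` ?S) = (\<integral>\<^sup>+x. ennreal (indicator ?S x * \<bar>det (matrix (f' x))\<bar>) \<partial>lborel)"
      by (rule emeasure_differentiable_image[OF S])
        (use inj in \<open>auto simp: fS ind intro!: der intro: inj_on_subset\<close>)
    also have "\<dots> = (\<integral>\<^sup>+x. ennreal (d x) * indicator (F -` B) x \<partial>lborel)"
      by (rule nn_integral_cong) (auto simp: ind indicator_def d_def)
    also have "\<dots> = emeasure (distr (density lborel d) borel F) B"
      by (subst emeasure_distr) (auto simp: emeasure_density)
    finally show "emeasure (distr (density lborel d) borel F) B = emeasure (density lborel (indicator (f ` U))) B"
      by (subst emeasure_density) (auto simp: fS emeasure_density indicator_inter_arith[symmetric])
  qed simp
  then have "(\<integral>\<^sup>+y. h y \<partial>density lborel (indicator (f ` U))) = (\<integral>\<^sup>+y. h y \<partial>distr (density lborel d) borel F)"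
    by simp
  also have "\<dots> = (\<integral>\<^sup>+x. ennreal (d x) * h (F x) \<partial>lborel)"
    by (simp add: nn_integral_distr nn_integral_density)
  also have "\<dots> = (\<integral>\<^sup>+x. indicator U x * (ennreal \<bar>det (matrix (f' x))\<bar> * h (f x)) \<partial>lborel)"
    by (rule nn_integral_cong) (auto simp: d_def F_def)
  finally show ?thesis by (simp add: nn_integral_density)
qed

section \<open>Gram matrices and the derivative of the determinant\<close>

text \<open>For the derivative \<open>D\<close> of a parametrization this is the matrix \<open>g\<^sub>i\<^sub>j\<close> of the induced metric.\<close>

definition gram :: "(real^'n \<Rightarrow> 'b::real_inner) \<Rightarrow> real^'n^'n" where
  "gram D = (\<chi> i j. D (axis i 1) \<bullet> D (axis j 1))"

definition gram_inv :: "(real^'n \<Rightarrow> 'b::real_inner) \<Rightarrow> real^'n^'n" where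
  "gram_inv D = matrix_inv (gram D)"

lemma linear_axis_expansion:
  fixes D :: "real^'n \<Rightarrow> 'b::real_vector"
  assumes "linear D"
  shows "D v = (\<Sum>i\<in>UNIV. v $ i *\<^sub>R D (axis i 1))"
proof -
  interpret linear D by fact
  have "D v = D (\<Sum>i\<in>UNIV. v $ i *\<^sub>R axis i 1)"
    using basis_expansion[of v] by (simp add: scalar_mult_eq_scaleR)
  then show ?thesis by (simp add: sum scaleR)
qed

lemma gram_mult_vec:
  assumes "linear D"
  shows "(gram D *v w) $ i = D (axis i 1) \<bullet> D w"
  by (subst (2) linear_axis_expansion[OF assms])
    (simp add: gram_def matrix_vector_mult_def inner_sum_right mult.commute)

lemma gram_quadratic:
  assumes "linear D"
  shows "v \<bullet> (gram D *v w) = D v \<bullet> D w"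
  by (subst linear_axis_expansion[OF assms, of v]) (simp add: inner_vec_def gram_mult_vec[OF assms] inner_sum_left)

text \<open>The segment from the identity to \<open>gram D\<close> consists of positive definite, hence invertible, matrices, so the
  determinant keeps the sign that it has at the identity.\<close>

lemma det_gram_pos:
  assumes "linear D" "inj D"
  shows "det (gram D) > 0"
proof (rule ccontr)
  \<comment> \<open>The intermediate value theorem gives a singular matrix on the segment.\<close>
  let ?A = "\<lambda>t::real. (1 - t) *\<^sub>R mat 1 + t *\<^sub>R gram D"
  assume "\<not> ?thesis"
  moreover have "continuous_on {0..1} (\<lambda>t. det (?A t))"
    unfolding det_def by (intro continuous_intros)
  ultimately obtain t where t: "0 \<le> t" "t \<le> 1" "det (?A t) = 0"
    using IVT2'[of "\<lambda>t. det (?A t)" 1 0 0] by auto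
  then have "\<not> (\<exists>B. B ** ?A t = mat 1)"
    using invertible_det_nz[of "?A t"] invertible_left_inverse by blast
  then obtain x where x: "?A t *v x = 0" "x \<noteq> 0"
    using matrix_left_invertible_ker[of "?A t"] by blast
  have "x \<bullet> (?A t *v x) = (1 - t) * (x \<bullet> x) + t * (D x \<bullet> D x)"
    by (simp add: matrix_vector_mult_add_rdistrib scaleR_matrix_vector_assoc[symmetric] inner_add_right gram_quadratic[OF assms(1)])
  moreover have "D x \<noteq> 0" using assms x(2) linear_injective_0[OF assms(1)] by blast
  then have "D x \<bullet> D x > 0" "x \<bullet> x > 0" using x(2) by auto
  then have "(1 - t) * (x \<bullet> x) + t * (D x \<bullet> D x) > 0"
    using t by (cases "t = 0") (auto intro!: add_nonneg_pos)
  ultimately show False using x(1) by simp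
qed

lemma gram_sym: "gram D $ i $ j = gram D $ j $ i"
  by (simp add: gram_def inner_commute)

lemma gram_inv_inverse:
  assumes "linear D" "inj D"
  shows "gram_inv D ** gram D = mat 1" "gram D ** gram_inv D = mat 1"
proof -
  have "invertible (gram D)" using det_gram_pos[OF assms] invertible_det_nz by force
  then have "gram D ** gram_inv D = mat 1 \<and> gram_inv D ** gram D = mat 1"
    unfolding gram_inv_def matrix_inv_def invertible_def by (rule someI_ex)
  then show "gram_inv D ** gram D = mat 1" "gram D ** gram_inv D = mat 1" by auto
qed

lemma gram_inv_sym:
  assumes "linear D" "inj D"
  shows "gram_inv D $ i $ j = gram_inv D $ j $ i"
proof -
  have "transpose (gram D) = gram D" by (simp add: transpose_def vec_eq_iff gram_sym)
  then have "gram D ** transpose (gram_inv D) = mat 1"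
    by (metis gram_inv_inverse(1)[OF assms] matrix_transpose_mul transpose_mat)
  then have "transpose (gram_inv D) = gram_inv D"
    by (metis gram_inv_inverse(1)[OF assms] matrix_mul_assoc matrix_mul_lid matrix_mul_rid)
  then have "transpose (gram_inv D) $ j $ i = gram_inv D $ j $ i" by simp
  then show ?thesis by (simp add: transpose_def)
qed

text \<open>In coordinates this is \<open>g\<^sup>-\<^sup>1 (g w) = w\<close>, the form in which the inverse matrix is used from here on: the
  coordinates of a tangent vector \<open>D w\<close> are recovered from its inner products with the coordinate vectors.\<close>

lemma gram_inv_apply:
  assumes "linear D" "inj D"
  shows "(\<Sum>j\<in>UNIV. gram_inv D $ i $ j * (D (axis j 1) \<bullet> D w)) = w $ i"
proof -
  have "gram_inv D *v (gram D *v w) = w"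
    by (simp add: matrix_vector_mul_assoc gram_inv_inverse[OF assms])
  then have "(gram_inv D *v (gram D *v w)) $ i = w $ i" by simp
  then show ?thesis by (simp add: matrix_vector_mult_def[of "gram_inv D"] gram_mult_vec[OF assms(1)])
qed

lemma gram_inv_axis:
  assumes "linear D" "inj D"
  shows "(\<Sum>j\<in>UNIV. gram_inv D $ i $ j * (D (axis j 1) \<bullet> D (axis k 1))) = (if i = k then 1 else 0)"
  by (simp add: gram_inv_apply[OF assms]) (simp add: axis_def)

text \<open>The orthogonal projection to the range of an injective \<open>D\<close>.\<close>

definition tangential :: "(real^'n \<Rightarrow> 'b::real_inner) \<Rightarrow> 'b \<Rightarrow> 'b" where
  "tangential D v = (\<Sum>i\<in>UNIV. \<Sum>j\<in>UNIV. (gram_inv D $ i $ j * (v \<bullet> D (axis i 1))) *\<^sub>R D (axis j 1))"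

lemma tangential_range: "linear D \<Longrightarrow> tangential D v \<in> range D"
  unfolding tangential_def
  by (intro subspace_sum subspace_scale linear_subspace_image subspace_UNIV) auto

lemma tangential_inner:
  assumes "linear D" "inj D"
  shows "(v - tangential D v) \<bullet> D w = 0"
proof -
  have "tangential D v \<bullet> D w = (\<Sum>i\<in>UNIV. (v \<bullet> D (axis i 1)) * (\<Sum>j\<in>UNIV. gram_inv D $ i $ j * (D (axis j 1) \<bullet> D w)))"
    by (simp add: tangential_def inner_sum_left sum_distrib_left mult_ac)
  also have "\<dots> = (\<Sum>i\<in>UNIV. (v \<bullet> D (axis i 1)) * w $ i)"
    by (simp add: gram_inv_apply[OF assms])
  also have "\<dots> = v \<bullet> D w"
    by (subst linear_axis_expansion[OF assms(1)]) (simp add: inner_sum_right mult.commute)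
  finally show ?thesis by (simp add: inner_diff_left)
qed

lemma tangential_linear: "linear (tangential D)"
proof (rule linearI)
  show "tangential D (x + y) = tangential D x + tangential D y" for x y
    unfolding tangential_def inner_add_left distrib_left scaleR_add_left sum.distrib ..
  show "tangential D (r *\<^sub>R x) = r *\<^sub>R tangential D x" for r x
    unfolding tangential_def inner_scaleR_left scaleR_sum_right scaleR_scaleR
    by (intro sum.cong refl arg_cong2[where f=scaleR]) simp
qed

lemma tangential_id:
  assumes "linear D" "inj D"
  shows "tangential D (D v) = D v"
proof -
  let ?X = "D v - tangential D (D v)"
  obtain w where w: "tangential D (D v) = D w" using tangential_range[OF assms(1)] by blast
  have "?X = D (v - w)" using linear_diff[OF assms(1)] w by simp
  then have "?X \<bullet> ?X = 0" using tangential_inner[OF assms, of "D v" "v - w"] by simp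
  then show ?thesis by simp
qed

lemma parseval:
  fixes x y :: "'b::euclidean_space"
  assumes "pairwise orthogonal B" "\<And>e. e \<in> B \<Longrightarrow> norm e = 1" "x \<in> span B"
  shows "(\<Sum>e\<in>B. (x \<bullet> e) * (y \<bullet> e)) = x \<bullet> y"
proof -
  have "finite B" using assms(1) pairwise_orthogonal_imp_finite by auto
  then have "(\<Sum>e\<in>B. (x \<bullet> e) *\<^sub>R e) = x"
    using orthonormal_basis_expand[OF assms(1)] assms(2,3) by blast
  then have "x \<bullet> y = (\<Sum>e\<in>B. (x \<bullet> e) *\<^sub>R e) \<bullet> y" by simp
  also have "\<dots> = (\<Sum>e\<in>B. (x \<bullet> e) * (e \<bullet> y))" by (simp add: inner_sum_left)
  finally show ?thesis by (simp only: inner_commute[of y])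
qed

text \<open>The coordinate vectors of an orthonormal basis form a matrix \<open>C\<close> with \<open>C C\<^sup>T = g\<^sup>-\<^sup>1\<close>. Hence traces over an
  orthonormal basis of the tangent space depend only on the Gram matrix, and not on the basis.\<close>

lemma trace_onb:
  fixes D :: "real^'n \<Rightarrow> 'b::euclidean_space" and \<beta> :: "real^'n \<Rightarrow> real^'n \<Rightarrow> 'c::real_vector"
  assumes D: "linear D" "inj D"
    and B: "pairwise orthogonal B" "\<And>e. e \<in> B \<Longrightarrow> norm e = 1" "span B = range D"
    and \<beta>: "\<And>v. linear (\<beta> v)" "\<And>w. linear (\<lambda>v. \<beta> v w)"
  shows "(\<Sum>e\<in>B. \<beta> (inv D e) (inv D e)) =
    (\<Sum>i\<in>UNIV. \<Sum>j\<in>UNIV. gram_inv D $ i $ j *\<^sub>R \<beta> (axis i 1) (axis j 1))"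
proof -
  let ?g = "\<lambda>i j. gram_inv D $ i $ j" and ?D = "\<lambda>i. D (axis i 1)"
  have c: "inv D e $ i = (\<Sum>j\<in>UNIV. ?g i j * (?D j \<bullet> e))" if "e \<in> B" for e i
  proof -
    have "e \<in> range D" using that B(3) span_base by blast
    then have "D (inv D e) = e" by (simp add: f_inv_into_f)
    then show ?thesis using gram_inv_apply[OF D, of i "inv D e"] by simp
  qed
  have g: "(\<Sum>e\<in>B. inv D e $ i * inv D e $ k) = ?g i k" for i k
  proof -
    have "(\<Sum>e\<in>B. inv D e $ i * inv D e $ k) = (\<Sum>e\<in>B. \<Sum>j\<in>UNIV. \<Sum>l\<in>UNIV. ?g i j * ?g k l * ((?D j \<bullet> e) * (?D l \<bullet> e)))"
      by (rule sum.cong[OF refl]) (simp add: c sum_product mult_ac)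
    also have "\<dots> = (\<Sum>j\<in>UNIV. \<Sum>l\<in>UNIV. \<Sum>e\<in>B. ?g i j * ?g k l * ((?D j \<bullet> e) * (?D l \<bullet> e)))"
      by (simp only: sum.swap[of _ _ B])
    also have "\<dots> = (\<Sum>j\<in>UNIV. \<Sum>l\<in>UNIV. ?g i j * (?g k l * (?D l \<bullet> ?D j)))"
      by (simp only: sum_distrib_left[symmetric])
        (subst parseval[OF B(1,2)], auto simp: B(3) inner_commute mult_ac sum_distrib_left)
    also have "\<dots> = (\<Sum>j\<in>UNIV. ?g i j * (if k = j then 1 else 0))"
      by (simp only: sum_distrib_left[symmetric] gram_inv_axis[OF D])
    also have "\<dots> = ?g i k" by (simp add: if_distrib cong: if_cong)
    finally show ?thesis .
  qed
  have "\<beta> v v = (\<Sum>i\<in>UNIV. \<Sum>k\<in>UNIV. (v $ i * v $ k) *\<^sub>R \<beta> (axis i 1) (axis k 1))" for v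
    by (subst linear_axis_expansion[OF \<beta>(1)], subst linear_axis_expansion[OF \<beta>(2)])
      (subst sum.swap, simp add: scaleR_sum_right mult.commute)
  then have "(\<Sum>e\<in>B. \<beta> (inv D e) (inv D e)) =
      (\<Sum>e\<in>B. \<Sum>i\<in>UNIV. \<Sum>k\<in>UNIV. (inv D e $ i * inv D e $ k) *\<^sub>R \<beta> (axis i 1) (axis k 1))"
    by (intro sum.cong[OF refl])
  also have "\<dots> = (\<Sum>i\<in>UNIV. \<Sum>k\<in>UNIV. \<Sum>e\<in>B. (inv D e $ i * inv D e $ k) *\<^sub>R \<beta> (axis i 1) (axis k 1))"
    by (simp only: sum.swap[of _ _ B])
  finally show ?thesis by (simp only: scaleR_sum_left[symmetric] g)
qed

lemma det_gram_compose:
  assumes "linear D" "linear J"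
  shows "det (gram (\<lambda>v. D (J v))) = (det (matrix J))\<^sup>2 * det (gram D)"
proof -
  have "gram (\<lambda>v. D (J v)) = transpose (matrix J) ** (gram D ** matrix J)"
  proof -
    have "gram (\<lambda>v. D (J v)) $ i $ j = (transpose (matrix J) ** (gram D ** matrix J)) $ i $ j" for i j
    proof -
      have "gram (\<lambda>v. D (J v)) $ i $ j = J (axis i 1) \<bullet> (gram D *v J (axis j 1))"
        by (simp add: gram_quadratic[OF assms(1)]) (simp add: gram_def)
      also have "\<dots> = (transpose (matrix J) ** (gram D ** matrix J)) $ i $ j"
        by (simp add: inner_vec_def matrix_vector_mult_def matrix_matrix_mult_def transpose_def matrix_def)
      finally show ?thesis .
    qed
    then show ?thesis by (simp add: vec_eq_iff)
  qed
  then show ?thesis by (simp add: det_mul power2_eq_square)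
qed

text \<open>Jacobi's formula. Differentiating the product in each summand of the determinant replaces one row by its
  derivative. That row is a combination of the rows of \<open>A x\<close> with coefficients \<open>A' G\<close>, and by Cramer's rule only
  its own coefficient survives.\<close>

lemma has_derivative_det:
  fixes A :: "'a::real_normed_vector \<Rightarrow> real^'n^'n"
  assumes der: "\<And>i j. ((\<lambda>x. A x $ i $ j) has_derivative A' i j) (at x)"
    and G: "G ** A x = mat 1"
  shows "((\<lambda>x. det (A x)) has_derivative
    (\<lambda>v. det (A x) * (\<Sum>i\<in>UNIV. \<Sum>j\<in>UNIV. A' i j v * G $ j $ i))) (at x)"
proof -
  let ?P = "{p. p permutes (UNIV :: 'n set)}"
  have "((\<lambda>x. det (A x)) has_derivative
    (\<lambda>v. \<Sum>p\<in>?P. of_int (sign p) * (\<Sum>k\<in>UNIV. A' k (p k) v * (\<Prod>i\<in>UNIV - {k}. A x $ i $ p i)))) (at x)"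
    unfolding det_def
    by (intro has_derivative_sum has_derivative_mult_right has_derivative_prod der)
  moreover have "(\<Sum>p\<in>?P. of_int (sign p) * (\<Sum>k\<in>UNIV. A' k (p k) v * (\<Prod>i\<in>UNIV - {k}. A x $ i $ p i))) =
      det (A x) * (\<Sum>i\<in>UNIV. \<Sum>j\<in>UNIV. A' i j v * G $ j $ i)" for v
  proof -
    have row: "(\<Sum>p\<in>?P. of_int (sign p) * (A' k (p k) v * (\<Prod>i\<in>UNIV - {k}. A x $ i $ p i))) =
        (\<Sum>j\<in>UNIV. A' k j v * G $ j $ k) * det (A x)" for k
    proof -
      define c :: "real^'n" where "c = (\<chi> m. \<Sum>j\<in>UNIV. A' k j v * G $ j $ m)"
      have c: "(\<Sum>m\<in>UNIV. c $ m *s row m (A x)) = (\<chi> j. A' k j v)"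
      proof -
        have "(\<Sum>m\<in>UNIV. c $ m * A x $ m $ l) = A' k l v" for l
        proof -
          have "(\<Sum>m\<in>UNIV. c $ m * A x $ m $ l) = (\<Sum>j\<in>UNIV. \<Sum>m\<in>UNIV. A' k j v * (G $ j $ m * A x $ m $ l))"
            by (simp only: c_def vec_lambda_beta sum_distrib_right mult.assoc) (rule sum.swap)
          also have "\<dots> = (\<Sum>j\<in>UNIV. A' k j v * (G ** A x) $ j $ l)"
            by (simp add: matrix_matrix_mult_def sum_distrib_left)
          also have "\<dots> = A' k l v" by (simp add: G mat_def if_distrib cong: if_cong)
          finally show ?thesis .
        qed
        then show ?thesis by (simp add: vec_eq_iff row_def)
      qed
      have "(\<Sum>p\<in>?P. of_int (sign p) * (A' k (p k) v * (\<Prod>i\<in>UNIV - {k}. A x $ i $ p i))) =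
          det (\<chi> i. if i = k then (\<chi> j. A' k j v) else row i (A x))"
        unfolding det_def
      proof (rule sum.cong[OF refl])
        fix p
        have "(\<Prod>i\<in>UNIV. (\<chi> i. if i = k then \<chi> j. A' k j v else row i (A x)) $ i $ p i) =
           A' k (p k) v * (\<Prod>i\<in>UNIV - {k}. (\<chi> i. if i = k then \<chi> j. A' k j v else row i (A x)) $ i $ p i)"
          by (subst prod.remove[of UNIV k]) auto
        also have "(\<Prod>i\<in>UNIV - {k}. (\<chi> i. if i = k then \<chi> j. A' k j v else row i (A x)) $ i $ p i) =
           (\<Prod>i\<in>UNIV - {k}. A x $ i $ p i)"
          by (rule prod.cong) (auto simp: row_def)
        finally show "of_int (sign p) * (A' k (p k) v * (\<Prod>i\<in>UNIV - {k}. A x $ i $ p i)) =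
           of_int (sign p) * (\<Prod>i\<in>UNIV. (\<chi> i. if i = k then \<chi> j. A' k j v else row i (A x)) $ i $ p i)"
          by simp
      qed
      also have "\<dots> = c $ k * det (A x)"
        using cramer_lemma_transpose[of k c "A x"] unfolding c .
      finally show ?thesis by (simp add: c_def)
    qed
    have "(\<Sum>p\<in>?P. of_int (sign p) * (\<Sum>k\<in>UNIV. A' k (p k) v * (\<Prod>i\<in>UNIV - {k}. A x $ i $ p i))) =
       (\<Sum>k\<in>UNIV. \<Sum>p\<in>?P. of_int (sign p) * (A' k (p k) v * (\<Prod>i\<in>UNIV - {k}. A x $ i $ p i)))"
      by (simp only: sum_distrib_left) (rule sum.swap)
    then show ?thesis
      unfolding row sum_distrib_right[symmetric] by (simp only: mult.commute)
  qed
  ultimately show ?thesis by (simp only:)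
qed

section \<open>Symmetric second derivatives and integrals of derivatives\<close>

lemma has_real_derivative_along_line:
  assumes "(\<gamma> has_derivative (\<lambda>d. d *\<^sub>R v)) (at t)" "(f has_derivative f') (at (\<gamma> t))"
  shows "((\<lambda>t. f (\<gamma> t)) has_real_derivative f' v) (at t)"
proof -
  have "(\<lambda>d. f' (d *\<^sub>R v)) = (*) (f' v)"
    using has_derivative_linear[OF assms(2)] by (auto simp: linear_cmul)
  then show ?thesis
    using has_derivative_compose[OF assms] by (simp add: has_field_derivative_def)
qed

text \<open>The second difference of \<open>f\<close> over a small parallelogram, by the mean value theorem first in direction \<open>a\<close>
  and then in direction \<open>b\<close>. The left-hand side is symmetric in \<open>a\<close> and \<open>b\<close>, which is what makes second
  derivatives symmetric.\<close>

lemma mixed_difference_mvt: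
  fixes f :: "'a::euclidean_space \<Rightarrow> real"
  assumes f: "smooth_on f S" and h: "h > 0"
    and S: "\<And>s t. 0 \<le> s \<Longrightarrow> s \<le> h \<Longrightarrow> 0 \<le> t \<Longrightarrow> t \<le> h \<Longrightarrow> x + s *\<^sub>R a + t *\<^sub>R b \<in> S"
  obtains s t where "0 \<le> s" "s \<le> h" "0 \<le> t" "t \<le> h"
    "f (x + h *\<^sub>R a + h *\<^sub>R b) - f (x + h *\<^sub>R a) - f (x + h *\<^sub>R b) + f x =
      h * h * frechet_derivative (\<lambda>y. frechet_derivative f (at y) a) (at (x + s *\<^sub>R a + t *\<^sub>R b)) b"
proof -
  let ?Da = "\<lambda>y. frechet_derivative f (at y) a"
  have 1: "((\<lambda>s. f (x + s *\<^sub>R a + t *\<^sub>R b)) has_real_derivative ?Da (x + s *\<^sub>R a + t *\<^sub>R b)) (at s)"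
    if "0 \<le> s" "s \<le> h" "0 \<le> t" "t \<le> h" for s t
  proof -
    have "((\<lambda>s. x + s *\<^sub>R a + t *\<^sub>R b) has_derivative (\<lambda>d. d *\<^sub>R a)) (at s)"
      by (auto intro!: derivative_eq_intros)
    from has_real_derivative_along_line[OF this smooth_on_has_derivative[OF f S[OF that]]]
    show ?thesis .
  qed
  have 2: "((\<lambda>t. ?Da (x + s *\<^sub>R a + t *\<^sub>R b)) has_real_derivative
      frechet_derivative ?Da (at (x + s *\<^sub>R a + t *\<^sub>R b)) b) (at t)"
    if "0 \<le> s" "s \<le> h" "0 \<le> t" "t \<le> h" for s t
  proof -
    note D = smooth_on_has_derivative[OF smooth_on_frechet_derivative[OF f, of a] S[OF that]]
    have "((\<lambda>t. x + s *\<^sub>R a + t *\<^sub>R b) has_derivative (\<lambda>d. d *\<^sub>R b)) (at t)"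
      by (auto intro!: derivative_eq_intros)
    from has_real_derivative_along_line[OF this D] show ?thesis .
  qed
  let ?\<phi> = "\<lambda>s. f (x + s *\<^sub>R a + h *\<^sub>R b) - f (x + s *\<^sub>R a + 0 *\<^sub>R b)"
  have "\<exists>s. 0 < s \<and> s < h \<and> ?\<phi> h - ?\<phi> 0 = (h - 0) * (?Da (x + s *\<^sub>R a + h *\<^sub>R b) - ?Da (x + s *\<^sub>R a + 0 *\<^sub>R b))"
    using h by (intro MVT2 DERIV_diff 1) auto
  then obtain s where s: "0 < s" "s < h" "?\<phi> h - ?\<phi> 0 = h * (?Da (x + s *\<^sub>R a + h *\<^sub>R b) - ?Da (x + s *\<^sub>R a + 0 *\<^sub>R b))"
    by auto
  have "\<exists>t. 0 < t \<and> t < h \<and> ?Da (x + s *\<^sub>R a + h *\<^sub>R b) - ?Da (x + s *\<^sub>R a + 0 *\<^sub>R b) =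
      (h - 0) * frechet_derivative ?Da (at (x + s *\<^sub>R a + t *\<^sub>R b)) b"
    using h s by (intro MVT2 2) auto
  then obtain t where t: "0 < t" "t < h" "?Da (x + s *\<^sub>R a + h *\<^sub>R b) - ?Da (x + s *\<^sub>R a + 0 *\<^sub>R b) =
      h * frechet_derivative ?Da (at (x + s *\<^sub>R a + t *\<^sub>R b)) b"
    by auto
  show ?thesis
    by (rule that[of s t]) (use s t in \<open>auto simp: algebra_simps\<close>)
qed

lemma second_derivative_symmetric_real:
  fixes f :: "'a::euclidean_space \<Rightarrow> real"
  assumes S: "open S" "x \<in> S" and f: "smooth_on f S"
  shows "frechet_derivative (\<lambda>y. frechet_derivative f (at y) a) (at x) b =
    frechet_derivative (\<lambda>y. frechet_derivative f (at y) b) (at x) a"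
proof -
  let ?D = "\<lambda>a b y. frechet_derivative (\<lambda>y. frechet_derivative f (at y) a) (at y) b"
  have cont: "isCont (?D a b) x" for a b
    using smooth_on_continuous[OF smooth_on_frechet_derivative[OF smooth_on_frechet_derivative[OF f]]] S
    by (simp add: continuous_on_eq_continuous_at)
  obtain r where r: "r > 0" "ball x r \<subseteq> S" using S openE by blast
  let ?c = "norm a + norm b + 1"
  have c: "?c > 0" by (simp add: add_nonneg_pos)
  \<comment> \<open>Side lengths that shrink to 0 and keep the parallelogram inside the ball.\<close>
  define h where "h = (\<lambda>k::nat. r / (?c * (real k + 2)))"
  have h: "h k > 0" for k using r c by (simp add: h_def)
  have h_c: "h k * ?c < r" for k
  proof -
    have "h k * ?c = r / (real k + 2)" using c by (simp add: h_def)
    also have "\<dots> < r" using r by (simp add: field_simps add_pos_nonneg)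
    finally show ?thesis .
  qed
  have h0: "h \<longlonglongrightarrow> 0"
  proof -
    have "(\<lambda>k. (r / ?c) * inverse (real (Suc (Suc k)))) \<longlonglongrightarrow> (r / ?c) * 0"
      by (intro tendsto_mult tendsto_const LIMSEQ_Suc[OF LIMSEQ_inverse_real_of_nat])
    moreover have "h = (\<lambda>k. (r / ?c) * inverse (real (Suc (Suc k))))"
    proof
      fix k
      have "real (Suc (Suc k)) = real k + 2" by simp
      then show "h k = (r / ?c) * inverse (real (Suc (Suc k)))"
        unfolding h_def by (simp only: divide_inverse inverse_mult_distrib mult.assoc)
    qed
    ultimately show ?thesis by simp
  qed
  have near: "norm (s *\<^sub>R a + t *\<^sub>R b) \<le> h k * ?c" if "0 \<le> s" "s \<le> h k" "0 \<le> t" "t \<le> h k" for s t k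
  proof -
    have "norm (s *\<^sub>R a + t *\<^sub>R b) \<le> s * norm a + t * norm b"
      using norm_triangle_ineq[of "s *\<^sub>R a" "t *\<^sub>R b"] that by simp
    also have "\<dots> \<le> h k * norm a + h k * norm b" using that by (intro add_mono mult_right_mono) auto
    finally show ?thesis using h[of k] by (simp add: algebra_simps)
  qed
  have inS: "x + s *\<^sub>R a + t *\<^sub>R b \<in> S" "x + s *\<^sub>R b + t *\<^sub>R a \<in> S"
    if "0 \<le> s" "s \<le> h k" "0 \<le> t" "t \<le> h k" for s t k
  proof -
    have d: "dist x (x + u + w) = norm (u + w)" for u w
      by (metis add.assoc add_diff_cancel_left' dist_commute dist_norm)
    have "norm (s *\<^sub>R a + t *\<^sub>R b) < r" "norm (s *\<^sub>R b + t *\<^sub>R a) < r"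
      using near[OF that] near[OF that(3,4,1,2)] h_c[of k] by (auto simp: add.commute)
    then have "x + s *\<^sub>R a + t *\<^sub>R b \<in> ball x r" "x + s *\<^sub>R b + t *\<^sub>R a \<in> ball x r"
      by (auto simp: d)
    then show "x + s *\<^sub>R a + t *\<^sub>R b \<in> S" "x + s *\<^sub>R b + t *\<^sub>R a \<in> S" using r by auto
  qed
  have "\<exists>p q. dist p x \<le> h k * ?c \<and> dist q x \<le> h k * ?c \<and> ?D a b p = ?D b a q" for k
  proof -
    obtain s t where st: "0 \<le> s" "s \<le> h k" "0 \<le> t" "t \<le> h k"
      "f (x + h k *\<^sub>R a + h k *\<^sub>R b) - f (x + h k *\<^sub>R a) - f (x + h k *\<^sub>R b) + f x = h k * h k * ?D a b (x + s *\<^sub>R a + t *\<^sub>R b)"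
      by (rule mixed_difference_mvt[OF f h[of k] inS(1)[of _ k]])
    obtain s' t' where st': "0 \<le> s'" "s' \<le> h k" "0 \<le> t'" "t' \<le> h k"
      "f (x + h k *\<^sub>R b + h k *\<^sub>R a) - f (x + h k *\<^sub>R b) - f (x + h k *\<^sub>R a) + f x = h k * h k * ?D b a (x + s' *\<^sub>R b + t' *\<^sub>R a)"
      by (rule mixed_difference_mvt[OF f h[of k] inS(2)[of _ k]])
    have "x + h k *\<^sub>R b + h k *\<^sub>R a = x + h k *\<^sub>R a + h k *\<^sub>R b" by (simp add: algebra_simps)
    then have "h k * h k * ?D a b (x + s *\<^sub>R a + t *\<^sub>R b) = h k * h k * ?D b a (x + s' *\<^sub>R b + t' *\<^sub>R a)"
      using st(5) st'(5) by (simp only:)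
    then have "?D a b (x + s *\<^sub>R a + t *\<^sub>R b) = ?D b a (x + s' *\<^sub>R b + t' *\<^sub>R a)"
      using h[of k] by simp
    moreover have "dist (x + s *\<^sub>R a + t *\<^sub>R b) x \<le> h k * ?c"
      using near[OF st(1-4)] by (simp add: dist_norm add.assoc)
    moreover have "dist (x + s' *\<^sub>R b + t' *\<^sub>R a) x \<le> h k * ?c"
      using near[OF st'(3,4,1,2)] by (simp add: dist_norm add.assoc add.commute)
    ultimately show ?thesis by blast
  qed
  then obtain p q where pq: "\<And>k. dist (p k) x \<le> h k * ?c" "\<And>k. dist (q k) x \<le> h k * ?c" "\<And>k. ?D a b (p k) = ?D b a (q k)"
    by metis
  have hc0: "(\<lambda>k. h k * ?c) \<longlonglongrightarrow> 0" using tendsto_mult_left_zero[OF h0] by blast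
  have px: "p \<longlonglongrightarrow> x" "q \<longlonglongrightarrow> x"
    unfolding tendsto_dist_iff[of _ x]
    by (rule tendsto_sandwich[OF _ _ tendsto_const hc0]; use pq(1,2) in simp)+
  have "(\<lambda>k. ?D a b (p k)) \<longlonglongrightarrow> ?D a b x" "(\<lambda>k. ?D b a (q k)) \<longlonglongrightarrow> ?D b a x"
    using px cont by (auto intro: isCont_tendsto_compose)
  then show ?thesis using pq(3) LIMSEQ_unique by auto
qed

definition second_derivative :: "('a::euclidean_space \<Rightarrow> 'b::euclidean_space) \<Rightarrow> 'a \<Rightarrow> 'a \<Rightarrow> 'a \<Rightarrow> 'b" where
  "second_derivative f x a b = frechet_derivative (\<lambda>y. frechet_derivative f (at y) b) (at x) a"

lemma smooth_on_second_derivative: "smooth_on f S \<Longrightarrow> smooth_on (\<lambda>x. second_derivative f x a b) S"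
  unfolding second_derivative_def by (intro smooth_on_frechet_derivative)

lemma frechet_derivative_inner_const:
  assumes "f differentiable (at x)"
  shows "frechet_derivative (\<lambda>y. f y \<bullet> c) (at x) v = frechet_derivative f (at x) v \<bullet> c"
proof -
  have "((\<lambda>y. f y \<bullet> c) has_derivative (\<lambda>v. frechet_derivative f (at x) v \<bullet> c)) (at x)"
    using assms by (intro has_derivative_inner_left) (simp add: frechet_derivative_works)
  from frechet_derivative_at[OF this, symmetric] show ?thesis by simp
qed

lemma second_derivative_symmetric:
  assumes S: "open S" "x \<in> S" and f: "smooth_on f S"
  shows "second_derivative f x a b = second_derivative f x b a"
proof (rule euclidean_eqI)
  fix c :: 'b
  have eq: "second_derivative f x a b \<bullet> c = frechet_derivative (\<lambda>y. frechet_derivative (\<lambda>y. f y \<bullet> c) (at y) b) (at x) a" for a b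
  proof -
    have "frechet_derivative (\<lambda>y. frechet_derivative (\<lambda>y. f y \<bullet> c) (at y) b) (at x) a =
        frechet_derivative (\<lambda>y. frechet_derivative f (at y) b \<bullet> c) (at x) a"
      by (rule frechet_derivative_cong_open[OF S, THEN fun_cong])
        (use smooth_on_has_derivative[OF f] in \<open>blast intro: frechet_derivative_inner_const differentiableI\<close>)
    also have "\<dots> = second_derivative f x a b \<bullet> c"
      unfolding second_derivative_def
      using smooth_on_has_derivative[OF smooth_on_frechet_derivative[OF f] S(2)]
      by (intro frechet_derivative_inner_const) (rule differentiableI)
    finally show ?thesis by simp
  qed
  have "smooth_on (\<lambda>y. f y \<bullet> c) S" using f S by (intro smooth_intros)
  from second_derivative_symmetric_real[OF S this]
  show "second_derivative f x a b \<bullet> c = second_derivative f x b a \<bullet> c"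
    by (simp add: eq)
qed

lemma second_derivative_linear_left:
  assumes "x \<in> S" "smooth_on f S"
  shows "linear (\<lambda>a. second_derivative f x a b)"
  unfolding second_derivative_def
  using smooth_on_has_derivative[OF smooth_on_frechet_derivative[OF assms(2)] assms(1)] has_derivative_linear by blast

lemma second_derivative_linear_right:
  assumes "open S" "x \<in> S" "smooth_on f S"
  shows "linear (second_derivative f x a)"
proof -
  have "second_derivative f x a = (\<lambda>b. second_derivative f x b a)"
    using second_derivative_symmetric[OF assms] by blast
  then show ?thesis using second_derivative_linear_left[OF assms(2,3)] by simp
qed

text \<open>The difference quotients of \<open>f\<close> in direction \<open>v\<close> have integral \<open>0\<close> because Lebesgue measure is translation
  invariant. They converge to the derivative, and by the mean value theorem they are dominated by a bound of the
  derivative on a fixed compact set.\<close>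

lemma integral_derivative_compact_support:
  fixes f :: "'a::euclidean_space \<Rightarrow> real"
  assumes f: "smooth_on f UNIV" and K: "compact K" "\<And>x. x \<notin> K \<Longrightarrow> f x = 0"
  shows "integrable lborel (\<lambda>x. frechet_derivative f (at x) v)"
    and "(\<integral>x. frechet_derivative f (at x) v \<partial>lborel) = 0"
proof -
  let ?D = "\<lambda>x. frechet_derivative f (at x) v"
  have cf [continuous_intros]: "continuous_on UNIV f" using smooth_on_continuous[OF f] .
  have cD: "continuous_on UNIV ?D" using smooth_on_continuous[OF smooth_on_frechet_derivative[OF f]] .
  have [measurable]: "f \<in> borel_measurable borel" "?D \<in> borel_measurable borel"
    using cf cD by (auto intro: borel_measurable_continuous_onI)
  have D0: "?D x = 0" if "x \<notin> K" for x
    using frechet_derivative_cong_open[of "-K" x f "\<lambda>_. 0"] K that by (simp add: open_Compl compact_imp_closed)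
  have "bounded (?D ` K)" using compact_continuous_image[OF continuous_on_subset[OF cD] K(1)] compact_imp_bounded by auto
  then obtain B where B: "B > 0" "\<And>x. x \<in> K \<Longrightarrow> \<bar>?D x\<bar> \<le> B"
    by (auto simp: bounded_pos)
  then have B: "B > 0" "\<bar>?D x\<bar> \<le> B" for x using D0[of x] by (cases "x \<in> K"; auto)+
  have seg: "\<exists>t>0. t < s \<and> f (x + s *\<^sub>R v) - f x = s * ?D (x + t *\<^sub>R v)" if "s > 0" for s x
  proof -
    have "((\<lambda>t. f (x + t *\<^sub>R v)) has_real_derivative ?D (x + t *\<^sub>R v)) (at t)" for t
    proof -
      have D: "(f has_derivative frechet_derivative f (at (x + t *\<^sub>R v))) (at (x + t *\<^sub>R v))"
        using smooth_on_has_derivative[OF f] by auto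
      have "((\<lambda>t. x + t *\<^sub>R v) has_derivative (\<lambda>d. d *\<^sub>R v)) (at t)" by (auto intro!: derivative_eq_intros)
      from has_real_derivative_along_line[OF this D] show ?thesis .
    qed
    from MVT2[OF that this] show ?thesis by auto
  qed
  define q where "q = (\<lambda>k x. (f (inverse (real (Suc k)) *\<^sub>R v + x) - f x) * real (Suc k))"
  \<comment> \<open>All points from which a step of length at most 1 along \<open>v\<close> leads into \<open>K\<close>.\<close>
  define K' where "K' = K \<union> (\<lambda>(t, y). y - t *\<^sub>R v) ` ({0..1} \<times> K)"
  have K': "compact K'" unfolding K'_def
    by (intro compact_Un K compact_continuous_image compact_Times) (auto intro!: continuous_intros simp: case_prod_unfold)
  have [measurable]: "K' \<in> sets borel" using K' by (simp add: borel_closed compact_imp_closed)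
  have qv: "\<exists>t>0. t \<le> inverse (real (Suc k)) \<and> q k x = ?D (x + t *\<^sub>R v)" for k x
  proof -
    have "inverse (real (Suc k)) > 0" by simp
    from seg[OF this, of x] obtain t where "t > 0" "t < inverse (real (Suc k))"
      "f (x + inverse (real (Suc k)) *\<^sub>R v) - f x = inverse (real (Suc k)) * ?D (x + t *\<^sub>R v)" by blast
    then show ?thesis by (intro exI[of _ t]) (auto simp: q_def add.commute)
  qed
  have qb: "norm (q k x) \<le> B * indicator K' x" for k x
  proof -
    obtain t where t: "t > 0" "t \<le> inverse (real (Suc k))" "q k x = ?D (x + t *\<^sub>R v)" using qv by blast
    then have "t \<le> 1" using inverse_le_1_iff[of "real (Suc k)"] by linarith
    show ?thesis
    proof (cases "x + t *\<^sub>R v \<in> K")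
      case True
      then have "x \<in> K'" unfolding K'_def using t \<open>t \<le> 1\<close>
        by (intro UnI2 image_eqI[of _ _ "(t, x + t *\<^sub>R v)"]) auto
      then show ?thesis using B t by simp
    next
      case False
      then show ?thesis using D0 B t by simp
    qed
  qed
  have lim: "(\<lambda>k. q k x) \<longlonglongrightarrow> ?D x" for x
  proof -
    obtain t where t: "\<And>k. t k > 0" "\<And>k. t k \<le> inverse (real (Suc k))" "\<And>k. q k x = ?D (x + t k *\<^sub>R v)"
      using qv[of _ x] by metis
    have "t \<longlonglongrightarrow> 0"
      by (rule tendsto_sandwich[OF _ _ tendsto_const LIMSEQ_inverse_real_of_nat])
        (use t in \<open>auto intro!: always_eventually less_imp_le\<close>)
    then have "(\<lambda>k. x + t k *\<^sub>R v) \<longlonglongrightarrow> x + 0 *\<^sub>R v" by (intro tendsto_intros)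
    then have "(\<lambda>k. x + t k *\<^sub>R v) \<longlonglongrightarrow> x" by simp
    moreover have "isCont ?D x" using cD by (simp add: continuous_on_eq_continuous_at)
    ultimately show ?thesis unfolding t(3) by (rule isCont_tendsto_compose[rotated])
  qed
  have [measurable]: "q k \<in> borel_measurable borel" for k unfolding q_def by measurable
  have K'int: "integrable lborel (\<lambda>x. B * indicator K' x)"
    using emeasure_bounded_finite[OF compact_imp_bounded[OF K']]
    by (intro integrable_mult_right integrable_real_indicator) auto
  have f_int: "integrable lborel f"
  proof -
    have "integrable lborel (\<lambda>x. indicator K x *\<^sub>R f x)"
      by (rule borel_integrable_compact[OF K(1)]) (rule continuous_on_subset[OF cf], auto)
    moreover have "(\<lambda>x. indicator K x *\<^sub>R f x) = f"
    proof
      fix x show "indicator K x *\<^sub>R f x = f x" using K(2)[of x] by (cases "x \<in> K") auto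
    qed
    ultimately show ?thesis by (simp only:)
  qed
  have "(\<integral>x. q k x \<partial>lborel) = 0" for k
  proof -
    let ?c = "inverse (real (Suc k)) *\<^sub>R v"
    have i: "integrable lborel (\<lambda>x. f (?c + x))"
      using integrable_distr_eq[of "(+) ?c" lborel borel f] f_int by (simp add: lborel_distr_plus)
    have "(\<integral>x. f x \<partial>lborel) = (\<integral>x. f (?c + x) \<partial>lborel)"
      using integral_distr[of "(+) ?c" lborel borel f] by (simp add: lborel_distr_plus)
    then show ?thesis unfolding q_def using i f_int by simp
  qed
  moreover have "(\<lambda>k. \<integral>x. q k x \<partial>lborel) \<longlonglongrightarrow> (\<integral>x. ?D x \<partial>lborel)"
    by (rule integral_dominated_convergence[OF _ _ K'int]) (use lim qb in auto)
  ultimately show "(\<integral>x. ?D x \<partial>lborel) = 0" using LIMSEQ_unique[of "\<lambda>_. 0::real"] by auto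
  show "integrable lborel ?D"
    by (rule integrable_dominated_convergence[OF _ _ K'int, where s=q]) (use lim qb in auto)
qed

lemma integral_derivative_supported_in_open:
  fixes W :: "'a::euclidean_space \<Rightarrow> real"
  assumes O: "open S" and W: "smooth_on W S" and K: "compact K" "K \<subseteq> S" "\<And>x. x \<in> S - K \<Longrightarrow> W x = 0"
  shows "integrable lborel (\<lambda>x. indicator S x * frechet_derivative W (at x) v)"
    and "(\<integral>x. indicator S x * frechet_derivative W (at x) v \<partial>lborel) = 0"
proof -
  define f where "f = (\<lambda>x. if x \<in> S then W x else 0)"
  have oK: "open (- K)" using K(1) by (simp add: compact_imp_closed open_Compl)
  have fK: "f x = 0" if "x \<notin> K" for x using that K by (auto simp: f_def)
  have "smooth_on f S" using smooth_on_cong[OF O, of f W] W by (simp add: f_def)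
  moreover have "smooth_on f (- K)" using smooth_on_cong[OF oK, of f "\<lambda>_. 0"] fK oK by (simp add: smooth_on_const)
  ultimately have "smooth_on f (S \<union> - K)" using O oK by (intro smooth_on_Un)
  moreover have "S \<union> - K = UNIV" using K(2) by auto
  ultimately have f: "smooth_on f UNIV" by simp
  have "indicator S x * frechet_derivative W (at x) v = frechet_derivative f (at x) v" for x
  proof (cases "x \<in> S")
    case True
    then show ?thesis using frechet_derivative_cong_open[OF O True, of f W] by (simp add: f_def)
  next
    case False
    then have "x \<in> - K" using K(2) by auto
    then show ?thesis using frechet_derivative_cong_open[OF oK, of x f "\<lambda>_. 0"] fK False by simp
  qed
  then show "integrable lborel (\<lambda>x. indicator S x * frechet_derivative W (at x) v)"
    "(\<integral>x. indicator S x * frechet_derivative W (at x) v \<partial>lborel) = 0"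
    using integral_derivative_compact_support[OF f K(1) fK] by simp_all
qed

section \<open>The first variation in one parametrization\<close>

abbreviation ax :: "'n::finite \<Rightarrow> real^'n" where "ax i \<equiv> axis i 1"

text \<open>A submanifold with one global parametrization, of any codimension. In coordinates, a chart of an immersed
  hypersurface is of this form.\<close>

locale parametrized_immersion =
  fixes \<Phi> :: "real^'n \<Rightarrow> 'b::euclidean_space" and S :: "(real^'n) set"
  assumes open_S: "open S" and smooth: "smooth_on \<Phi> S"
    and inj_deriv: "\<And>u. u \<in> S \<Longrightarrow> inj (frechet_derivative \<Phi> (at u))"
begin

abbreviation D :: "real^'n \<Rightarrow> real^'n \<Rightarrow> 'b" where "D u \<equiv> frechet_derivative \<Phi> (at u)"
abbreviation D2 :: "real^'n \<Rightarrow> real^'n \<Rightarrow> real^'n \<Rightarrow> 'b" where "D2 u \<equiv> second_derivative \<Phi> u"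
abbreviation ginv :: "real^'n \<Rightarrow> 'n \<Rightarrow> 'n \<Rightarrow> real" where "ginv u i j \<equiv> gram_inv (D u) $ i $ j"

definition vol :: "real^'n \<Rightarrow> real" where "vol u = sqrt (det (gram (D u)))"

lemma linear_D: "u \<in> S \<Longrightarrow> linear (D u)"
  using smooth_on_has_derivative[OF smooth] has_derivative_linear by blast

lemma smooth_D: "smooth_on (\<lambda>u. D u v) S"
  by (rule smooth_on_frechet_derivative[OF smooth])

lemma smooth_gram: "smooth_on (\<lambda>u. gram (D u) $ i $ j) S"
  unfolding gram_def by (simp, intro smooth_intros open_S smooth_D)

lemma det_gram_D_pos: "u \<in> S \<Longrightarrow> det (gram (D u)) > 0"
  using det_gram_pos linear_D inj_deriv by blast

lemma vol_pos: "u \<in> S \<Longrightarrow> vol u > 0"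
  using det_gram_D_pos by (simp add: vol_def)

lemma smooth_vol: "smooth_on vol S"
  unfolding vol_def[abs_def] det_def
  by (intro smooth_on_sqrt smooth_intros open_S smooth_gram) (use det_gram_D_pos in \<open>simp add: det_def\<close>)

text \<open>By Cramer's rule the entries of the inverse are rational functions of the entries of the Gram matrix.\<close>

lemma smooth_gram_inv: "smooth_on (\<lambda>u. ginv u i j) S"
proof -
  \<comment> \<open>Cramer's rule for the system that column \<open>j\<close> of the inverse solves.\<close>
  let ?M = "\<lambda>u. (\<chi> a b. if b = i then ax j $ a else gram (D u) $ a $ b)"
  have eq: "det (?M u) / det (gram (D u)) = ginv u i j" if u: "u \<in> S" for u
  proof -
    have "gram (D u) *v column j (gram_inv (D u)) = ax j"
    proof -
      have "(gram (D u) ** gram_inv (D u)) $ k $ j = ax j $ k" for k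
        by (simp add: gram_inv_inverse[OF linear_D[OF u] inj_deriv[OF u]] mat_def axis_def)
      then show ?thesis
        by (simp add: vec_eq_iff matrix_vector_mult_def column_def matrix_matrix_mult_def)
    qed
    then have "column j (gram_inv (D u)) = (\<chi> k. det (\<chi> a b. if b = k then ax j $ a else gram (D u) $ a $ b) / det (gram (D u)))"
      using cramer[of "gram (D u)" "column j (gram_inv (D u))" "ax j"] det_gram_D_pos[OF u] by simp
    then have "column j (gram_inv (D u)) $ i = det (?M u) / det (gram (D u))" by simp
    then show ?thesis by (simp add: column_def)
  qed
  have "smooth_on (\<lambda>u. ?M u $ a $ b) S" for a b
    by (cases "b = i") (auto intro!: smooth_intros open_S smooth_gram)
  then have "smooth_on (\<lambda>u. det (?M u)) S" unfolding det_def by (intro smooth_intros open_S)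
  moreover have "smooth_on (\<lambda>u. det (gram (D u))) S" unfolding det_def by (intro smooth_intros open_S smooth_gram)
  ultimately have "smooth_on (\<lambda>u. det (?M u) / det (gram (D u))) S"
    using det_gram_D_pos by (intro smooth_intros open_S) force+
  moreover have "smooth_on (\<lambda>u. det (?M u) / det (gram (D u))) S \<longleftrightarrow> smooth_on (\<lambda>u. ginv u i j) S"
    by (rule smooth_on_cong[OF open_S]) (rule eq)
  ultimately show ?thesis by blast
qed

text \<open>Jacobi's formula for \<open>det g\<close>; the two terms of the derivative of \<open>g\<^sub>i\<^sub>j = \<langle>D\<^sub>i, D\<^sub>j\<rangle>\<close> contribute equally, which cancels
  the factor \<open>1/2\<close> from the square root.\<close>

lemma vol_derivative:
  assumes u: "u \<in> S"
  shows "frechet_derivative vol (at u) v = vol u * (\<Sum>i\<in>UNIV. \<Sum>j\<in>UNIV. ginv u i j * (D2 u v (ax i) \<bullet> D u (ax j)))"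
proof -
  note lin = linear_D[OF u] and inj = inj_deriv[OF u]
  let ?g' = "\<lambda>i j v. D u (ax i) \<bullet> D2 u v (ax j) + D2 u v (ax i) \<bullet> D u (ax j)"
  have dD: "((\<lambda>u. D u w) has_derivative (\<lambda>v. D2 u v w)) (at u)" for w
    using smooth_on_has_derivative[OF smooth_D u] by (simp add: second_derivative_def)
  have "((\<lambda>u. gram (D u) $ i $ j) has_derivative ?g' i j) (at u)" for i j
    unfolding gram_def by (simp, rule has_derivative_inner[OF dD dD])
  from has_derivative_det[OF this gram_inv_inverse(1)[OF lin inj]]
  have "((\<lambda>u. det (gram (D u))) has_derivative
    (\<lambda>v. det (gram (D u)) * (\<Sum>i\<in>UNIV. \<Sum>j\<in>UNIV. ?g' i j v * ginv u j i))) (at u)" .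
  then have "(vol has_derivative (\<lambda>v. inverse (vol u) / 2 * (det (gram (D u)) * (\<Sum>i\<in>UNIV. \<Sum>j\<in>UNIV. ?g' i j v * ginv u j i)))) (at u)"
    unfolding vol_def[abs_def] using det_gram_D_pos[OF u]
    by (auto intro!: derivative_eq_intros simp: field_simps)
  from frechet_derivative_at[OF this, symmetric]
  have 1: "frechet_derivative vol (at u) v = inverse (vol u) / 2 * (det (gram (D u)) * (\<Sum>i\<in>UNIV. \<Sum>j\<in>UNIV. ?g' i j v * ginv u j i))"
    by simp
  have "(\<Sum>i\<in>UNIV. \<Sum>j\<in>UNIV. ?g' i j v * ginv u j i) =
      (\<Sum>i\<in>UNIV. \<Sum>j\<in>UNIV. ginv u j i * (D2 u v (ax j) \<bullet> D u (ax i))) + (\<Sum>i\<in>UNIV. \<Sum>j\<in>UNIV. ginv u j i * (D2 u v (ax i) \<bullet> D u (ax j)))"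
    by (simp add: sum.distrib algebra_simps inner_commute)
  also have "(\<Sum>i\<in>UNIV. \<Sum>j\<in>UNIV. ginv u j i * (D2 u v (ax j) \<bullet> D u (ax i))) = (\<Sum>i\<in>UNIV. \<Sum>j\<in>UNIV. ginv u i j * (D2 u v (ax i) \<bullet> D u (ax j)))"
    by (rule sum.swap)
  also have "(\<Sum>i\<in>UNIV. \<Sum>j\<in>UNIV. ginv u j i * (D2 u v (ax i) \<bullet> D u (ax j))) = (\<Sum>i\<in>UNIV. \<Sum>j\<in>UNIV. ginv u i j * (D2 u v (ax i) \<bullet> D u (ax j)))"
    by (simp only: gram_inv_sym[OF lin inj])
  finally have 2: "(\<Sum>i\<in>UNIV. \<Sum>j\<in>UNIV. ?g' i j v * ginv u j i) = 2 * (\<Sum>i\<in>UNIV. \<Sum>j\<in>UNIV. ginv u i j * (D2 u v (ax i) \<bullet> D u (ax j)))"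
    by simp
  have 3: "det (gram (D u)) = vol u * vol u" using det_gram_D_pos[OF u] by (simp add: vol_def)
  show ?thesis unfolding 1 2 3 using vol_pos[OF u] by (simp add: field_simps)
qed

text \<open>The frame dual to the coordinate vectors, times the volume density: the vector field \<open>\<surd>g g\<^sup>i\<^sup>j D\<^sub>j\<close> whose coordinate
  divergence is the Laplacian of the parametrization times \<open>\<surd>g\<close>.\<close>

definition coframe :: "'n \<Rightarrow> real^'n \<Rightarrow> 'b" where
  "coframe i u = (\<Sum>j\<in>UNIV. (vol u * ginv u i j) *\<^sub>R D u (ax j))"

lemma smooth_coframe: "smooth_on (coframe i) S"
  unfolding coframe_def[abs_def] by (intro smooth_intros open_S smooth_vol smooth_gram_inv smooth_D)

lemma coframe_inner:
  assumes "u \<in> S"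
  shows "coframe i u \<bullet> D u (ax k) = (if i = k then vol u else 0)"
proof -
  have "coframe i u \<bullet> D u (ax k) = vol u * (\<Sum>j\<in>UNIV. ginv u i j * (D u (ax j) \<bullet> D u (ax k)))"
    by (simp add: coframe_def inner_sum_left sum_distrib_left mult.assoc)
  then show ?thesis by (simp add: gram_inv_axis[OF linear_D inj_deriv] assms)
qed

text \<open>This is \<open>\<Delta> \<Phi> = H\<close> in coordinates. The normal part is clear, because derivatives of the coefficients only
  contribute tangential vectors. For the tangential part, \<open>\<langle>V\<^sup>i, D\<^sub>k\<rangle> = \<surd>g \<delta>\<^sub>i\<^sub>k\<close> is differentiated: by
  \<open>vol_derivative\<close> and the symmetry of second derivatives the terms cancel. The vector \<open>H\<close> is characterized as the
  normal part of the trace of the second derivative.\<close>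

lemma divergence_coframe:
  assumes u: "u \<in> S" and H: "\<And>w. H \<bullet> D u w = 0"
    and trace: "(\<Sum>i\<in>UNIV. \<Sum>j\<in>UNIV. ginv u i j *\<^sub>R D2 u (ax i) (ax j)) - H \<in> range (D u)"
  shows "(\<Sum>i\<in>UNIV. frechet_derivative (coframe i) (at u) (ax i)) = vol u *\<^sub>R H"
proof -
  let ?X = "(\<Sum>i\<in>UNIV. frechet_derivative (coframe i) (at u) (ax i))"
  let ?dc = "\<lambda>i j. frechet_derivative (\<lambda>u. vol u * ginv u i j) (at u) (ax i)"
  note lin = linear_D[OF u]
  have sub: "subspace (range (D u))" by (rule linear_subspace_image[OF lin subspace_UNIV])
  have dD: "((\<lambda>u. D u w) has_derivative (\<lambda>v. D2 u v w)) (at u)" for w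
    using smooth_on_has_derivative[OF smooth_D u] by (simp add: second_derivative_def)
  have coef: "smooth_on (\<lambda>u. vol u * ginv u i j) S" for i j
    by (intro smooth_intros open_S smooth_vol smooth_gram_inv)
  have dV: "frechet_derivative (coframe i) (at u) (ax i) =
      (\<Sum>j\<in>UNIV. (vol u * ginv u i j) *\<^sub>R D2 u (ax i) (ax j) + ?dc i j *\<^sub>R D u (ax j))" for i
  proof -
    have "(coframe i has_derivative (\<lambda>v. \<Sum>j\<in>UNIV. (vol u * ginv u i j) *\<^sub>R D2 u v (ax j) +
        frechet_derivative (\<lambda>u. vol u * ginv u i j) (at u) v *\<^sub>R D u (ax j))) (at u)"
      unfolding coframe_def[abs_def]
      by (intro has_derivative_sum has_derivative_scaleR dD smooth_on_has_derivative[OF coef u])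
    from frechet_derivative_at[OF this, symmetric] show ?thesis by simp
  qed
  \<comment> \<open>The difference of both sides is tangential, ...\<close>
  have "?X - vol u *\<^sub>R H = vol u *\<^sub>R ((\<Sum>i\<in>UNIV. \<Sum>j\<in>UNIV. ginv u i j *\<^sub>R D2 u (ax i) (ax j)) - H) +
      (\<Sum>i\<in>UNIV. \<Sum>j\<in>UNIV. ?dc i j *\<^sub>R D u (ax j))"
    by (simp add: dV sum.distrib scaleR_diff_right scaleR_sum_right)
  moreover have "(\<Sum>i\<in>UNIV. \<Sum>j\<in>UNIV. ?dc i j *\<^sub>R D u (ax j)) \<in> range (D u)"
    by (intro subspace_sum subspace_scale sub) auto
  ultimately have "?X - vol u *\<^sub>R H \<in> range (D u)"
    using trace sub by (auto intro: subspace_add subspace_scale)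
  \<comment> \<open>... and orthogonal to all tangent vectors.\<close>
  moreover have "(?X - vol u *\<^sub>R H) \<bullet> D u w = 0" for w
  proof -
    have "?X \<bullet> D u (ax k) = 0" for k
    proof -
      have 1: "frechet_derivative (coframe i) (at u) (ax i) \<bullet> D u (ax k) =
          (if i = k then frechet_derivative vol (at u) (ax k) else 0) - coframe i u \<bullet> D2 u (ax i) (ax k)" for i
      proof -
        have "((\<lambda>u. coframe i u \<bullet> D u (ax k)) has_derivative
           (\<lambda>v. coframe i u \<bullet> D2 u v (ax k) + frechet_derivative (coframe i) (at u) v \<bullet> D u (ax k))) (at u)"
          by (rule has_derivative_inner[OF smooth_on_has_derivative[OF smooth_coframe u] dD])
        from frechet_derivative_at[OF this, symmetric]
        have "frechet_derivative (\<lambda>u. coframe i u \<bullet> D u (ax k)) (at u) (ax i) =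
           coframe i u \<bullet> D2 u (ax i) (ax k) + frechet_derivative (coframe i) (at u) (ax i) \<bullet> D u (ax k)" by simp
        moreover have "frechet_derivative (\<lambda>u. coframe i u \<bullet> D u (ax k)) (at u) =
            frechet_derivative (\<lambda>u. if i = k then vol u else 0) (at u)"
          by (rule frechet_derivative_cong_open[OF open_S u coframe_inner])
        ultimately show ?thesis by (cases "i = k") auto
      qed
      have "?X \<bullet> D u (ax k) = frechet_derivative vol (at u) (ax k) - (\<Sum>i\<in>UNIV. coframe i u \<bullet> D2 u (ax i) (ax k))"
        by (simp add: inner_sum_left 1 sum_subtractf)
      also have "(\<Sum>i\<in>UNIV. coframe i u \<bullet> D2 u (ax i) (ax k)) = frechet_derivative vol (at u) (ax k)"
        by (simp add: vol_derivative[OF u] coframe_def inner_sum_left sum_distrib_left mult.assoc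
            inner_commute[of "D u _"] second_derivative_symmetric[OF open_S u smooth, of "ax k"])
      finally show ?thesis by simp
    qed
    then have "?X \<bullet> D u w = 0"
      by (subst linear_axis_expansion[OF lin]) (simp add: inner_sum_right)
    then show ?thesis using H by (simp add: inner_diff_left)
  qed
  ultimately have "(?X - vol u *\<^sub>R H) \<bullet> (?X - vol u *\<^sub>R H) = 0" by (elim rangeE) simp
  then show ?thesis by simp
qed

text \<open>The integrand is the sum over \<open>i\<close> of the partial derivatives of \<open>\<eta> \<langle>V\<^sup>i, \<Phi>\<rangle>\<close>, where \<open>V\<^sup>i\<close> is \<open>coframe i\<close>. Each of
  them is compactly supported and integrates to \<open>0\<close>. The dimension arises as the sum of \<open>\<langle>V\<^sup>i, D\<^sub>i\<rangle> / \<surd>g\<close>.\<close>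

theorem local_first_variation:
  assumes \<eta>: "smooth_on \<eta> S" and K: "compact K" "K \<subseteq> S" "\<And>x. x \<in> S - K \<Longrightarrow> \<eta> x = 0"
    and H: "\<And>u w. u \<in> S \<Longrightarrow> H u \<bullet> D u w = 0"
    and trace: "\<And>u. u \<in> S \<Longrightarrow> (\<Sum>i\<in>UNIV. \<Sum>j\<in>UNIV. ginv u i j *\<^sub>R D2 u (ax i) (ax j)) - H u \<in> range (D u)"
  shows "(\<integral>u. indicator S u * (vol u * (\<eta> u * (real CARD('n) + \<Phi> u \<bullet> H u) +
     (\<Sum>i\<in>UNIV. \<Sum>j\<in>UNIV. ginv u i j * (frechet_derivative \<eta> (at u) (ax i) * (\<Phi> u \<bullet> D u (ax j)))))) \<partial>lborel) = 0"
proof -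
  define W where "W = (\<lambda>i u. \<eta> u * (coframe i u \<bullet> \<Phi> u))"
  have W: "smooth_on (W i) S" for i unfolding W_def
    by (intro smooth_intros open_S \<eta> smooth_coframe smooth)
  have W0: "W i u = 0" if "u \<in> S - K" for i u using K(3)[OF that] by (simp add: W_def)
  note int = integral_derivative_supported_in_open[OF open_S W K(1,2) W0]
  have "vol u * (\<eta> u * (real CARD('n) + \<Phi> u \<bullet> H u) +
     (\<Sum>i\<in>UNIV. \<Sum>j\<in>UNIV. ginv u i j * (frechet_derivative \<eta> (at u) (ax i) * (\<Phi> u \<bullet> D u (ax j)))))
     = (\<Sum>i\<in>UNIV. frechet_derivative (W i) (at u) (ax i))" if u: "u \<in> S" for u
  proof -
    have "frechet_derivative (W i) (at u) (ax i) =
       \<eta> u * (coframe i u \<bullet> D u (ax i) + frechet_derivative (coframe i) (at u) (ax i) \<bullet> \<Phi> u) +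
       frechet_derivative \<eta> (at u) (ax i) * (coframe i u \<bullet> \<Phi> u)" for i
    proof -
      have "(W i has_derivative (\<lambda>v. \<eta> u * (coframe i u \<bullet> D u v + frechet_derivative (coframe i) (at u) v \<bullet> \<Phi> u) +
       frechet_derivative \<eta> (at u) v * (coframe i u \<bullet> \<Phi> u))) (at u)"
        unfolding W_def
        by (intro has_derivative_mult has_derivative_inner smooth_on_has_derivative[OF \<eta> u]
            smooth_on_has_derivative[OF smooth u] smooth_on_has_derivative[OF smooth_coframe u])
      from frechet_derivative_at[OF this, symmetric] show ?thesis by simp
    qed
    then have "(\<Sum>i\<in>UNIV. frechet_derivative (W i) (at u) (ax i)) =
       \<eta> u * ((\<Sum>i\<in>UNIV. coframe i u \<bullet> D u (ax i)) + (\<Sum>i\<in>UNIV. frechet_derivative (coframe i) (at u) (ax i)) \<bullet> \<Phi> u) +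
       (\<Sum>i\<in>UNIV. frechet_derivative \<eta> (at u) (ax i) * (coframe i u \<bullet> \<Phi> u))"
      by (simp add: sum.distrib sum_distrib_left inner_sum_left distrib_left)
    also have "(\<Sum>i\<in>UNIV. frechet_derivative (coframe i) (at u) (ax i)) = vol u *\<^sub>R H u"
      by (rule divergence_coframe[OF u H[OF u] trace[OF u]])
    also have "(\<Sum>i\<in>UNIV. coframe i u \<bullet> D u (ax i)) = real CARD('n) * vol u"
      by (simp add: coframe_inner[OF u])
    also have "(\<Sum>i\<in>UNIV. frechet_derivative \<eta> (at u) (ax i) * (coframe i u \<bullet> \<Phi> u)) =
       vol u * (\<Sum>i\<in>UNIV. \<Sum>j\<in>UNIV. ginv u i j * (frechet_derivative \<eta> (at u) (ax i) * (\<Phi> u \<bullet> D u (ax j))))"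
      by (simp add: coframe_def inner_commute[of _ "\<Phi> u"] inner_sum_right sum_distrib_left mult_ac)
    finally show ?thesis by (simp add: algebra_simps inner_commute)
  qed
  then have "(\<integral>u. indicator S u * (vol u * (\<eta> u * (real CARD('n) + \<Phi> u \<bullet> H u) +
     (\<Sum>i\<in>UNIV. \<Sum>j\<in>UNIV. ginv u i j * (frechet_derivative \<eta> (at u) (ax i) * (\<Phi> u \<bullet> D u (ax j)))))) \<partial>lborel)
     = (\<integral>u. (\<Sum>i\<in>UNIV. indicator S u * frechet_derivative (W i) (at u) (ax i)) \<partial>lborel)"
    by (intro Bochner_Integration.integral_cong) (auto simp: indicator_def sum_distrib_left[symmetric])
  also have "\<dots> = (\<Sum>i\<in>UNIV. \<integral>u. indicator S u * frechet_derivative (W i) (at u) (ax i) \<partial>lborel)"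
    using int(1) by (rule Bochner_Integration.integral_sum)
  also have "\<dots> = 0" by (simp only: int(2) sum.neutral_const)
  finally show ?thesis .
qed

end

section \<open>Immersed hypersurfaces in charts\<close>

abbreviation chart_image :: "('m, 'n) chart \<Rightarrow> (real^'n) set" where
  "chart_image c \<equiv> snd c ` fst c"

locale hypersurface =
  fixes \<A> :: "('m::{t2_space,second_countable_topology}, 'n::finite) chart set"
    and F :: "'m \<Rightarrow> real^('n + 1)"
  assumes immersed: "immersed_hypersurface \<A> F"
begin

lemma chart_cover: "\<exists>c\<in>\<A>. p \<in> fst c"
  using immersed by (auto simp: immersed_hypersurface_def smooth_atlas_def)

lemma
  assumes "c \<in> \<A>"
  shows open_chart: "open (fst c)" and open_chart_image: "open (chart_image c)"
    and chart_homeomorphism: "homeomorphism (fst c) (chart_image c) (snd c) (chart_inv c)"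
    and smooth_F: "smooth_on (F \<circ> chart_inv c) (chart_image c)"
    and inj_F: "\<And>u. u \<in> chart_image c \<Longrightarrow> inj (frechet_derivative (F \<circ> chart_inv c) (at u))"
  using assms immersed
  by (auto simp: immersed_hypersurface_def smooth_atlas_def smooth_map_def split_beta)

lemma smooth_transition:
  "c \<in> \<A> \<Longrightarrow> d \<in> \<A> \<Longrightarrow> smooth_on (snd d \<circ> chart_inv c) (snd c ` (fst c \<inter> fst d))"
  using immersed by (auto simp: immersed_hypersurface_def smooth_atlas_def split_beta)

lemma
  assumes "c \<in> \<A>"
  shows chart_inv_chart: "\<And>p. p \<in> fst c \<Longrightarrow> chart_inv c (snd c p) = p"
    and chart_chart_inv: "\<And>u. u \<in> chart_image c \<Longrightarrow> snd c (chart_inv c u) = u"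
    and chart_inv_in: "\<And>u. u \<in> chart_image c \<Longrightarrow> chart_inv c u \<in> fst c"
    and continuous_chart: "continuous_on (fst c) (snd c)"
    and continuous_chart_inv: "continuous_on (chart_image c) (chart_inv c)"
    and inj_chart: "inj_on (snd c) (fst c)"
  using chart_homeomorphism[OF assms] unfolding homeomorphism_def by (auto intro: inj_on_inverseI)

lemma chart_image_subset_open:
  assumes "c \<in> \<A>" "open U" "U \<subseteq> fst c"
  shows "open (snd c ` U)"
proof -
  have "snd c ` U = chart_image c \<inter> chart_inv c -` U"
    using assms chart_inv_chart[OF assms(1)] by (force simp: image_iff)
  then show ?thesis
    using continuous_open_preimage[OF continuous_chart_inv open_chart_image assms(2)] assms(1) by simp
qed

lemma chart_image_Int:
  assumes "c \<in> \<A>"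
  shows "snd c ` (fst c \<inter> U) = chart_image c \<inter> chart_inv c -` U"
proof (intro set_eqI iffI)
  show "u \<in> chart_image c \<inter> chart_inv c -` U" if "u \<in> snd c ` (fst c \<inter> U)" for u
    using that chart_inv_chart[OF assms] by auto
  show "u \<in> snd c ` (fst c \<inter> U)" if "u \<in> chart_image c \<inter> chart_inv c -` U" for u
    using that chart_inv_in[OF assms, of u] chart_chart_inv[OF assms, of u]
    by (intro image_eqI[of _ _ "chart_inv c u"]) auto
qed

lemma open_overlap: "c \<in> \<A> \<Longrightarrow> d \<in> \<A> \<Longrightarrow> open (snd c ` (fst c \<inter> fst d))"
  by (rule chart_image_subset_open) (simp_all add: open_Int open_chart)

lemma immersion_chart: "c \<in> \<A> \<Longrightarrow> parametrized_immersion (F \<circ> chart_inv c) (chart_image c)"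
  by unfold_locales (auto simp: open_chart_image smooth_F inj_F)

text \<open>Coordinate derivatives under a change of charts.\<close>

text \<open>The derivative of the transition map from chart \<open>c\<close> to chart \<open>d\<close>.\<close>

definition jac :: "('m, 'n) chart \<Rightarrow> ('m, 'n) chart \<Rightarrow> 'm \<Rightarrow> real^'n \<Rightarrow> real^'n" where
  "jac c d p = deriv_at c (snd d) p"

lemma chart_change_has_derivative:
  assumes c: "c \<in> \<A>" "p \<in> fst c" and d: "d \<in> \<A>" "p \<in> fst d"
    and f: "(f \<circ> chart_inv d) differentiable (at (snd d p))"
  shows "((f \<circ> chart_inv c) has_derivative (\<lambda>v. deriv_at d f p (jac c d p v))) (at (snd c p))"
proof -
  let ?O = "snd c ` (fst c \<inter> fst d)"
  have O: "open ?O" by (rule open_overlap[OF c(1) d(1)])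
  have p: "snd c p \<in> ?O" using c d by auto
  have 1: "((snd d \<circ> chart_inv c) has_derivative jac c d p) (at (snd c p))"
    using smooth_on_has_derivative[OF smooth_transition[OF c(1) d(1)] p] by (simp add: jac_def deriv_at_def)
  have "((f \<circ> chart_inv d) has_derivative deriv_at d f p) (at (snd d p))"
    using f by (simp add: deriv_at_def frechet_derivative_works)
  then have "((f \<circ> chart_inv d) has_derivative deriv_at d f p) (at ((snd d \<circ> chart_inv c) (snd c p)))"
    using chart_inv_chart[OF c] by simp
  from has_derivative_compose[OF 1 this]
  have 2: "((\<lambda>u. (f \<circ> chart_inv d) ((snd d \<circ> chart_inv c) u)) has_derivative (\<lambda>v. deriv_at d f p (jac c d p v))) (at (snd c p))" .
  show ?thesis
    by (rule has_derivative_transform_within_open[OF 2 O p])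
      (use chart_inv_chart[OF c(1)] chart_inv_chart[OF d(1)] in auto)
qed

lemma chart_change_deriv:
  assumes "c \<in> \<A>" "p \<in> fst c" "d \<in> \<A>" "p \<in> fst d" "(f \<circ> chart_inv d) differentiable (at (snd d p))"
  shows "deriv_at c f p v = deriv_at d f p (jac c d p v)"
  using frechet_derivative_at[OF chart_change_has_derivative[OF assms], symmetric] by (simp add: deriv_at_def)

lemma chart_change_differentiable:
  fixes f :: "'m \<Rightarrow> 'b::euclidean_space"
  assumes "c \<in> \<A>" "p \<in> fst c" "d \<in> \<A>" "p \<in> fst d"
  shows "(f \<circ> chart_inv c) differentiable (at (snd c p)) \<longleftrightarrow> (f \<circ> chart_inv d) differentiable (at (snd d p))"
  by (rule iffI)
    (erule differentiableI[OF chart_change_has_derivative[OF assms(3,4,1,2)]],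
     erule differentiableI[OF chart_change_has_derivative[OF assms]])

lemma
  assumes "c \<in> \<A>" "p \<in> fst c"
  shows F_differentiable: "(F \<circ> chart_inv c) differentiable (at (snd c p))"
    and linear_dF: "linear (deriv_at c F p)" and inj_dF: "inj (deriv_at c F p)"
  using smooth_on_has_derivative[OF smooth_F[OF assms(1)], of "snd c p"] inj_F[OF assms(1), of "snd c p"] assms(2)
  by (auto simp: deriv_at_def intro: differentiableI has_derivative_linear)

lemma chart_at: "chart_at \<A> p \<in> \<A>" "p \<in> fst (chart_at \<A> p)"
proof -
  have "chart_at \<A> p \<in> \<A> \<and> p \<in> fst (chart_at \<A> p)"
    unfolding chart_at_def by (rule someI_ex) (use chart_cover in blast)
  then show "chart_at \<A> p \<in> \<A>" "p \<in> fst (chart_at \<A> p)" by auto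
qed

lemma tangent_space_chart:
  assumes "c \<in> \<A>" "p \<in> fst c"
  shows "tangent_space \<A> F p = range (deriv_at c F p)"
proof -
  let ?d = "chart_at \<A> p"
  note d = chart_at[of p]
  have "deriv_at ?d F p v \<in> range (deriv_at c F p)" for v
    using chart_change_deriv[OF d assms F_differentiable[OF assms]] by simp
  moreover have "deriv_at c F p v \<in> range (deriv_at ?d F p)" for v
    using chart_change_deriv[OF assms d F_differentiable[OF d]] by simp
  ultimately show ?thesis unfolding tangent_space_def by blast
qed

text \<open>The definitions in terms of tangent vectors refer to the chart selected at \<open>p\<close>. Expressing a tangent vector by its
  coordinates in an arbitrary chart \<open>c\<close> and passing to the selected chart by \<open>jac\<close> removes this choice.\<close>

lemma coords_chart:
  assumes "c \<in> \<A>" "p \<in> fst c"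
  shows "coords \<A> F p (deriv_at c F p v) = jac c (chart_at \<A> p) p v"
  unfolding coords_def
  using chart_change_deriv[OF assms chart_at[of p] F_differentiable[OF chart_at]] inj_dF[OF chart_at[of p]]
  by (simp add: inv_f_f)

lemma dir_deriv_chart:
  assumes "c \<in> \<A>" "p \<in> fst c" "(f \<circ> chart_inv c) differentiable (at (snd c p))"
  shows "dir_deriv \<A> F f p (deriv_at c F p v) = deriv_at c f p v"
proof -
  have "(f \<circ> chart_inv (chart_at \<A> p)) differentiable (at (snd (chart_at \<A> p) p))"
    using chart_change_differentiable[OF assms(1,2) chart_at, of f] assms(3) by simp
  from chart_change_deriv[OF assms(1,2) chart_at this] show ?thesis
    by (simp add: dir_deriv_def coords_chart[OF assms(1,2)])
qed

lemma normal_part_unique: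
  assumes c: "c \<in> \<A>" "p \<in> fst c" and w: "\<And>a. w \<bullet> deriv_at c F p a = 0" "v - w \<in> range (deriv_at c F p)"
  shows "normal_part \<A> F p v = w"
  unfolding normal_part_def tangent_space_chart[OF c]
proof (rule the_equality)
  show "w \<in> orthogonal_comp (range (deriv_at c F p)) \<and> v - w \<in> range (deriv_at c F p)"
    using w by (auto simp: orthogonal_comp_def orthogonal_def inner_commute)
  fix w' assume w': "w' \<in> orthogonal_comp (range (deriv_at c F p)) \<and> v - w' \<in> range (deriv_at c F p)"
  then obtain a b where "v - w = deriv_at c F p a" "v - w' = deriv_at c F p b" using w(2) by auto
  moreover have "w' - w = (v - w) - (v - w')" by simp
  ultimately have "w' - w = deriv_at c F p (a - b)" by (simp only: linear_diff[OF linear_dF[OF c]])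
  moreover have "(w' - w) \<bullet> deriv_at c F p (a - b) = 0"
    using w(1) w' by (auto simp: orthogonal_comp_def orthogonal_def inner_diff_left inner_commute)
  ultimately have "(w' - w) \<bullet> (w' - w) = 0" by metis
  then show "w' = w" by simp
qed

lemma normal_part_chart:
  assumes c: "c \<in> \<A>" "p \<in> fst c"
  shows "normal_part \<A> F p v = v - tangential (deriv_at c F p) v"
  using tangential_inner[OF linear_dF[OF c] inj_dF[OF c]] tangential_range[OF linear_dF[OF c]]
  by (intro normal_part_unique[OF c]) auto

lemma linear_normal_part: "linear (normal_part \<A> F p)"
proof -
  obtain c where c: "c \<in> \<A>" "p \<in> fst c" using chart_cover by blast
  have "normal_part \<A> F p = (\<lambda>v. v - tangential (deriv_at c F p) v)"
    by (rule ext) (rule normal_part_chart[OF c])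
  then show ?thesis using linear_compose_sub[OF linear_id tangential_linear] by (simp add: id_def)
qed

lemma normal_part_tangent:
  assumes c: "c \<in> \<A>" "p \<in> fst c"
  shows "normal_part \<A> F p (v + deriv_at c F p a) = normal_part \<A> F p v"
  by (simp add: linear_add[OF linear_normal_part] normal_part_chart[OF c, of "deriv_at c F p a"]
      tangential_id[OF linear_dF[OF c] inj_dF[OF c]])

lemma normal_part_inner:
  assumes c: "c \<in> \<A>" "p \<in> fst c"
  shows "normal_part \<A> F p v \<bullet> deriv_at c F p a = 0"
  by (simp add: normal_part_chart[OF c] tangential_inner[OF linear_dF[OF c] inj_dF[OF c]])

abbreviation hess :: "('m, 'n) chart \<Rightarrow> 'm \<Rightarrow> real^'n \<Rightarrow> real^'n \<Rightarrow> real^('n + 1)" where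
  "hess c p \<equiv> second_derivative (F \<circ> chart_inv c) (snd c p)"

text \<open>Differentiating \<open>D\<Phi>\<^sub>c = D\<Phi>\<^sub>d \<circ> D\<tau>\<close> once more produces the second derivative of \<open>\<tau>\<close>, but only inside \<open>D\<Phi>\<^sub>d\<close>,
  where it is tangential. So the normal part of the second derivative transforms like a bilinear form.\<close>

lemma hess_chart_change:
  assumes c: "c \<in> \<A>" "p \<in> fst c" and d: "d \<in> \<A>" "p \<in> fst d"
  shows "\<exists>w. hess c p a b = hess d p (jac c d p a) (jac c d p b) + deriv_at d F p w"
proof -
  let ?O = "snd c ` (fst c \<inter> fst d)" and ?\<tau> = "snd d \<circ> chart_inv c" and ?u = "snd c p"
  let ?Fc = "F \<circ> chart_inv c" and ?Fd = "F \<circ> chart_inv d"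
  let ?b = "\<lambda>u. frechet_derivative ?\<tau> (at u) b" and ?D = "\<lambda>y. frechet_derivative ?Fd (at y)"
  have O: "open ?O" by (rule open_overlap[OF c(1) d(1)])
  have u: "?u \<in> ?O" using c d by auto
  have \<tau>u: "?\<tau> ?u = snd d p" using chart_inv_chart[OF c] by simp
  have \<tau>O: "?\<tau> u \<in> chart_image d" if "u \<in> ?O" for u
    using that chart_inv_chart[OF c(1)] by auto
  have D1: "frechet_derivative ?Fc (at u) b = (\<Sum>k\<in>UNIV. ?b u $ k *\<^sub>R ?D (?\<tau> u) (ax k))" if "u \<in> ?O" for u
  proof -
    from that obtain q where q: "q \<in> fst c" "q \<in> fst d" "u = snd c q" by auto
    have "deriv_at c F q b = deriv_at d F q (jac c d q b)"
      by (rule chart_change_deriv[OF c(1) q(1) d(1) q(2) F_differentiable[OF d(1) q(2)]])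
    also have "\<dots> = (\<Sum>k\<in>UNIV. jac c d q b $ k *\<^sub>R deriv_at d F q (ax k))"
      by (rule linear_axis_expansion[OF linear_dF[OF d(1) q(2)]])
    finally show ?thesis using q chart_inv_chart[OF c(1)] by (simp add: deriv_at_def jac_def)
  qed
  have d\<tau>: "(?\<tau> has_derivative jac c d p) (at ?u)"
    using smooth_on_has_derivative[OF smooth_transition[OF c(1) d(1)] u] by (simp add: jac_def deriv_at_def)
  have db: "((\<lambda>u. ?b u $ k) has_derivative (\<lambda>v. frechet_derivative ?b (at ?u) v $ k)) (at ?u)" for k
    using smooth_on_has_derivative[OF smooth_on_frechet_derivative[OF smooth_transition[OF c(1) d(1)]] u]
    by (rule bounded_linear.has_derivative[OF bounded_linear_vec_nth])
  have dD: "((\<lambda>u. ?D (?\<tau> u) (ax k)) has_derivative (\<lambda>v. hess d p (jac c d p v) (ax k))) (at ?u)" for k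
  proof -
    have "((\<lambda>y. ?D y (ax k)) has_derivative (\<lambda>v. hess d p v (ax k))) (at (?\<tau> ?u))"
      unfolding \<tau>u second_derivative_def
      by (rule smooth_on_has_derivative[OF smooth_on_frechet_derivative[OF smooth_F[OF d(1)]]]) (use d in auto)
    from has_derivative_compose[OF d\<tau> this] show ?thesis .
  qed
  have "((\<lambda>u. \<Sum>k\<in>UNIV. ?b u $ k *\<^sub>R ?D (?\<tau> u) (ax k)) has_derivative
     (\<lambda>v. \<Sum>k\<in>UNIV. ?b ?u $ k *\<^sub>R hess d p (jac c d p v) (ax k) + (frechet_derivative ?b (at ?u) v $ k) *\<^sub>R ?D (?\<tau> ?u) (ax k))) (at ?u)"
    by (intro has_derivative_sum has_derivative_scaleR db dD)
  from frechet_derivative_at[OF this, symmetric]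
  have "frechet_derivative (\<lambda>u. \<Sum>k\<in>UNIV. ?b u $ k *\<^sub>R ?D (?\<tau> u) (ax k)) (at ?u) a =
     (\<Sum>k\<in>UNIV. ?b ?u $ k *\<^sub>R hess d p (jac c d p a) (ax k) + (frechet_derivative ?b (at ?u) a $ k) *\<^sub>R ?D (?\<tau> ?u) (ax k))" by simp
  also have "\<dots> = hess d p (jac c d p a) (jac c d p b) + deriv_at d F p (frechet_derivative ?b (at ?u) a)"
  proof -
    have "linear (hess d p (jac c d p a))"
      by (rule second_derivative_linear_right[OF open_chart_image[OF d(1)] _ smooth_F[OF d(1)]]) (use d in auto)
    from linear_axis_expansion[OF this, of "jac c d p b"] linear_axis_expansion[OF linear_dF[OF d], of "frechet_derivative ?b (at ?u) a"]
    show ?thesis by (simp add: sum.distrib jac_def deriv_at_def chart_inv_chart[OF c])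
  qed
  also have "frechet_derivative (\<lambda>u. \<Sum>k\<in>UNIV. ?b u $ k *\<^sub>R ?D (?\<tau> u) (ax k)) (at ?u) a = hess c p a b"
    unfolding second_derivative_def using frechet_derivative_cong_open[OF O u D1] by simp
  finally show ?thesis by blast
qed

lemma second_fundamental_form_chart:
  assumes c: "c \<in> \<A>" "p \<in> fst c"
  shows "second_fundamental_form \<A> F p (deriv_at c F p a) (deriv_at c F p b) = normal_part \<A> F p (hess c p a b)"
proof -
  let ?d = "chart_at \<A> p"
  note d = chart_at[of p]
  let ?b = "jac c ?d p b" and ?Fd = "F \<circ> chart_inv ?d"
  let ?Y = "extend_field \<A> F p (deriv_at c F p b)"
  have Y: "(?Y \<circ> chart_inv ?d) u = frechet_derivative ?Fd (at u) ?b" if "u \<in> chart_image ?d" for u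
    unfolding o_def extend_field_def coords_chart[OF c]
    using chart_chart_inv[OF d(1) that] by (simp add: deriv_at_def o_def)
  have "frechet_derivative (?Y \<circ> chart_inv ?d) (at (snd ?d p)) = frechet_derivative (\<lambda>u. frechet_derivative ?Fd (at u) ?b) (at (snd ?d p))"
    by (rule frechet_derivative_cong_open[OF open_chart_image[OF d(1)] _ Y]) (use d in auto)
  then have "deriv_at ?d ?Y p (jac c ?d p a) = hess ?d p (jac c ?d p a) ?b"
    by (simp add: deriv_at_def second_derivative_def)
  then have 1: "dir_deriv \<A> F ?Y p (deriv_at c F p a) = hess ?d p (jac c ?d p a) ?b"
    by (simp add: dir_deriv_def coords_chart[OF c])
  obtain w where w: "hess c p a b = hess ?d p (jac c ?d p a) ?b + deriv_at ?d F p w"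
    using hess_chart_change[OF c d] by blast
  show ?thesis unfolding second_fundamental_form_def 1 w normal_part_tangent[OF d] ..
qed

lemma tangent_onb:
  "pairwise orthogonal (tangent_onb \<A> F p)" "e \<in> tangent_onb \<A> F p \<Longrightarrow> norm e = 1"
  "span (tangent_onb \<A> F p) = tangent_space \<A> F p"
proof -
  have "subspace (tangent_space \<A> F p)"
    unfolding tangent_space_def using linear_dF[OF chart_at] linear_subspace_image subspace_UNIV by blast
  then obtain B where "B \<subseteq> tangent_space \<A> F p" "pairwise orthogonal B" "\<And>x. x \<in> B \<Longrightarrow> norm x = 1" "span B = tangent_space \<A> F p"
    by (rule orthonormal_basis_subspace) blast
  then have "\<exists>B. pairwise orthogonal B \<and> (\<forall>e\<in>B. norm e = 1) \<and> span B = tangent_space \<A> F p" by blast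
  from someI_ex[OF this]
  show "pairwise orthogonal (tangent_onb \<A> F p)" "e \<in> tangent_onb \<A> F p \<Longrightarrow> norm e = 1"
    "span (tangent_onb \<A> F p) = tangent_space \<A> F p"
    unfolding tangent_onb_def by blast+
qed

abbreviation ginv :: "('m, 'n) chart \<Rightarrow> 'm \<Rightarrow> 'n \<Rightarrow> 'n \<Rightarrow> real" where
  "ginv c p i j \<equiv> gram_inv (deriv_at c F p) $ i $ j"

text \<open>The diagonal \<open>b\<close> of the bilinear form is all that the sum over the basis sees, and it is only known on tangent
  vectors \<open>deriv_at c F p v\<close>.\<close>

lemma trace_tangent_onb:
  fixes \<beta> :: "real^'n \<Rightarrow> real^'n \<Rightarrow> 'c::real_vector"
  assumes c: "c \<in> \<A>" "p \<in> fst c"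
    and \<beta>: "\<And>v. linear (\<beta> v)" "\<And>w. linear (\<lambda>v. \<beta> v w)"
    and B: "\<And>v. deriv_at c F p v \<in> tangent_onb \<A> F p \<Longrightarrow> b (deriv_at c F p v) = \<beta> v v"
  shows "(\<Sum>e\<in>tangent_onb \<A> F p. b e) = (\<Sum>i\<in>UNIV. \<Sum>j\<in>UNIV. ginv c p i j *\<^sub>R \<beta> (ax i) (ax j))"
proof -
  have "b e = \<beta> (inv (deriv_at c F p) e) (inv (deriv_at c F p) e)" if "e \<in> tangent_onb \<A> F p" for e
  proof -
    have "e \<in> range (deriv_at c F p)"
      using that tangent_onb(3)[of p] tangent_space_chart[OF c] span_base by blast
    then have "deriv_at c F p (inv (deriv_at c F p) e) = e" by (rule f_inv_into_f)
    then show ?thesis using B[of "inv (deriv_at c F p) e"] that by simp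
  qed
  then have "(\<Sum>e\<in>tangent_onb \<A> F p. b e) =
      (\<Sum>e\<in>tangent_onb \<A> F p. \<beta> (inv (deriv_at c F p) e) (inv (deriv_at c F p) e))" by (rule sum.cong[OF refl])
  also have "\<dots> = (\<Sum>i\<in>UNIV. \<Sum>j\<in>UNIV. ginv c p i j *\<^sub>R \<beta> (ax i) (ax j))"
    using tangent_onb(3)[of p] tangent_space_chart[OF c]
    by (intro trace_onb linear_dF[OF c] inj_dF[OF c] tangent_onb(1,2) \<beta>) auto
  finally show ?thesis .
qed

lemma linear_hess:
  assumes "c \<in> \<A>" "p \<in> fst c"
  shows "linear (hess c p v)" "linear (\<lambda>v. hess c p v w)"
  using second_derivative_linear_right[OF open_chart_image[OF assms(1)] _ smooth_F[OF assms(1)], of "snd c p" v]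
    second_derivative_linear_left[OF _ smooth_F[OF assms(1)], of "snd c p" w] assms(2) by auto

lemma linear_normal_hess:
  assumes "c \<in> \<A>" "p \<in> fst c"
  shows "linear (\<lambda>w. normal_part \<A> F p (hess c p v w))" "linear (\<lambda>v. normal_part \<A> F p (hess c p v w))"
  using linear_compose[OF linear_hess(1)[OF assms] linear_normal_part]
    linear_compose[OF linear_hess(2)[OF assms] linear_normal_part] by (simp_all add: o_def)

lemma mean_curvature_vector_chart:
  assumes c: "c \<in> \<A>" "p \<in> fst c"
  shows "mean_curvature_vector \<A> F p =
    normal_part \<A> F p (\<Sum>i\<in>UNIV. \<Sum>j\<in>UNIV. ginv c p i j *\<^sub>R hess c p (ax i) (ax j))"
proof -
  have "mean_curvature_vector \<A> F p = (\<Sum>i\<in>UNIV. \<Sum>j\<in>UNIV. ginv c p i j *\<^sub>R normal_part \<A> F p (hess c p (ax i) (ax j)))"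
    unfolding mean_curvature_vector_def
    by (rule trace_tangent_onb[OF c linear_normal_hess[OF c]]) (rule second_fundamental_form_chart[OF c])
  then show ?thesis by (simp add: linear_sum[OF linear_normal_part] linear_cmul[OF linear_normal_part])
qed

lemma norm_A_sq_chart:
  assumes c: "c \<in> \<A>" "p \<in> fst c"
  shows "norm_A_sq \<A> F p = (\<Sum>i\<in>UNIV. \<Sum>j\<in>UNIV. ginv c p i j * (\<Sum>k\<in>UNIV. \<Sum>l\<in>UNIV. ginv c p k l *
     (normal_part \<A> F p (hess c p (ax i) (ax k)) \<bullet> normal_part \<A> F p (hess c p (ax j) (ax l)))))"
proof -
  define N where "N = (\<lambda>v w. normal_part \<A> F p (hess c p v w))"
  have N: "second_fundamental_form \<A> F p (deriv_at c F p v) (deriv_at c F p w) = N v w" for v w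
    by (simp only: N_def second_fundamental_form_chart[OF c])
  have lin: "linear (N v)" "linear (\<lambda>v. N v w)" for v w
    unfolding N_def by (rule linear_normal_hess[OF c])+
  have inner: "(\<Sum>e'\<in>tangent_onb \<A> F p. (norm (second_fundamental_form \<A> F p (deriv_at c F p v) e'))\<^sup>2) =
     (\<Sum>k\<in>UNIV. \<Sum>l\<in>UNIV. ginv c p k l *\<^sub>R (N v (ax k) \<bullet> N v (ax l)))" for v
    by (rule trace_tangent_onb[OF c])
      (auto simp: N power2_norm_eq_inner linear_add[OF lin(1)] linear_cmul[OF lin(1)]
        inner_add_left inner_add_right intro!: linearI)
  have "norm_A_sq \<A> F p = (\<Sum>i\<in>UNIV. \<Sum>j\<in>UNIV. ginv c p i j *\<^sub>R (\<Sum>k\<in>UNIV. \<Sum>l\<in>UNIV. ginv c p k l *\<^sub>R (N (ax i) (ax k) \<bullet> N (ax j) (ax l))))"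
    unfolding norm_A_sq_def
    by (rule trace_tangent_onb[OF c, where \<beta>="\<lambda>v w. \<Sum>k\<in>UNIV. \<Sum>l\<in>UNIV. ginv c p k l *\<^sub>R (N v (ax k) \<bullet> N w (ax l))"])
      (auto simp: inner linear_add[OF lin(2)] linear_cmul[OF lin(2)]
        inner_add_left inner_add_right sum.distrib distrib_left sum_distrib_left mult_ac intro!: linearI)
  then show ?thesis by (simp add: N_def)
qed

lemma gradient_chart:
  assumes c: "c \<in> \<A>" "p \<in> fst c" and f: "(f \<circ> chart_inv c) differentiable (at (snd c p))"
  shows "gradient \<A> F f p = (\<Sum>i\<in>UNIV. \<Sum>j\<in>UNIV. (ginv c p i j * deriv_at c f p (ax i)) *\<^sub>R deriv_at c F p (ax j))"
proof -
  have lf: "linear (deriv_at c f p)"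
    using f by (simp add: deriv_at_def linear_frechet_derivative)
  note lF = linear_dF[OF c]
  have "gradient \<A> F f p = (\<Sum>i\<in>UNIV. \<Sum>j\<in>UNIV. ginv c p i j *\<^sub>R (deriv_at c f p (ax i) *\<^sub>R deriv_at c F p (ax j)))"
    unfolding gradient_def
    by (rule trace_tangent_onb[OF c])
      (auto simp: dir_deriv_chart[OF c f] linear_add[OF lf] linear_add[OF lF] linear_cmul[OF lf] linear_cmul[OF lF]
        scaleR_add_left scaleR_add_right mult_ac intro!: linearI)
  then show ?thesis by simp
qed

lemma gradient_inner_differentiable:
  assumes c: "c \<in> \<A>" "p \<in> fst c" and f: "(f \<circ> chart_inv c) differentiable (at (snd c p))"
  shows "gradient \<A> F f p \<bullet> deriv_at c F p v = deriv_at c f p v"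
proof -
  have lf: "linear (deriv_at c f p)"
    using f by (simp add: deriv_at_def linear_frechet_derivative)
  have "gradient \<A> F f p \<bullet> deriv_at c F p v = (\<Sum>i\<in>UNIV. deriv_at c f p (ax i) * (\<Sum>j\<in>UNIV. ginv c p i j * (deriv_at c F p (ax j) \<bullet> deriv_at c F p v)))"
    by (simp add: gradient_chart[OF c f] inner_sum_left sum_distrib_left mult_ac)
  also have "\<dots> = (\<Sum>i\<in>UNIV. v $ i * deriv_at c f p (ax i))"
    by (simp add: gram_inv_apply[OF linear_dF[OF c] inj_dF[OF c]] mult.commute)
  also have "\<dots> = deriv_at c f p v" using linear_axis_expansion[OF lf, of v] by simp
  finally show ?thesis .
qed

lemma gradient_range_differentiable:
  assumes c: "c \<in> \<A>" "p \<in> fst c" and f: "(f \<circ> chart_inv c) differentiable (at (snd c p))"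
  shows "gradient \<A> F f p \<in> range (deriv_at c F p)"
proof -
  have "subspace (range (deriv_at c F p))" by (rule linear_subspace_image[OF linear_dF[OF c] subspace_UNIV])
  then show ?thesis unfolding gradient_chart[OF c f]
    by (intro subspace_sum subspace_scale) auto
qed

text \<open>The tangent vector that represents the differential is unique. This is how gradients are computed below, from
  the usual rules for derivatives of functions on \<open>\<real>\<^sup>n\<close>.\<close>

lemma gradient_eqI:
  fixes f :: "'m \<Rightarrow> real"
  assumes c: "c \<in> \<A>" "p \<in> fst c" and X: "X \<in> range (deriv_at c F p)"
    and f: "((f \<circ> chart_inv c) has_derivative (\<lambda>v. X \<bullet> deriv_at c F p v)) (at (snd c p))"
  shows "gradient \<A> F f p = X"
proof -
  let ?Y = "gradient \<A> F f p - X"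
  note d = differentiableI[OF f]
  have "deriv_at c f p = (\<lambda>v. X \<bullet> deriv_at c F p v)"
    unfolding deriv_at_def[of c f] by (rule frechet_derivative_at[OF f, symmetric])
  then have orth: "?Y \<bullet> deriv_at c F p v = 0" for v
    by (simp add: inner_diff_left gradient_inner_differentiable[OF c d])
  have "subspace (range (deriv_at c F p))" by (rule linear_subspace_image[OF linear_dF[OF c] subspace_UNIV])
  then have "?Y \<in> range (deriv_at c F p)"
    using subspace_diff gradient_range_differentiable[OF c d] X by blast
  then obtain v where "?Y = deriv_at c F p v" by auto
  then have "?Y \<bullet> ?Y = 0" using orth[of v] by simp
  then show ?thesis by simp
qed

end

section \<open>The volume measure\<close>

context hypersurface
begin

lemma volume_density_gram: "volume_density c F u = sqrt (det (gram (frechet_derivative (F \<circ> chart_inv c) (at u))))"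
  by (simp add: volume_density_def gram_def Let_def)

lemma
  assumes "c \<in> \<A>"
  shows volume_density_pos: "\<And>u. u \<in> chart_image c \<Longrightarrow> volume_density c F u > 0"
    and smooth_volume_density: "smooth_on (volume_density c F) (chart_image c)"
proof -
  note im = immersion_chart[OF assms]
  have "volume_density c F = parametrized_immersion.vol (F \<circ> chart_inv c)"
    by (simp add: fun_eq_iff volume_density_gram parametrized_immersion.vol_def[OF im])
  then show "\<And>u. u \<in> chart_image c \<Longrightarrow> volume_density c F u > 0" "smooth_on (volume_density c F) (chart_image c)"
    using parametrized_immersion.vol_pos[OF im] parametrized_immersion.smooth_vol[OF im] by auto
qed

text \<open>The inverse of a chart, made total so that a measure can be pushed forward by it. As \<open>chart_density\<close> vanishes
  outside of the chart, any default value will do there.\<close>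

definition chart_param :: "('m, 'n) chart \<Rightarrow> real^'n \<Rightarrow> 'm" where
  "chart_param c u = (if u \<in> chart_image c then chart_inv c u else undefined)"

definition chart_density :: "('m, 'n) chart \<Rightarrow> real^'n \<Rightarrow> real" where
  "chart_density c u = (if u \<in> chart_image c then volume_density c F u else 0)"

definition chart_measure :: "('m, 'n) chart \<Rightarrow> 'm measure" where
  "chart_measure c = distr (density lborel (chart_density c)) borel (chart_param c)"

lemma sets_chart_measure [simp]: "sets (chart_measure c) = sets borel" "space (chart_measure c) = UNIV"
  by (simp_all add: chart_measure_def)

lemma measurable_chart_param [measurable]: "c \<in> \<A> \<Longrightarrow> chart_param c \<in> borel_measurable borel"
  unfolding chart_param_def[abs_def]
  by (intro borel_measurable_continuous_on_if)
    (auto intro: continuous_chart_inv borel_open open_chart_image)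

lemma measurable_chart_density [measurable]: "c \<in> \<A> \<Longrightarrow> chart_density c \<in> borel_measurable borel"
  unfolding chart_density_def[abs_def]
  by (intro borel_measurable_continuous_on_if)
    (auto intro: smooth_on_continuous smooth_volume_density borel_open open_chart_image)

lemma chart_density_nonneg: "c \<in> \<A> \<Longrightarrow> 0 \<le> chart_density c u"
  using volume_density_pos by (simp add: chart_density_def less_imp_le)

lemma chart_image_eq_vimage:
  assumes "c \<in> \<A>" "E \<subseteq> fst c"
  shows "snd c ` E = chart_image c \<inter> chart_param c -` E"
proof -
  have "fst c \<inter> E = E" using assms(2) by auto
  then have "snd c ` E = chart_image c \<inter> chart_inv c -` E"
    using chart_image_Int[OF assms(1), of E] by simp
  then show ?thesis by (auto simp: chart_param_def)
qed

lemma borel_chart_image: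
  assumes "c \<in> \<A>" "E \<in> sets borel" "E \<subseteq> fst c"
  shows "snd c ` E \<in> sets borel"
  unfolding chart_image_eq_vimage[OF assms(1,3)]
  using measurable_sets_borel[OF measurable_chart_param[OF assms(1)] assms(2)] open_chart_image[OF assms(1)]
  by (intro sets.Int) auto

lemma emeasure_chart_measure:
  assumes "c \<in> \<A>" "E \<in> sets borel" "E \<subseteq> fst c"
  shows "emeasure (chart_measure c) E = (\<integral>\<^sup>+u\<in>snd c ` E. ennreal (volume_density c F u) \<partial>lborel)"
proof -
  note [measurable] = measurable_chart_param[OF assms(1)] measurable_chart_density[OF assms(1)]
  have [measurable]: "chart_param c -` E \<in> sets borel"
    by (rule measurable_sets_borel[OF _ assms(2)]) measurable
  have "emeasure (chart_measure c) E = (\<integral>\<^sup>+u. ennreal (chart_density c u) * indicator (chart_param c -` E) u \<partial>lborel)"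
    unfolding chart_measure_def using assms(2) by (simp add: emeasure_distr emeasure_density)
  also have "\<dots> = (\<integral>\<^sup>+u\<in>snd c ` E. ennreal (volume_density c F u) \<partial>lborel)"
    by (rule nn_integral_cong)
      (auto simp: chart_image_eq_vimage[OF assms(1,3)] chart_density_def indicator_def)
  finally show ?thesis .
qed

text \<open>On an overlap the densities differ by the factor \<open>\<bar>det \<tau>'\<bar>\<close>, because \<open>det (J\<^sup>T g J) = (det J)\<^sup>2 det g\<close>. The change of
  variables formula absorbs this factor.\<close>

lemma chart_measure_overlap:
  assumes c: "c \<in> \<A>" and d: "d \<in> \<A>" and E: "E \<in> sets borel" "E \<subseteq> fst c" "E \<subseteq> fst d"
  shows "emeasure (chart_measure c) E = emeasure (chart_measure d) E"
proof -
  let ?U = "snd c ` (fst c \<inter> fst d)" and ?\<tau> = "snd d \<circ> chart_inv c" and ?g = "snd c \<circ> chart_inv d"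
  let ?J = "\<lambda>u. frechet_derivative ?\<tau> (at u)"
  define h where "h = (\<lambda>y. indicator (snd d ` E) y * ennreal (chart_density d y))"
  have [measurable]: "snd d ` E \<in> sets borel" by (rule borel_chart_image[OF d E(1,3)])
  have hm: "h \<in> borel_measurable borel" unfolding h_def
    using measurable_chart_density[OF d] by measurable
  have \<tau>U: "?\<tau> ` ?U = snd d ` (fst d \<inter> fst c)"
    using chart_inv_chart[OF c] by (force simp: image_iff)
  have der: "(?\<tau> has_derivative ?J u) (at u)" if "u \<in> ?U" for u
    by (rule smooth_on_has_derivative[OF smooth_transition[OF c d] that])
  have sub: "snd d ` E \<subseteq> ?\<tau> ` ?U" unfolding \<tau>U using E by auto
  have "(\<integral>\<^sup>+y. indicator (?\<tau> ` ?U) y * h y \<partial>lborel) =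
      (\<integral>\<^sup>+u. indicator ?U u * (ennreal \<bar>det (matrix (?J u))\<bar> * h (?\<tau> u)) \<partial>lborel)"
  proof (rule nn_integral_change_of_variables[OF open_overlap[OF c d] _ der _ _ _ hm])
    show "open (?\<tau> ` ?U)" unfolding \<tau>U by (rule open_overlap[OF d c])
    have "smooth_on (\<lambda>u. det (matrix (?J u))) ?U"
      unfolding det_def matrix_def
      by (simp, intro smooth_intros open_overlap c d)
        (simp add: smooth_on_inner[OF open_overlap[OF c d] smooth_on_frechet_derivative[OF smooth_transition[OF c d]] smooth_on_const[OF open_overlap[OF c d]], of _ "axis _ 1", unfolded inner_axis, simplified])
    then show "continuous_on ?U (\<lambda>u. det (matrix (?J u)))" by (rule smooth_on_continuous)
    show "continuous_on (?\<tau> ` ?U) ?g" unfolding \<tau>U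
      by (rule smooth_on_continuous[OF smooth_transition[OF d c]])
    show "?g (?\<tau> u) = u" if "u \<in> ?U" for u
      using that chart_inv_chart[OF c] chart_inv_chart[OF d] by auto
  qed
  moreover have "(\<integral>\<^sup>+y. indicator (?\<tau> ` ?U) y * h y \<partial>lborel) = emeasure (chart_measure d) E"
    unfolding emeasure_chart_measure[OF d E(1,3)]
    by (rule nn_integral_cong) (use sub E in \<open>auto simp: h_def indicator_def chart_density_def\<close>)
  moreover have "(\<integral>\<^sup>+u. indicator ?U u * (ennreal \<bar>det (matrix (?J u))\<bar> * h (?\<tau> u)) \<partial>lborel) = emeasure (chart_measure c) E"
    unfolding emeasure_chart_measure[OF c E(1,2)]
  proof (rule nn_integral_cong)
    fix u
    show "indicator ?U u * (ennreal \<bar>det (matrix (?J u))\<bar> * h (?\<tau> u)) = ennreal (volume_density c F u) * indicator (snd c ` E) u"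
    proof (cases "u \<in> ?U")
      case False
      then have "u \<notin> snd c ` E" using E by auto
      then show ?thesis using False by simp
    next
      case True
      then obtain p where p: "p \<in> fst c" "p \<in> fst d" "u = snd c p" by auto
      have \<tau>u: "?\<tau> u = snd d p" using p chart_inv_chart[OF c] by simp
      have E_iff: "?\<tau> u \<in> snd d ` E \<longleftrightarrow> u \<in> snd c ` E"
        using p E inj_onD[OF inj_chart[OF c]] inj_onD[OF inj_chart[OF d]] unfolding \<tau>u by blast
      have "frechet_derivative (F \<circ> chart_inv c) (at u) = (\<lambda>v. deriv_at d F p (?J u v))"
        using chart_change_deriv[OF c p(1) d p(2) F_differentiable[OF d p(2)]] p
        by (simp add: deriv_at_def jac_def fun_eq_iff)
      then have "volume_density c F u = \<bar>det (matrix (?J u))\<bar> * volume_density d F (?\<tau> u)"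
        unfolding volume_density_gram \<tau>u
        using det_gram_compose[OF linear_dF[OF d p(2)] has_derivative_linear[OF der[OF True]]]
        by (simp add: real_sqrt_mult deriv_at_def)
      moreover have "chart_density d (?\<tau> u) = volume_density d F (?\<tau> u)"
        using p \<tau>u by (simp add: chart_density_def)
      ultimately show ?thesis using True E_iff volume_density_pos[OF d, of "?\<tau> u"] p \<tau>u
        by (auto simp: h_def indicator_def ennreal_mult)
    qed
  qed
  ultimately show ?thesis by simp
qed

lemma emeasure_chart_measure_Int:
  assumes "c \<in> \<A>" "E \<in> sets borel"
  shows "emeasure (chart_measure c) E = emeasure (chart_measure c) (E \<inter> fst c)"
proof -
  note [measurable] = measurable_chart_param[OF assms(1)] measurable_chart_density[OF assms(1)]
  have em: "emeasure (chart_measure c) E = (\<integral>\<^sup>+u. ennreal (chart_density c u) * indicator (chart_param c -` E) u \<partial>lborel)"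
    if "E \<in> sets borel" for E
  proof -
    have [measurable]: "chart_param c -` E \<in> sets borel"
      by (rule measurable_sets_borel[OF _ that]) measurable
    show ?thesis unfolding chart_measure_def using that by (simp add: emeasure_distr emeasure_density)
  qed
  have "E \<inter> fst c \<in> sets borel" using assms open_chart by auto
  then show ?thesis unfolding em[OF assms(2)] em[OF \<open>E \<inter> fst c \<in> sets borel\<close>]
    by (intro nn_integral_cong)
      (use chart_inv_in[OF assms(1)] in \<open>auto simp: chart_density_def chart_param_def indicator_def\<close>)
qed

definition is_volume_measure :: "'m measure \<Rightarrow> bool" where
  "is_volume_measure \<sigma> \<longleftrightarrow> sets \<sigma> = sets borel \<and>
     (\<forall>c\<in>\<A>. \<forall>E\<in>sets borel. E \<subseteq> fst c \<longrightarrow>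
        emeasure \<sigma> E = (\<integral>\<^sup>+u\<in>snd c ` E. ennreal (volume_density c F u) \<partial>lborel))"

text \<open>Second countability enters here: the chart domains have a countable subcover, which is made disjoint.\<close>

lemma countable_partition_by_charts:
  "\<exists>(ch :: nat \<Rightarrow> ('m, 'n) chart) P. (\<forall>n. ch n \<in> \<A> \<and> P n \<in> sets borel \<and> P n \<subseteq> fst (ch n)) \<and>
     disjoint_family P \<and> (\<Union>n. P n) = UNIV"
proof -
  obtain \<U> where \<U>: "\<U> \<subseteq> fst ` \<A>" "countable \<U>" "\<Union>\<U> = \<Union>(fst ` \<A>)"
    using Lindelof[of "fst ` \<A>"] open_chart by blast
  have UN: "\<Union>\<U> = UNIV" using \<U>(3) chart_cover by auto
  then have ne: "\<U> \<noteq> {}" by auto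
  have "\<forall>n. \<exists>c. c \<in> \<A> \<and> fst c = from_nat_into \<U> n"
    using from_nat_into[OF ne] \<U>(1) by force
  then obtain ch where ch: "\<And>n. ch n \<in> \<A>" "\<And>n. fst (ch n) = from_nat_into \<U> n" by metis
  have "(\<Union>n. fst (ch n)) = UNIV"
    using UN range_from_nat_into[OF ne \<U>(2)] by (simp add: ch(2))
  define P where "P = disjointed (\<lambda>n. fst (ch n))"
  have "range (\<lambda>n. fst (ch n)) \<subseteq> sets borel"
    using borel_open[OF open_chart[OF ch(1)]] by blast
  then have "range P \<subseteq> sets borel" unfolding P_def by (rule sets.range_disjointed_sets)
  then have "P n \<in> sets borel" for n by auto
  moreover have "P n \<subseteq> fst (ch n)" for n unfolding P_def by (rule disjointed_subset)
  moreover have "disjoint_family P" unfolding P_def by (rule disjoint_family_disjointed)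
  moreover have "(\<Union>n. P n) = UNIV"
    unfolding P_def UN_disjointed_eq by fact
  ultimately show ?thesis using ch(1) by (intro exI[of _ ch] exI[of _ P]) simp
qed

text \<open>On each piece of a countable partition into Borel subsets of charts the measure is prescribed by that
  chart. Adding up gives existence, and \<open>chart_measure_overlap\<close> says that the sum has the right value on
  every other chart as well. Uniqueness follows from the same partition.\<close>

lemma ex1_volume_measure: "\<exists>!\<sigma>. is_volume_measure \<sigma>"
proof -
  obtain ch :: "nat \<Rightarrow> ('m, 'n) chart" and P :: "nat \<Rightarrow> 'm set"
    where *: "(\<forall>n. ch n \<in> \<A> \<and> P n \<in> sets borel \<and> P n \<subseteq> fst (ch n)) \<and> disjoint_family P \<and> (\<Union>n. P n) = UNIV"
    using countable_partition_by_charts by (elim exE)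
  have ch: "\<And>n. ch n \<in> \<A>" and P: "\<And>n. P n \<in> sets borel" "\<And>n. P n \<subseteq> fst (ch n)"
    "disjoint_family P" "(\<Union>n. P n) = UNIV" using * by auto
  note [measurable] = P(1)
  have spec: "is_volume_measure \<sigma> \<longleftrightarrow> sets \<sigma> = sets borel \<and>
     (\<forall>c\<in>\<A>. \<forall>E\<in>sets borel. E \<subseteq> fst c \<longrightarrow> emeasure \<sigma> E = emeasure (chart_measure c) E)" for \<sigma>
    unfolding is_volume_measure_def using emeasure_chart_measure by auto
  have split: "emeasure M E = (\<Sum>n. emeasure M (E \<inter> P n))" if "sets M = sets borel" "E \<in> sets borel" for M E
  proof -
    have "emeasure M (\<Union>n. E \<inter> P n) = (\<Sum>n. emeasure M (E \<inter> P n))"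
    proof (rule suminf_emeasure[symmetric])
      show "range (\<lambda>n. E \<inter> P n) \<subseteq> sets M"
        by (intro image_subsetI) (simp only: that(1) sets.Int[OF that(2) P(1)])
      show "disjoint_family (\<lambda>n. E \<inter> P n)" by (rule disjoint_family_subset[OF P(3)]) simp
    qed
    moreover have "(\<Union>n. E \<inter> P n) = E" using P(4) by auto
    ultimately show ?thesis by simp
  qed
  \<comment> \<open>The sum over \<open>n\<close>, written as an integral so that monotone convergence exchanges it with the sum over disjoint sets.\<close>
  define \<mu> where "\<mu> = (\<lambda>E. \<integral>\<^sup>+n. emeasure (chart_measure (ch n)) (E \<inter> P n) \<partial>count_space UNIV)"
  define \<sigma> where "\<sigma> = measure_of UNIV (sets borel) \<mu>"
  have sets: "sets \<sigma> = sets borel"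
    by (simp add: \<sigma>_def sets.sigma_sets_eq[of borel, simplified])
  have em: "emeasure \<sigma> E = \<mu> E" if "E \<in> sets borel" for E
  proof (rule emeasure_measure_of[OF \<sigma>_def])
    show "countably_additive (sets \<sigma>) \<mu>"
    proof (rule countably_additiveI)
      fix A :: "nat \<Rightarrow> 'm set" assume A: "range A \<subseteq> sets \<sigma>" "disjoint_family A" "\<Union> (range A) \<in> sets \<sigma>"
      have Ab: "A i \<in> sets borel" for i using A(1) unfolding sets by blast
      have "\<mu> (\<Union> (range A)) = (\<integral>\<^sup>+n. (\<Sum>i. emeasure (chart_measure (ch n)) (A i \<inter> P n)) \<partial>count_space UNIV)"
        unfolding \<mu>_def
      proof (rule nn_integral_cong)
        fix n
        have "(\<Sum>i. emeasure (chart_measure (ch n)) (A i \<inter> P n)) = emeasure (chart_measure (ch n)) (\<Union>i. A i \<inter> P n)"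
        proof (rule suminf_emeasure)
          show "range (\<lambda>i. A i \<inter> P n) \<subseteq> sets (chart_measure (ch n))"
            by (intro image_subsetI) (simp only: sets_chart_measure sets.Int[OF Ab P(1)])
          show "disjoint_family (\<lambda>i. A i \<inter> P n)" by (rule disjoint_family_subset[OF A(2)]) simp
        qed
        then show "emeasure (chart_measure (ch n)) (\<Union> (range A) \<inter> P n) = (\<Sum>i. emeasure (chart_measure (ch n)) (A i \<inter> P n))"
          by (simp add: Int_commute)
      qed
      also have "\<dots> = (\<Sum>i. \<mu> (A i))" unfolding \<mu>_def by (rule nn_integral_suminf) simp
      finally show "(\<Sum>i. \<mu> (A i)) = \<mu> (\<Union> (range A))" by simp
    qed
  qed (use that sets in \<open>auto simp: positive_def \<mu>_def\<close>)
  have "is_volume_measure \<sigma>" unfolding spec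
  proof (intro conjI sets ballI impI)
    fix c E assume c: "c \<in> \<A>" and E: "E \<in> sets borel" "E \<subseteq> fst c"
    have "emeasure \<sigma> E = (\<Sum>n. emeasure (chart_measure (ch n)) (E \<inter> P n))"
      by (simp add: em[OF E(1)] \<mu>_def nn_integral_count_space_nat)
    also have "\<dots> = (\<Sum>n. emeasure (chart_measure c) (E \<inter> P n))"
      using E P(2) by (intro suminf_cong chart_measure_overlap ch c) auto
    also have "\<dots> = emeasure (chart_measure c) E"
      using split[of "chart_measure c" E] E by simp
    finally show "emeasure \<sigma> E = emeasure (chart_measure c) E" .
  qed
  moreover have "\<sigma>' = \<sigma>" if "is_volume_measure \<sigma>'" for \<sigma>'
  proof (rule measure_eqI)
    have \<sigma>': "sets \<sigma>' = sets borel" using that by (simp add: spec)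
    then show "sets \<sigma>' = sets \<sigma>" using sets by simp
    fix E assume "E \<in> sets \<sigma>'"
    then have E: "E \<in> sets borel" using \<sigma>' by simp
    have "emeasure \<sigma>' (E \<inter> P n) = emeasure \<sigma> (E \<inter> P n)" for n
    proof -
      have "E \<inter> P n \<in> sets borel" "E \<inter> P n \<subseteq> fst (ch n)" using E P(2) by auto
      then show ?thesis using that \<open>is_volume_measure \<sigma>\<close> ch unfolding spec by metis
    qed
    then show "emeasure \<sigma>' E = emeasure \<sigma> E" using split[OF \<sigma>' E] split[OF sets E] by simp
  qed
  ultimately show ?thesis by blast
qed

abbreviation \<sigma> :: "'m measure" where "\<sigma> \<equiv> volume_measure \<A> F"

lemma volume_measure_is_volume_measure: "is_volume_measure \<sigma>"
  using theI'[OF ex1_volume_measure] unfolding volume_measure_def is_volume_measure_def .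

lemma sets_volume_measure [simp, measurable_cong]: "sets \<sigma> = sets borel"
  using volume_measure_is_volume_measure by (simp add: is_volume_measure_def)

lemma space_volume_measure [simp]: "space \<sigma> = UNIV"
  using sets_eq_imp_space_eq[OF sets_volume_measure] by simp

lemma emeasure_volume_measure:
  assumes "c \<in> \<A>" "E \<in> sets borel" "E \<subseteq> fst c"
  shows "emeasure \<sigma> E = (\<integral>\<^sup>+u\<in>snd c ` E. ennreal (volume_density c F u) \<partial>lborel)"
  using volume_measure_is_volume_measure assms by (simp add: is_volume_measure_def)

lemma volume_measure_chart:
  assumes "c \<in> \<A>"
  shows "density \<sigma> (indicator (fst c)) = chart_measure c"
proof (rule measure_eqI)
  fix E assume "E \<in> sets (density \<sigma> (indicator (fst c)))"
  then have E: "E \<in> sets borel" by simp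
  have U: "fst c \<in> sets borel" using open_chart[OF assms] by simp
  have "emeasure (density \<sigma> (indicator (fst c))) E = (\<integral>\<^sup>+p. indicator (fst c) p * indicator E p \<partial>\<sigma>)"
    using E U by (intro emeasure_density) auto
  also have "\<dots> = (\<integral>\<^sup>+p. indicator (E \<inter> fst c) p \<partial>\<sigma>)"
    by (rule nn_integral_cong) (auto simp: indicator_def)
  also have "\<dots> = emeasure \<sigma> (E \<inter> fst c)" using E U by (intro nn_integral_indicator) simp
  also have "\<dots> = emeasure (chart_measure c) (E \<inter> fst c)"
    using E U by (simp add: emeasure_volume_measure[OF assms] emeasure_chart_measure[OF assms])
  also have "\<dots> = emeasure (chart_measure c) E" using emeasure_chart_measure_Int[OF assms E] by simp
  finally show "emeasure (density \<sigma> (indicator (fst c))) E = emeasure (chart_measure c) E" .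
qed simp

lemma integral_volume_measure_chart:
  fixes f :: "'m \<Rightarrow> real"
  assumes c: "c \<in> \<A>" and f [measurable]: "f \<in> borel_measurable borel" and supp: "\<And>p. p \<notin> fst c \<Longrightarrow> f p = 0"
  shows "(\<integral>p. f p \<partial>\<sigma>) = (\<integral>u. indicator (chart_image c) u * (volume_density c F u * f (chart_inv c u)) \<partial>lborel)"
proof -
  note [measurable] = measurable_chart_param[OF c] measurable_chart_density[OF c]
  have U [measurable]: "fst c \<in> sets borel" using open_chart[OF c] by simp
  have "(\<integral>p. f p \<partial>\<sigma>) = (\<integral>p. indicator (fst c) p *\<^sub>R f p \<partial>\<sigma>)"
    by (rule Bochner_Integration.integral_cong) (use supp in \<open>auto simp: indicator_def\<close>)
  also have "\<dots> = (\<integral>p. f p \<partial>density \<sigma> (\<lambda>p. ennreal (indicator (fst c) p)))"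
    by (rule integral_density[symmetric]) auto
  also have "\<dots> = (\<integral>p. f p \<partial>chart_measure c)"
    by (simp only: ennreal_indicator volume_measure_chart[OF c])
  also have "\<dots> = (\<integral>u. f (chart_param c u) \<partial>density lborel (chart_density c))"
    unfolding chart_measure_def by (rule integral_distr) auto
  also have "\<dots> = (\<integral>u. chart_density c u *\<^sub>R f (chart_param c u) \<partial>lborel)"
    by (rule integral_density) (use chart_density_nonneg[OF c] in auto)
  also have "\<dots> = (\<integral>u. indicator (chart_image c) u * (volume_density c F u * f (chart_inv c u)) \<partial>lborel)"
    by (rule Bochner_Integration.integral_cong) (auto simp: chart_density_def chart_param_def indicator_def)
  finally show ?thesis .
qed

lemma chart_ball:
  assumes "c \<in> \<A>" "p \<in> fst c"
  obtains r where "r > 0" "cball (snd c p) r \<subseteq> chart_image c"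
  using open_chart_image[OF assms(1)] assms(2) open_contains_cball by blast

lemma chart_inv_image_open:
  assumes c: "c \<in> \<A>" and V: "open V" "V \<subseteq> chart_image c"
  shows "open (chart_inv c ` V)"
proof -
  have "chart_inv c ` V = fst c \<inter> snd c -` V"
  proof (intro set_eqI iffI)
    show "p \<in> fst c \<inter> snd c -` V" if "p \<in> chart_inv c ` V" for p
      using that V(2) chart_inv_in[OF c] chart_chart_inv[OF c] by auto
    show "p \<in> chart_inv c ` V" if "p \<in> fst c \<inter> snd c -` V" for p
      using that chart_inv_chart[OF c, of p] by (intro image_eqI[of _ _ "snd c p"]) auto
  qed
  then show ?thesis
    using continuous_open_preimage[OF continuous_chart[OF c] open_chart[OF c] V(1)] by simp
qed

text \<open>Every point has a neighbourhood of finite measure, the inverse image of a ball on whose closure the density is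
  bounded.\<close>

lemma emeasure_compact_finite:
  assumes "compact K"
  shows "emeasure \<sigma> K < \<infinity>"
proof -
  have "\<exists>V. open V \<and> p \<in> V \<and> emeasure \<sigma> V < \<infinity>" for p
  proof -
    obtain c where c: "c \<in> \<A>" "p \<in> fst c" using chart_cover by blast
    obtain r where r: "r > 0" "cball (snd c p) r \<subseteq> chart_image c" using chart_ball[OF c] .
    let ?B = "ball (snd c p) r" and ?V = "chart_inv c ` ball (snd c p) r"
    have B: "?B \<subseteq> chart_image c" using r ball_subset_cball by blast
    have V: "open ?V" by (rule chart_inv_image_open[OF c(1) open_ball B])
    have V_in: "?V \<subseteq> fst c" using B chart_inv_in[OF c(1)] by auto
    have sV: "snd c ` ?V = ?B"
      using B chart_chart_inv[OF c(1)] by (force simp: image_iff)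
    have "compact (volume_density c F ` cball (snd c p) r)"
      using smooth_on_continuous[OF smooth_volume_density[OF c(1)]] r(2)
      by (intro compact_continuous_image) (auto intro: continuous_on_subset)
    then have "bounded (volume_density c F ` cball (snd c p) r)" by (rule compact_imp_bounded)
    then obtain b where b': "\<forall>u\<in>cball (snd c p) r. norm (volume_density c F u) \<le> b"
      unfolding bounded_iff by (elim exE) simp
    have b: "volume_density c F u \<le> b" if "u \<in> cball (snd c p) r" for u
      using bspec[OF b' that] by simp
    have "emeasure \<sigma> ?V = (\<integral>\<^sup>+u\<in>?B. ennreal (volume_density c F u) \<partial>lborel)"
      using emeasure_volume_measure[OF c(1) _ V_in] V sV by simp
    also have "\<dots> \<le> (\<integral>\<^sup>+u. ennreal b * indicator ?B u \<partial>lborel)"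
      by (rule nn_integral_mono) (use b in \<open>auto simp: indicator_def intro!: ennreal_leI\<close>)
    also have "\<dots> = ennreal b * emeasure lborel ?B" by (simp add: nn_integral_cmult_indicator)
    also have "\<dots> < \<infinity>" using emeasure_bounded_finite[of ?B] by (simp add: ennreal_mult_less_top)
    finally have "emeasure \<sigma> ?V < \<infinity>" .
    moreover have "p \<in> ?V" using r c chart_inv_chart[OF c] by (intro image_eqI[of _ _ "snd c p"]) auto
    ultimately show ?thesis using V by blast
  qed
  then obtain V where V: "\<And>p. open (V p)" "\<And>p. p \<in> V p" "\<And>p. emeasure \<sigma> (V p) < \<infinity>" by metis
  have cover: "K \<subseteq> (\<Union>p\<in>K. V p)" using V(2) by blast
  obtain C where C: "C \<subseteq> K" "finite C" "K \<subseteq> (\<Union>p\<in>C. V p)"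
    by (rule compactE_image[OF assms V(1) cover])
  have "emeasure \<sigma> K \<le> emeasure \<sigma> (\<Union>p\<in>C. V p)"
    using C V by (intro emeasure_mono) auto
  also have "\<dots> \<le> (\<Sum>p\<in>C. emeasure \<sigma> (V p))"
    using C V by (intro emeasure_subadditive_finite) auto
  also have "\<dots> < \<infinity>" using V(3) by (simp add: ennreal_sum_less_top[OF C(2)] less_top)
  finally show ?thesis .
qed

lemma emeasure_open_pos:
  assumes "open W" "W \<noteq> {}"
  shows "emeasure \<sigma> W > 0"
proof -
  obtain p where p: "p \<in> W" using assms by auto
  obtain c where c: "c \<in> \<A>" "p \<in> fst c" using chart_cover by blast
  let ?E = "fst c \<inter> W"
  have E: "open ?E" "?E \<subseteq> fst c" using assms open_chart[OF c(1)] by auto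
  have oE: "open (snd c ` ?E)" by (rule chart_image_subset_open[OF c(1) E])
  have "emeasure \<sigma> ?E \<noteq> 0"
  proof
    assume "emeasure \<sigma> ?E = 0"
    then have "(\<integral>\<^sup>+u\<in>snd c ` ?E. ennreal (volume_density c F u) \<partial>lborel) = 0"
      using emeasure_volume_measure[OF c(1) borel_open[OF E(1)] E(2)] by simp
    moreover have "(\<integral>\<^sup>+u\<in>snd c ` ?E. ennreal (volume_density c F u) \<partial>lborel) =
        (\<integral>\<^sup>+u\<in>snd c ` ?E. ennreal (chart_density c u) \<partial>lborel)"
      by (rule nn_integral_cong) (auto simp: chart_density_def indicator_def)
    ultimately have "(\<integral>\<^sup>+u\<in>snd c ` ?E. ennreal (chart_density c u) \<partial>lborel) = 0" by simp
    moreover have [measurable]: "snd c ` ?E \<in> sets borel" using oE by simp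
    ultimately have "AE u in lborel. ennreal (chart_density c u) * indicator (snd c ` ?E) u = 0"
      using measurable_chart_density[OF c(1)] by (subst (asm) nn_integral_0_iff_AE) auto
    then have "AE u in lborel. u \<notin> snd c ` ?E"
    proof eventually_elim
      case (elim u)
      show ?case
      proof
        assume "u \<in> snd c ` ?E"
        moreover then have "chart_density c u > 0" using volume_density_pos[OF c(1), of u] by (auto simp: chart_density_def)
        ultimately show False using elim by simp
      qed
    qed
    then have "emeasure lborel (snd c ` ?E) = 0"
      using AE_iff_measurable[of "snd c ` ?E" lborel "\<lambda>u. u \<notin> snd c ` ?E"] oE by auto
    then have "negligible (snd c ` ?E)"
      using oE by (simp add: negligible_iff_null_sets null_sets_def)
    then show False using open_not_negligible[OF oE] p c by auto
  qed
  moreover have "emeasure \<sigma> ?E \<le> emeasure \<sigma> W" using assms by (intro emeasure_mono) auto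
  ultimately show ?thesis by (metis not_gr_zero le_zero_eq)
qed

lemma integrable_continuous_compact_support:
  fixes f :: "'m \<Rightarrow> real"
  assumes f: "continuous_on UNIV f" and K: "compact K" "\<And>p. p \<notin> K \<Longrightarrow> f p = 0"
  shows "integrable \<sigma> f"
proof -
  have "bounded (f ` K)" using compact_continuous_image[OF continuous_on_subset[OF f] K(1)] compact_imp_bounded by auto
  then obtain B where B: "\<And>p. p \<in> K \<Longrightarrow> \<bar>f p\<bar> \<le> B" by (auto simp: bounded_iff)
  have Kb: "K \<in> sets borel" using K(1) by (simp add: borel_compact)
  show ?thesis
  proof (rule Bochner_Integration.integrable_bound)
    show "integrable \<sigma> (\<lambda>p. B * indicator K p)"
      using emeasure_compact_finite[OF K(1)] Kb by (intro integrable_mult_right integrable_real_indicator) auto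
    show "f \<in> borel_measurable \<sigma>" using borel_measurable_continuous_onI[OF f] by simp
    show "AE p in \<sigma>. norm (f p) \<le> norm (B * indicator K p)"
    proof (rule AE_I2)
      fix p show "norm (f p) \<le> norm (B * indicator K p)"
        using B[of p] K(2)[of p] by (cases "p \<in> K") auto
    qed
  qed
qed

end

section \<open>The first variation formula\<close>

context hypersurface
begin

lemma smooth_mapD: "smooth_map \<A> f \<Longrightarrow> c \<in> \<A> \<Longrightarrow> smooth_on (f \<circ> chart_inv c) (chart_image c)"
  by (auto simp: smooth_map_def split_beta)

lemma smooth_mapI: "(\<And>c. c \<in> \<A> \<Longrightarrow> smooth_on (f \<circ> chart_inv c) (chart_image c)) \<Longrightarrow> smooth_map \<A> f"
  by (force simp: smooth_map_def split_beta)

lemma smooth_map_F: "smooth_map \<A> F"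
  by (intro smooth_mapI smooth_F)

lemma smooth_map_bilinear:
  assumes "bounded_bilinear b" "smooth_map \<A> f" "smooth_map \<A> g"
  shows "smooth_map \<A> (\<lambda>p. b (f p) (g p))"
proof (rule smooth_mapI)
  fix c assume c: "c \<in> \<A>"
  show "smooth_on ((\<lambda>p. b (f p) (g p)) \<circ> chart_inv c) (chart_image c)"
    using smooth_on_bilinear[OF assms(1) open_chart_image[OF c] smooth_mapD[OF assms(2) c] smooth_mapD[OF assms(3) c]]
    by (simp add: o_def)
qed

lemmas smooth_map_mult = smooth_map_bilinear[OF bounded_bilinear_mult]
lemmas smooth_map_inner = smooth_map_bilinear[OF bounded_bilinear_inner]

lemma smooth_map_sum:
  assumes "\<And>i. i \<in> I \<Longrightarrow> smooth_map \<A> (f i)"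
  shows "smooth_map \<A> (\<lambda>p. \<Sum>i\<in>I. f i p)"
proof (rule smooth_mapI)
  fix c assume c: "c \<in> \<A>"
  show "smooth_on ((\<lambda>p. \<Sum>i\<in>I. f i p) \<circ> chart_inv c) (chart_image c)"
    using smooth_on_sum[OF open_chart_image[OF c], of I "\<lambda>i. f i \<circ> chart_inv c"] smooth_mapD[OF assms c]
    by (simp add: o_def)
qed

lemma smooth_map_compose:
  fixes f :: "'m \<Rightarrow> real"
  assumes h: "smooth_on h UNIV" and f: "smooth_map \<A> f"
  shows "smooth_map \<A> (\<lambda>p. h (f p))"
proof (rule smooth_mapI)
  fix c assume c: "c \<in> \<A>"
  show "smooth_on ((\<lambda>p. h (f p)) \<circ> chart_inv c) (chart_image c)"
    using smooth_on_compose[OF open_chart_image[OF c] open_UNIV h smooth_mapD[OF f c]]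
    by (simp add: o_def)
qed

lemma smooth_map_norm_sq: "smooth_map \<A> (\<lambda>p. (norm (F p))\<^sup>2)"
  unfolding power2_norm_eq_inner by (intro smooth_map_inner smooth_map_F)

lemma smooth_map_differentiable:
  assumes "smooth_map \<A> f" "c \<in> \<A>" "p \<in> fst c"
  shows "(f \<circ> chart_inv c) differentiable (at (snd c p))"
  by (rule differentiableI[OF smooth_on_has_derivative[OF smooth_mapD[OF assms(1,2)]]]) (use assms(3) in simp)

lemma smooth_map_has_derivative:
  assumes "smooth_map \<A> f" "c \<in> \<A>" "p \<in> fst c"
  shows "((f \<circ> chart_inv c) has_derivative deriv_at c f p) (at (snd c p))"
  unfolding deriv_at_def
  by (rule smooth_on_has_derivative[OF smooth_mapD[OF assms(1,2)]]) (use assms(3) in simp)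

text \<open>Smoothness is local, so a function may be given by different formulas on two open sets. Bump functions and
  quotients by sums of bump functions are smooth for this reason.\<close>

lemma smooth_map_open_cover:
  assumes A: "open A" and B: "open B" and AB: "A \<union> B = UNIV"
    and fA: "\<And>c. c \<in> \<A> \<Longrightarrow> smooth_on (f \<circ> chart_inv c) (snd c ` (fst c \<inter> A))"
    and fB: "\<And>c. c \<in> \<A> \<Longrightarrow> smooth_on (f \<circ> chart_inv c) (snd c ` (fst c \<inter> B))"
  shows "smooth_map \<A> f"
proof (rule smooth_mapI)
  fix c assume c: "c \<in> \<A>"
  have o: "open (snd c ` (fst c \<inter> A))" "open (snd c ` (fst c \<inter> B))"
    by (rule chart_image_subset_open[OF c]; simp add: open_Int open_chart[OF c] A B)+
  have "chart_image c = snd c ` (fst c \<inter> A) \<union> snd c ` (fst c \<inter> B)"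
    using AB by blast
  then show "smooth_on (f \<circ> chart_inv c) (chart_image c)"
    using smooth_on_Un[OF o fA[OF c] fB[OF c]] by simp
qed

lemma continuous_via_charts:
  assumes "\<And>c. c \<in> \<A> \<Longrightarrow> continuous_on (chart_image c) (f \<circ> chart_inv c)"
  shows "continuous_on UNIV f"
proof (rule continuous_at_imp_continuous_on, rule ballI)
  fix p :: 'm
  obtain c where c: "c \<in> \<A>" "p \<in> fst c" using chart_cover by blast
  have "continuous_on (fst c) ((f \<circ> chart_inv c) \<circ> snd c)"
    by (rule continuous_on_compose[OF continuous_chart[OF c(1)] assms[OF c(1)]])
  then have "continuous_on (fst c) f"
    by (rule continuous_on_eq) (simp add: chart_inv_chart[OF c(1)])
  then show "isCont f p"
    using continuous_on_eq_continuous_at[OF open_chart[OF c(1)]] c(2) by blast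
qed

lemma smooth_map_continuous: "smooth_map \<A> f \<Longrightarrow> continuous_on UNIV f"
  by (intro continuous_via_charts smooth_on_continuous smooth_mapD)

lemma deriv_at_chart_inv:
  "c \<in> \<A> \<Longrightarrow> u \<in> chart_image c \<Longrightarrow> deriv_at c f (chart_inv c u) = frechet_derivative (f \<circ> chart_inv c) (at u)"
  by (simp add: deriv_at_def chart_chart_inv)

lemma continuous_deriv:
  assumes "smooth_map \<A> f" "c \<in> \<A>"
  shows "continuous_on (chart_image c) (\<lambda>u. deriv_at c f (chart_inv c u) v)"
proof -
  have "continuous_on (chart_image c) (\<lambda>u. frechet_derivative (f \<circ> chart_inv c) (at u) v)"
    by (intro smooth_on_continuous smooth_on_frechet_derivative smooth_mapD assms)
  then show ?thesis by (rule continuous_on_eq) (simp add: deriv_at_chart_inv[OF assms(2)])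
qed

lemma continuous_ginv:
  assumes "c \<in> \<A>"
  shows "continuous_on (chart_image c) (\<lambda>u. ginv c (chart_inv c u) i j)"
proof -
  have "continuous_on (chart_image c) (\<lambda>u. gram_inv (frechet_derivative (F \<circ> chart_inv c) (at u)) $ i $ j)"
    by (intro smooth_on_continuous parametrized_immersion.smooth_gram_inv immersion_chart assms)
  then show ?thesis by (rule continuous_on_eq) (simp add: deriv_at_chart_inv[OF assms])
qed

lemma continuous_hess:
  assumes "c \<in> \<A>"
  shows "continuous_on (chart_image c) (\<lambda>u. hess c (chart_inv c u) v w)"
proof -
  have "continuous_on (chart_image c) (\<lambda>u. second_derivative (F \<circ> chart_inv c) u v w)"
    by (intro smooth_on_continuous smooth_on_second_derivative smooth_F assms)
  then show ?thesis by (rule continuous_on_eq) (simp add: chart_chart_inv[OF assms])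
qed

lemma continuous_normal_part:
  assumes c: "c \<in> \<A>" and X: "continuous_on (chart_image c) X"
  shows "continuous_on (chart_image c) (\<lambda>u. normal_part \<A> F (chart_inv c u) (X u))"
proof -
  let ?D = "\<lambda>u. deriv_at c F (chart_inv c u)"
  have "continuous_on (chart_image c) (\<lambda>u. X u - (\<Sum>i\<in>UNIV. \<Sum>j\<in>UNIV. (ginv c (chart_inv c u) i j * (X u \<bullet> ?D u (ax i))) *\<^sub>R ?D u (ax j)))"
    by (intro continuous_intros X continuous_ginv[OF c] continuous_deriv[OF smooth_map_F c])
  then show ?thesis
    by (rule continuous_on_eq) (simp add: normal_part_chart[OF c chart_inv_in[OF c]] tangential_def)
qed

lemma continuous_mean_curvature_vector: "continuous_on UNIV (mean_curvature_vector \<A> F)"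
proof (rule continuous_via_charts)
  fix c assume c: "c \<in> \<A>"
  have "continuous_on (chart_image c) (\<lambda>u. normal_part \<A> F (chart_inv c u)
     (\<Sum>i\<in>UNIV. \<Sum>j\<in>UNIV. ginv c (chart_inv c u) i j *\<^sub>R hess c (chart_inv c u) (ax i) (ax j)))"
    by (intro continuous_normal_part[OF c] continuous_intros continuous_ginv[OF c] continuous_hess[OF c])
  then show "continuous_on (chart_image c) (mean_curvature_vector \<A> F \<circ> chart_inv c)"
    by (rule continuous_on_eq) (simp add: mean_curvature_vector_chart[OF c chart_inv_in[OF c]])
qed

lemma continuous_norm_A_sq: "continuous_on UNIV (norm_A_sq \<A> F)"
proof (rule continuous_via_charts)
  fix c assume c: "c \<in> \<A>"
  have N: "continuous_on (chart_image c) (\<lambda>u. normal_part \<A> F (chart_inv c u) (hess c (chart_inv c u) v w))" for v w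
    by (intro continuous_normal_part[OF c] continuous_hess[OF c])
  have "continuous_on (chart_image c) (\<lambda>u. \<Sum>i\<in>UNIV. \<Sum>j\<in>UNIV. ginv c (chart_inv c u) i j *
    (\<Sum>k\<in>UNIV. \<Sum>l\<in>UNIV. ginv c (chart_inv c u) k l *
     (normal_part \<A> F (chart_inv c u) (hess c (chart_inv c u) (ax i) (ax k)) \<bullet>
      normal_part \<A> F (chart_inv c u) (hess c (chart_inv c u) (ax j) (ax l)))))"
    by (intro continuous_intros continuous_ginv[OF c] N)
  then show "continuous_on (chart_image c) (norm_A_sq \<A> F \<circ> chart_inv c)"
    by (rule continuous_on_eq) (simp only: norm_A_sq_chart[OF c chart_inv_in[OF c]] o_apply)
qed

lemma continuous_gradient:
  fixes f :: "'m \<Rightarrow> real"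
  assumes "smooth_map \<A> f"
  shows "continuous_on UNIV (gradient \<A> F f)"
proof (rule continuous_via_charts)
  fix c assume c: "c \<in> \<A>"
  have "continuous_on (chart_image c) (\<lambda>u. \<Sum>i\<in>UNIV. \<Sum>j\<in>UNIV.
     (ginv c (chart_inv c u) i j * deriv_at c f (chart_inv c u) (ax i)) *\<^sub>R deriv_at c F (chart_inv c u) (ax j))"
    by (intro continuous_intros continuous_ginv[OF c] continuous_deriv[OF assms c] continuous_deriv[OF smooth_map_F c])
  then show "continuous_on (chart_image c) (gradient \<A> F f \<circ> chart_inv c)"
    by (rule continuous_on_eq)
      (simp add: gradient_chart[OF c chart_inv_in[OF c] smooth_map_differentiable[OF assms c chart_inv_in[OF c]]])
qed

lemma
  fixes f :: "'m \<Rightarrow> real"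
  assumes f: "smooth_map \<A> f" and c: "c \<in> \<A>" "p \<in> fst c"
  shows gradient_range: "gradient \<A> F f p \<in> range (deriv_at c F p)"
    and gradient_inner: "gradient \<A> F f p \<bullet> deriv_at c F p v = deriv_at c f p v"
  using smooth_map_differentiable[OF f c]
  by (rule gradient_range_differentiable[OF c] gradient_inner_differentiable[OF c])+

lemma range_dF_combination:
  assumes "c \<in> \<A>" "p \<in> fst c" "X \<in> range (deriv_at c F p)" "Y \<in> range (deriv_at c F p)"
  shows "a *\<^sub>R X + b *\<^sub>R Y \<in> range (deriv_at c F p)"
  using linear_subspace_image[OF linear_dF[OF assms(1,2)] subspace_UNIV] assms(3,4)
  by (intro subspace_add subspace_scale)

lemma gradient_mult:
  fixes f g :: "'m \<Rightarrow> real"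
  assumes f: "smooth_map \<A> f" and g: "smooth_map \<A> g"
  shows "gradient \<A> F (\<lambda>p. f p * g p) p = f p *\<^sub>R gradient \<A> F g p + g p *\<^sub>R gradient \<A> F f p"
proof -
  obtain c where c: "c \<in> \<A>" "p \<in> fst c" using chart_cover by blast
  show ?thesis
  proof (rule gradient_eqI[OF c])
    show "f p *\<^sub>R gradient \<A> F g p + g p *\<^sub>R gradient \<A> F f p \<in> range (deriv_at c F p)"
      by (intro range_dF_combination c gradient_range f g)
    have "((\<lambda>u. (f \<circ> chart_inv c) u * (g \<circ> chart_inv c) u) has_derivative
       (\<lambda>v. (f \<circ> chart_inv c) (snd c p) * deriv_at c g p v + deriv_at c f p v * (g \<circ> chart_inv c) (snd c p))) (at (snd c p))"
      by (intro has_derivative_mult smooth_map_has_derivative f g c)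
    then show "((\<lambda>p. f p * g p) \<circ> chart_inv c has_derivative
       (\<lambda>v. (f p *\<^sub>R gradient \<A> F g p + g p *\<^sub>R gradient \<A> F f p) \<bullet> deriv_at c F p v)) (at (snd c p))"
      by (simp add: o_def inner_add_left gradient_inner[OF f c] gradient_inner[OF g c] chart_inv_chart[OF c] mult.commute[of _ "g p"])
  qed
qed

lemma gradient_add:
  fixes f g :: "'m \<Rightarrow> real"
  assumes f: "smooth_map \<A> f" and g: "smooth_map \<A> g"
  shows "gradient \<A> F (\<lambda>p. f p + g p) p = gradient \<A> F f p + gradient \<A> F g p"
proof -
  obtain c where c: "c \<in> \<A>" "p \<in> fst c" using chart_cover by blast
  show ?thesis
  proof (rule gradient_eqI[OF c])
    show "gradient \<A> F f p + gradient \<A> F g p \<in> range (deriv_at c F p)"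
      using range_dF_combination[OF c gradient_range[OF f c] gradient_range[OF g c], of 1 1] by simp
    have "((\<lambda>u. (f \<circ> chart_inv c) u + (g \<circ> chart_inv c) u) has_derivative
       (\<lambda>v. deriv_at c f p v + deriv_at c g p v)) (at (snd c p))"
      by (intro has_derivative_add smooth_map_has_derivative f g c)
    then show "((\<lambda>p. f p + g p) \<circ> chart_inv c has_derivative
       (\<lambda>v. (gradient \<A> F f p + gradient \<A> F g p) \<bullet> deriv_at c F p v)) (at (snd c p))"
      by (simp add: o_def inner_add_left gradient_inner[OF f c] gradient_inner[OF g c])
  qed
qed

lemma gradient_compose:
  fixes f :: "'m \<Rightarrow> real"
  assumes f: "smooth_map \<A> f" and h: "(h has_real_derivative h') (at (f p))"
  shows "gradient \<A> F (\<lambda>p. h (f p)) p = h' *\<^sub>R gradient \<A> F f p"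
proof -
  obtain c where c: "c \<in> \<A>" "p \<in> fst c" using chart_cover by blast
  show ?thesis
  proof (rule gradient_eqI[OF c])
    show "h' *\<^sub>R gradient \<A> F f p \<in> range (deriv_at c F p)"
      using range_dF_combination[OF c gradient_range[OF f c] gradient_range[OF f c], of h' 0] by simp
    have "(h has_derivative (\<lambda>d. h' * d)) (at ((f \<circ> chart_inv c) (snd c p)))"
      using h by (simp add: has_field_derivative_def chart_inv_chart[OF c])
    from has_derivative_compose[OF smooth_map_has_derivative[OF f c] this]
    show "((\<lambda>p. h (f p)) \<circ> chart_inv c has_derivative (\<lambda>v. (h' *\<^sub>R gradient \<A> F f p) \<bullet> deriv_at c F p v)) (at (snd c p))"
      by (simp add: o_def gradient_inner[OF f c])
  qed
qed

text \<open>The vector field \<open>x\<^sup>T\<close>.\<close>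

definition tangent_position :: "'m \<Rightarrow> real^('n + 1)" where
  "tangent_position p = F p - normal_part \<A> F p (F p)"

lemma gradient_norm_sq: "gradient \<A> F (\<lambda>p. (norm (F p))\<^sup>2) p = 2 *\<^sub>R tangent_position p"
proof -
  obtain c where c: "c \<in> \<A>" "p \<in> fst c" using chart_cover by blast
  have tp: "tangent_position p = tangential (deriv_at c F p) (F p)"
    by (simp add: tangent_position_def normal_part_chart[OF c])
  show ?thesis
  proof (rule gradient_eqI[OF c])
    have r: "tangent_position p \<in> range (deriv_at c F p)" unfolding tp by (rule tangential_range[OF linear_dF[OF c]])
    show "2 *\<^sub>R tangent_position p \<in> range (deriv_at c F p)"
      using range_dF_combination[OF c r r, of 2 0] by simp
    have "((\<lambda>u. (F \<circ> chart_inv c) u \<bullet> (F \<circ> chart_inv c) u) has_derivative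
       (\<lambda>v. (F \<circ> chart_inv c) (snd c p) \<bullet> deriv_at c F p v + deriv_at c F p v \<bullet> (F \<circ> chart_inv c) (snd c p))) (at (snd c p))"
      by (intro has_derivative_inner smooth_map_has_derivative smooth_map_F c)
    moreover have "2 * (tangent_position p \<bullet> deriv_at c F p v) = F p \<bullet> deriv_at c F p v + deriv_at c F p v \<bullet> F p" for v
      unfolding tangent_position_def inner_diff_left normal_part_inner[OF c] by (simp add: inner_commute)
    ultimately show "((\<lambda>p. (norm (F p))\<^sup>2) \<circ> chart_inv c has_derivative
       (\<lambda>v. (2 *\<^sub>R tangent_position p) \<bullet> deriv_at c F p v)) (at (snd c p))"
      by (simp add: o_def power2_norm_eq_inner chart_inv_chart[OF c])
  qed
qed

lemma gradient_inner_normal_part: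
  fixes f :: "'m \<Rightarrow> real"
  assumes "smooth_map \<A> f"
  shows "gradient \<A> F f p \<bullet> normal_part \<A> F p v = 0"
proof -
  obtain c where c: "c \<in> \<A>" "p \<in> fst c" using chart_cover by blast
  show ?thesis using gradient_range[OF assms c] normal_part_inner[OF c, of v] by (auto simp: inner_commute)
qed

lemma gradient_inner_position:
  fixes f :: "'m \<Rightarrow> real"
  assumes "smooth_map \<A> f"
  shows "gradient \<A> F f p \<bullet> F p = gradient \<A> F f p \<bullet> tangent_position p"
  by (simp add: tangent_position_def inner_diff_right gradient_inner_normal_part[OF assms])

lemma gradient_eq_0:
  fixes f :: "'m \<Rightarrow> real"
  assumes "open W" "p \<in> W" "\<And>q. q \<in> W \<Longrightarrow> f q = 0"
  shows "gradient \<A> F f p = 0"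
proof -
  obtain c where c: "c \<in> \<A>" "p \<in> fst c" using chart_cover by blast
  let ?O = "snd c ` (fst c \<inter> W)"
  have O: "open ?O" by (rule chart_image_subset_open[OF c(1)]) (simp_all add: open_Int open_chart[OF c(1)] assms(1))
  show ?thesis
  proof (rule gradient_eqI[OF c])
    show "0 \<in> range (deriv_at c F p)" using linear_0[OF linear_dF[OF c]] by (metis rangeI)
    have "((\<lambda>u. 0) has_derivative (\<lambda>v. 0)) (at (snd c p))" by simp
    then show "(f \<circ> chart_inv c has_derivative (\<lambda>v. 0 \<bullet> deriv_at c F p v)) (at (snd c p))"
      unfolding inner_zero_left
      by (rule has_derivative_transform_within_open[OF _ O])
        (use c assms(2,3) chart_inv_chart[OF c(1)] in auto)
  qed
qed

text \<open>The divergence of \<open>\<eta> x\<^sup>T\<close>, since \<open>x\<^sup>T\<close> has divergence \<open>n + \<langle>x, H\<rangle>\<close>.\<close>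

definition first_variation :: "('m \<Rightarrow> real) \<Rightarrow> 'm \<Rightarrow> real" where
  "first_variation \<eta> p = \<eta> p * (real CARD('n) + F p \<bullet> mean_curvature_vector \<A> F p) + gradient \<A> F \<eta> p \<bullet> F p"

lemma continuous_F: "continuous_on UNIV F" by (rule smooth_map_continuous[OF smooth_map_F])

lemma continuous_first_variation: "smooth_map \<A> \<eta> \<Longrightarrow> continuous_on UNIV (first_variation \<eta>)"
  unfolding first_variation_def[abs_def]
  by (intro continuous_intros smooth_map_continuous continuous_F continuous_mean_curvature_vector continuous_gradient)

lemma first_variation_eq_0:
  assumes "closed K" "\<And>p. p \<notin> K \<Longrightarrow> \<eta> p = 0" "p \<notin> K"
  shows "first_variation \<eta> p = 0"
  using gradient_eq_0[of "- K" p \<eta>] assms by (simp add: first_variation_def open_Compl)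

lemma first_variation_chart:
  assumes c: "c \<in> \<A>" and \<eta>: "smooth_map \<A> \<eta>" and K: "compact K" "K \<subseteq> fst c" "\<And>p. p \<notin> K \<Longrightarrow> \<eta> p = 0"
  shows "(\<integral>p. first_variation \<eta> p \<partial>\<sigma>) = 0"
proof -
  let ?\<Phi> = "F \<circ> chart_inv c" and ?H = "mean_curvature_vector \<A> F \<circ> chart_inv c"
  interpret P: parametrized_immersion ?\<Phi> "chart_image c" by (rule immersion_chart[OF c])
  have "compact (snd c ` K)"
    using K(1,2) continuous_on_subset[OF continuous_chart[OF c]] by (intro compact_continuous_image) auto
  moreover have "snd c ` K \<subseteq> chart_image c" using K(2) by auto
  moreover have "(\<eta> \<circ> chart_inv c) u = 0" if "u \<in> chart_image c - snd c ` K" for u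
  proof -
    have "chart_inv c u \<notin> K"
    proof
      assume "chart_inv c u \<in> K"
      then have "snd c (chart_inv c u) \<in> snd c ` K" by (rule imageI)
      then show False using that chart_chart_inv[OF c, of u] by auto
    qed
    then show ?thesis using K(3) by simp
  qed
  moreover have "?H u \<bullet> frechet_derivative ?\<Phi> (at u) w = 0" if u: "u \<in> chart_image c" for u w
    using normal_part_inner[OF c chart_inv_in[OF c u]]
    by (simp add: mean_curvature_vector_chart[OF c chart_inv_in[OF c u]] deriv_at_chart_inv[OF c u, symmetric])
  moreover have "(\<Sum>i\<in>UNIV. \<Sum>j\<in>UNIV. gram_inv (frechet_derivative ?\<Phi> (at u)) $ i $ j *\<^sub>R second_derivative ?\<Phi> u (ax i) (ax j)) - ?H u
     \<in> range (frechet_derivative ?\<Phi> (at u))" if u: "u \<in> chart_image c" for u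
  proof -
    note p = c chart_inv_in[OF c u]
    have "(\<Sum>i\<in>UNIV. \<Sum>j\<in>UNIV. ginv c (chart_inv c u) i j *\<^sub>R hess c (chart_inv c u) (ax i) (ax j)) - ?H u
       \<in> range (deriv_at c F (chart_inv c u))"
      using tangential_range[OF linear_dF[OF p]]
      by (simp add: mean_curvature_vector_chart[OF p] normal_part_chart[OF p])
    then show ?thesis by (simp only: deriv_at_chart_inv[OF c u] chart_chart_inv[OF c u])
  qed
  ultimately have 0: "(\<integral>u. indicator (chart_image c) u * (P.vol u * ((\<eta> \<circ> chart_inv c) u * (real CARD('n) + ?\<Phi> u \<bullet> ?H u) +
     (\<Sum>i\<in>UNIV. \<Sum>j\<in>UNIV. gram_inv (frechet_derivative ?\<Phi> (at u)) $ i $ j *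
       (frechet_derivative (\<eta> \<circ> chart_inv c) (at u) (ax i) * (?\<Phi> u \<bullet> frechet_derivative ?\<Phi> (at u) (ax j)))))) \<partial>lborel) = 0"
    by (rule P.local_first_variation[OF smooth_mapD[OF \<eta> c]])
  have "(\<integral>p. first_variation \<eta> p \<partial>\<sigma>) =
     (\<integral>u. indicator (chart_image c) u * (volume_density c F u * first_variation \<eta> (chart_inv c u)) \<partial>lborel)"
  proof (rule integral_volume_measure_chart[OF c])
    show "first_variation \<eta> \<in> borel_measurable borel"
      by (intro borel_measurable_continuous_onI continuous_first_variation \<eta>)
    show "first_variation \<eta> p = 0" if "p \<notin> fst c" for p
      by (rule first_variation_eq_0[OF compact_imp_closed[OF K(1)] K(3)]) (use that K(2) in auto)
  qed
  also have "\<dots> = 0" unfolding 0[symmetric]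
  proof (rule Bochner_Integration.integral_cong[OF refl])
    fix u
    show "indicator (chart_image c) u * (volume_density c F u * first_variation \<eta> (chart_inv c u)) =
      indicator (chart_image c) u * (P.vol u * ((\<eta> \<circ> chart_inv c) u * (real CARD('n) + ?\<Phi> u \<bullet> ?H u) +
     (\<Sum>i\<in>UNIV. \<Sum>j\<in>UNIV. gram_inv (frechet_derivative ?\<Phi> (at u)) $ i $ j *
       (frechet_derivative (\<eta> \<circ> chart_inv c) (at u) (ax i) * (?\<Phi> u \<bullet> frechet_derivative ?\<Phi> (at u) (ax j))))))"
    proof (cases "u \<in> chart_image c")
      case u: True
      note p = c chart_inv_in[OF c u]
      have "gradient \<A> F \<eta> (chart_inv c u) \<bullet> F (chart_inv c u) =
        (\<Sum>i\<in>UNIV. \<Sum>j\<in>UNIV. gram_inv (frechet_derivative ?\<Phi> (at u)) $ i $ j *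
       (frechet_derivative (\<eta> \<circ> chart_inv c) (at u) (ax i) * (?\<Phi> u \<bullet> frechet_derivative ?\<Phi> (at u) (ax j))))"
        unfolding gradient_chart[OF p smooth_map_differentiable[OF \<eta> p]] deriv_at_chart_inv[OF c u]
        by (simp add: inner_commute[of _ "F (chart_inv c u)"] inner_sum_right mult.assoc)
      then show ?thesis by (simp add: first_variation_def volume_density_gram P.vol_def)
    qed simp
  qed
  finally show ?thesis .
qed

text \<open>In a chart around \<open>p\<close> the function is \<open>flat_exp 0 (r\<^sup>2 - \<bar>v - y\<bar>\<^sup>2)\<close>. It extends by \<open>0\<close> because its support is
  compact, hence closed in the Hausdorff space \<open>'m\<close>.\<close>

lemma bump_function:
  obtains \<beta> :: "'m \<Rightarrow> real" and K c where "smooth_map \<A> \<beta>" "\<And>q. \<beta> q \<ge> 0" "\<beta> p > 0"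
    "c \<in> \<A>" "compact K" "K \<subseteq> fst c" "\<And>q. q \<notin> K \<Longrightarrow> \<beta> q = 0"
proof -
  obtain c where c: "c \<in> \<A>" "p \<in> fst c" using chart_cover by blast
  obtain r where r: "r > 0" "cball (snd c p) r \<subseteq> chart_image c" by (rule chart_ball[OF c])
  define K where "K = chart_inv c ` cball (snd c p) r"
  have K: "compact K" unfolding K_def
    by (intro compact_continuous_image continuous_on_subset[OF continuous_chart_inv[OF c(1)] r(2)] compact_cball)
  have Kc: "K \<subseteq> fst c" unfolding K_def using r(2) chart_inv_in[OF c(1)] by blast
  let ?y = "snd c p"
  define h where "h = (\<lambda>v. flat_exp 0 (r\<^sup>2 - (v - ?y) \<bullet> (v - ?y)))"
  define \<beta> where "\<beta> = (\<lambda>q. if q \<in> fst c then h (snd c q) else 0)"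
  have h: "smooth_on h UNIV" unfolding h_def
    by (rule smooth_on_compose[OF open_UNIV open_UNIV smooth_on_flat_exp]) (auto intro!: smooth_intros)
  have K0: "\<beta> q = 0" if "q \<notin> K" for q
  proof (cases "q \<in> fst c")
    case True
    have "snd c q \<notin> cball ?y r"
    proof
      assume "snd c q \<in> cball ?y r"
      then have "chart_inv c (snd c q) \<in> K" unfolding K_def by blast
      then show False using that chart_inv_chart[OF c(1) True] by simp
    qed
    then have "r < norm (snd c q - ?y)" by (simp add: dist_norm norm_minus_commute)
    then have "r\<^sup>2 < (norm (snd c q - ?y))\<^sup>2" using r(1) by (intro power_strict_mono) auto
    then show ?thesis by (simp add: \<beta>_def h_def flat_exp_def power2_norm_eq_inner)
  qed (simp add: \<beta>_def)
  have "smooth_map \<A> \<beta>"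
  proof (rule smooth_map_open_cover[OF open_chart[OF c(1)] open_Compl[OF compact_imp_closed[OF K]]])
    show "fst c \<union> - K = UNIV" using Kc by auto
    fix d assume d: "d \<in> \<A>"
    have o: "open (snd d ` (fst d \<inter> - K))"
      by (rule chart_image_subset_open[OF d]) (simp_all add: open_Int open_chart[OF d] open_Compl compact_imp_closed[OF K])
    have "smooth_on (\<lambda>u. 0::real) (snd d ` (fst d \<inter> - K))" by (rule smooth_on_const[OF o])
    moreover have "(\<beta> \<circ> chart_inv d) u = 0" if "u \<in> snd d ` (fst d \<inter> - K)" for u
      using that chart_inv_chart[OF d] K0 by auto
    ultimately show "smooth_on (\<beta> \<circ> chart_inv d) (snd d ` (fst d \<inter> - K))"
      using smooth_on_cong[OF o, of "\<beta> \<circ> chart_inv d" "\<lambda>u. 0"] by blast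
    have "smooth_on (\<lambda>u. h ((snd c \<circ> chart_inv d) u)) (snd d ` (fst d \<inter> fst c))"
      by (rule smooth_on_compose[OF open_overlap[OF d c(1)] open_UNIV h smooth_transition[OF d c(1)]]) simp
    moreover have "(\<beta> \<circ> chart_inv d) u = h ((snd c \<circ> chart_inv d) u)" if "u \<in> snd d ` (fst d \<inter> fst c)" for u
      using that chart_inv_chart[OF d] by (auto simp: \<beta>_def)
    ultimately show "smooth_on (\<beta> \<circ> chart_inv d) (snd d ` (fst d \<inter> fst c))"
      using smooth_on_cong[OF open_overlap[OF d c(1)], of "\<beta> \<circ> chart_inv d" "\<lambda>u. h ((snd c \<circ> chart_inv d) u)"] by blast
  qed
  moreover have "\<beta> q \<ge> 0" for q by (simp add: \<beta>_def h_def flat_exp_def)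
  moreover have "\<beta> p > 0" using c r by (simp add: \<beta>_def h_def flat_exp_def)
  ultimately show ?thesis using that c(1) K Kc K0 by blast
qed

text \<open>The function \<open>\<eta>\<close> is split into pieces that live in one chart each: \<open>\<eta> = \<Sum> \<beta>\<^sub>p \<eta> / s\<close>, where \<open>s\<close> is the sum of finitely
  many bumps \<open>\<beta>\<^sub>p\<close> that cover \<open>K\<close>. The quotient \<open>\<eta> / s\<close> is smooth, because \<open>s > 0\<close> near \<open>K\<close> and \<open>\<eta> = 0\<close> outside of \<open>K\<close>.\<close>

lemma partition_of_unity:
  fixes \<eta> :: "'m \<Rightarrow> real"
  assumes \<eta>: "smooth_map \<A> \<eta>" and K_compact: "compact K" and K_supp: "{p. \<eta> p \<noteq> 0} \<subseteq> K"
  shows "\<exists>(C :: 'm set) \<eta>'. finite C \<and> \<eta> = (\<lambda>q. \<Sum>p\<in>C. \<eta>' p q) \<and>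
    (\<forall>p\<in>C. smooth_map \<A> (\<eta>' p) \<and> (\<exists>c\<in>\<A>. \<exists>L. compact L \<and> L \<subseteq> fst c \<and> (\<forall>q. q \<notin> L \<longrightarrow> \<eta>' p q = 0)))"
proof -
  have K: "compact K" "\<And>p. p \<notin> K \<Longrightarrow> \<eta> p = 0" using K_compact K_supp by auto
  have "\<forall>p. \<exists>\<beta> :: 'm \<Rightarrow> real. smooth_map \<A> \<beta> \<and> (\<forall>q. \<beta> q \<ge> 0) \<and> \<beta> p > 0 \<and>
     (\<exists>c\<in>\<A>. \<exists>L. compact L \<and> L \<subseteq> fst c \<and> (\<forall>q. q \<notin> L \<longrightarrow> \<beta> q = 0))"
  proof
    fix p
    show "\<exists>\<beta> :: 'm \<Rightarrow> real. smooth_map \<A> \<beta> \<and> (\<forall>q. \<beta> q \<ge> 0) \<and> \<beta> p > 0 \<and>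
     (\<exists>c\<in>\<A>. \<exists>L. compact L \<and> L \<subseteq> fst c \<and> (\<forall>q. q \<notin> L \<longrightarrow> \<beta> q = 0))"
      by (rule bump_function[of p]) blast
  qed
  from choice[OF this] obtain \<beta> :: "'m \<Rightarrow> 'm \<Rightarrow> real" where \<beta>: "\<And>p. smooth_map \<A> (\<beta> p)" "\<And>p q. \<beta> p q \<ge> 0" "\<And>p. \<beta> p p > 0"
    and supp: "\<And>p. \<exists>c\<in>\<A>. \<exists>L. compact L \<and> L \<subseteq> fst c \<and> (\<forall>q. q \<notin> L \<longrightarrow> \<beta> p q = 0)" by blast
  have open_pos: "open {q. g q > 0}" if "smooth_map \<A> g" for g :: "'m \<Rightarrow> real"
    by (rule open_Collect_less[OF continuous_on_const smooth_map_continuous[OF that]])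
  have cover: "K \<subseteq> (\<Union>p\<in>K. {q. \<beta> p q > 0})" using \<beta>(3) by auto
  obtain C where C: "C \<subseteq> K" "finite C" "K \<subseteq> (\<Union>p\<in>C. {q. \<beta> p q > 0})"
    by (rule compactE_image[OF K(1) open_pos[OF \<beta>(1)] cover])
  define s where "s = (\<lambda>q. \<Sum>p\<in>C. \<beta> p q)"
  have s: "smooth_map \<A> s" unfolding s_def by (intro smooth_map_sum \<beta>(1))
  have s_pos: "s q > 0" if "q \<in> K" for q
  proof -
    from that C(3) obtain p where "p \<in> C" "\<beta> p q > 0" by auto
    then show ?thesis unfolding s_def using C(2) \<beta>(2) by (intro sum_pos2[of C p]) auto
  qed
  define \<eta>' where "\<eta>' = (\<lambda>p q. \<beta> p q * (\<eta> q / s q))"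
  have quot: "smooth_map \<A> (\<lambda>q. \<eta> q / s q)"
  proof (rule smooth_map_open_cover[OF open_pos[OF s] open_Compl[OF compact_imp_closed[OF K(1)]]])
    show "{q. 0 < s q} \<union> - K = UNIV" using s_pos by auto
    fix d assume d: "d \<in> \<A>"
    have o: "open (snd d ` (fst d \<inter> - K))"
      by (rule chart_image_subset_open[OF d]) (simp_all add: open_Int open_chart[OF d] open_Compl compact_imp_closed[OF K(1)])
    have "((\<lambda>q. \<eta> q / s q) \<circ> chart_inv d) u = 0" if "u \<in> snd d ` (fst d \<inter> - K)" for u
      using that chart_inv_chart[OF d] K(2) by auto
    then show "smooth_on ((\<lambda>q. \<eta> q / s q) \<circ> chart_inv d) (snd d ` (fst d \<inter> - K))"
      using smooth_on_cong[OF o, of "(\<lambda>q. \<eta> q / s q) \<circ> chart_inv d" "\<lambda>u. 0"] smooth_on_const[OF o] by blast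
    let ?O = "snd d ` (fst d \<inter> {q. 0 < s q})"
    have o': "open ?O"
      by (rule chart_image_subset_open[OF d]) (simp_all add: open_Int open_chart[OF d] open_pos[OF s])
    have "smooth_on (\<lambda>u. (\<eta> \<circ> chart_inv d) u / (s \<circ> chart_inv d) u) ?O"
    proof (rule smooth_on_divide[OF o'])
      show "smooth_on (\<eta> \<circ> chart_inv d) ?O" by (rule smooth_on_subset[OF smooth_mapD[OF \<eta> d]]) auto
      show "smooth_on (s \<circ> chart_inv d) ?O" by (rule smooth_on_subset[OF smooth_mapD[OF s d]]) auto
      show "(s \<circ> chart_inv d) u \<noteq> 0" if "u \<in> ?O" for u using that chart_inv_chart[OF d] by auto
    qed
    then show "smooth_on ((\<lambda>q. \<eta> q / s q) \<circ> chart_inv d) ?O" by (simp add: o_def)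
  qed
  have "smooth_map \<A> (\<eta>' p)" for p unfolding \<eta>'_def by (intro smooth_map_mult \<beta>(1) quot)
  moreover have "\<exists>c\<in>\<A>. \<exists>L. compact L \<and> L \<subseteq> fst c \<and> (\<forall>q. q \<notin> L \<longrightarrow> \<eta>' p q = 0)" for p
    using supp[of p] unfolding \<eta>'_def by (metis mult_zero_left)
  moreover have "\<eta> q = (\<Sum>p\<in>C. \<eta>' p q)" for q
  proof (cases "q \<in> K")
    case True
    have "(\<Sum>p\<in>C. \<eta>' p q) = s q * (\<eta> q / s q)"
      unfolding \<eta>'_def sum_distrib_right[symmetric] by (simp only: s_def)
    then show ?thesis using s_pos[OF True] by simp
  qed (simp add: \<eta>'_def K(2))
  ultimately show ?thesis using C(2) by (intro exI[of _ C] exI[of _ \<eta>']) auto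
qed

theorem first_variation_formula:
  assumes \<eta>: "smooth_map \<A> \<eta>" and K: "compact K" "\<And>p. p \<notin> K \<Longrightarrow> \<eta> p = 0"
  shows "(\<integral>p. first_variation \<eta> p \<partial>\<sigma>) = 0"
proof -
  have supp: "{p. \<eta> p \<noteq> 0} \<subseteq> K" using K(2) by blast
  obtain C :: "'m set" and \<eta>' where C: "finite C" "\<eta> = (\<lambda>q. \<Sum>p\<in>C. \<eta>' p q)"
    and \<eta>': "\<forall>p\<in>C. smooth_map \<A> (\<eta>' p) \<and> (\<exists>c\<in>\<A>. \<exists>L. compact L \<and> L \<subseteq> fst c \<and> (\<forall>q. q \<notin> L \<longrightarrow> \<eta>' p q = 0))"
    using partition_of_unity[OF \<eta> K(1) supp] by (elim exE conjE)
  have "(\<integral>p. first_variation (\<lambda>q. \<Sum>p\<in>B. \<eta>' p q) p \<partial>\<sigma>) = 0 \<and> integrable \<sigma> (first_variation (\<lambda>q. \<Sum>p\<in>B. \<eta>' p q))"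
    if "finite B" "B \<subseteq> C" for B
    using that
  proof (induction B rule: finite_induct)
    case empty
    have "first_variation (\<lambda>q. 0) p = 0" for p
      using gradient_eq_0[of UNIV p "\<lambda>q. 0"] by (simp add: first_variation_def)
    then show ?case by simp
  next
    case (insert b B)
    let ?g = "\<lambda>q. \<Sum>p\<in>B. \<eta>' p q"
    obtain c L where b: "smooth_map \<A> (\<eta>' b)" and c: "c \<in> \<A>" and L: "compact L" "L \<subseteq> fst c" "\<And>q. q \<notin> L \<Longrightarrow> \<eta>' b q = 0"
      using \<eta>' insert.prems by auto
    have g: "smooth_map \<A> ?g" using \<eta>' insert.prems by (intro smooth_map_sum) auto
    have eq: "(\<lambda>q. \<Sum>p\<in>insert b B. \<eta>' p q) = (\<lambda>q. \<eta>' b q + ?g q)"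
      using insert.hyps by simp
    have fv: "first_variation (\<lambda>q. \<eta>' b q + ?g q) = (\<lambda>p. first_variation (\<eta>' b) p + first_variation ?g p)"
      by (rule ext) (simp add: first_variation_def gradient_add[OF b g] inner_add_left distrib_right)
    have int: "integrable \<sigma> (first_variation (\<eta>' b))"
      by (rule integrable_continuous_compact_support[OF continuous_first_variation[OF b] L(1)])
        (rule first_variation_eq_0[OF compact_imp_closed[OF L(1)] L(3)])
    have "(\<integral>p. first_variation (\<eta>' b) p \<partial>\<sigma>) = 0" by (rule first_variation_chart[OF c b L])
    moreover have "(\<integral>p. first_variation ?g p \<partial>\<sigma>) = 0 \<and> integrable \<sigma> (first_variation ?g)"
      using insert by blast
    ultimately show ?case unfolding eq fv using int by simp
  qed
  from this[OF C(1) order_refl] show ?thesis unfolding C(2)[symmetric] by simp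
qed

end

section \<open>The stability form of a self-expander\<close>

context hypersurface
begin

text \<open>The normal space is a line by a dimension count. This is what makes the mean curvature a number.\<close>

lemma orthogonal_comp_tangent:
  obtains \<nu> where "norm \<nu> = 1" "orthogonal_comp (tangent_space \<A> F p) = span {\<nu>}"
proof -
  let ?T = "tangent_space \<A> F p" and ?N = "orthogonal_comp (tangent_space \<A> F p)"
  obtain c where c: "c \<in> \<A>" "p \<in> fst c" using chart_cover by blast
  have T: "?T = deriv_at c F p ` UNIV" by (rule tangent_space_chart[OF c])
  have sT: "subspace ?T" unfolding T by (rule linear_subspace_image[OF linear_dF[OF c] subspace_UNIV])
  have "dim ?T = CARD('n)" unfolding T
    using dim_image_eq[OF linear_dF[OF c], of UNIV] inj_dF[OF c] by (simp add: inj_on_def)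
  moreover have "dim ?N + dim ?T = DIM(real^('n + 1))"
    using dim_subspace_orthogonal_to_vectors[OF sT subspace_UNIV] by (simp add: orthogonal_comp_def)
  ultimately have d: "dim ?N = 1" by simp
  have sN: "subspace ?N" by (rule subspace_orthogonal_comp)
  obtain B where B: "B \<subseteq> ?N" "\<And>x. x \<in> B \<Longrightarrow> norm x = 1" "card B = dim ?N" "span B = ?N"
    by (rule orthonormal_basis_subspace[OF sN]) blast
  then obtain \<nu> where "B = {\<nu>}" using d card_1_singletonE by metis
  then show ?thesis using that B by auto
qed

lemma mean_curvature_vector_normal: "mean_curvature_vector \<A> F p \<in> orthogonal_comp (tangent_space \<A> F p)"
proof -
  obtain c where c: "c \<in> \<A>" "p \<in> fst c" using chart_cover by blast
  show ?thesis
    unfolding mean_curvature_vector_chart[OF c] tangent_space_chart[OF c]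
    using normal_part_inner[OF c] by (auto simp: orthogonal_comp_def orthogonal_def inner_commute)
qed

text \<open>The unit normal is one of the two unit vectors of the normal line, so the scalar that is defined by it
  is the length of the mean curvature vector up to sign.\<close>

lemma abs_mean_curvature: "\<bar>mean_curvature \<A> F p\<bar> = norm (mean_curvature_vector \<A> F p)"
proof -
  let ?N = "orthogonal_comp (tangent_space \<A> F p)"
  obtain \<nu> where \<nu>: "norm \<nu> = 1" "?N = span {\<nu>}" by (rule orthogonal_comp_tangent)
  have "norm (unit_normal \<A> F p) = 1 \<and> unit_normal \<A> F p \<in> ?N"
    unfolding unit_normal_def by (rule someI[of _ \<nu>]) (use \<nu> in \<open>simp add: span_base\<close>)
  then have u: "norm (unit_normal \<A> F p) = 1" "unit_normal \<A> F p \<in> span {\<nu>}" using \<nu>(2) by auto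
  then obtain k where k: "unit_normal \<A> F p = k *\<^sub>R \<nu>" by (auto simp: span_singleton)
  then have k1: "\<bar>k\<bar> = 1" using u(1) \<nu>(1) by simp
  obtain l where l: "mean_curvature_vector \<A> F p = l *\<^sub>R \<nu>"
    using mean_curvature_vector_normal[of p] unfolding \<nu>(2) by (auto simp: span_singleton)
  have "\<nu> = k *\<^sub>R unit_normal \<A> F p"
    using k1 by (simp add: k abs_if power2_eq_1_iff split: if_splits)
  then have eq: "mean_curvature_vector \<A> F p = - ((- (l * k)) *\<^sub>R unit_normal \<A> F p)"
    by (simp add: l)
  have "mean_curvature_vector \<A> F p = - (mean_curvature \<A> F p *\<^sub>R unit_normal \<A> F p)"
    unfolding mean_curvature_def
  proof (rule theI[of _ "- (l * k)"])
    show "mean_curvature_vector \<A> F p = - ((- (l * k)) *\<^sub>R unit_normal \<A> F p)" by (rule eq)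
    fix h assume "mean_curvature_vector \<A> F p = - (h *\<^sub>R unit_normal \<A> F p)"
    then have "h *\<^sub>R unit_normal \<A> F p = (- (l * k)) *\<^sub>R unit_normal \<A> F p" using eq by simp
    moreover have "unit_normal \<A> F p \<noteq> 0" using u(1) by auto
    ultimately show "h = - (l * k)" by (simp add: scaleR_right_imp_eq)
  qed
  then show ?thesis using u(1) by simp
qed

end

locale self_expander_hypersurface = hypersurface \<A> F
  for \<A> :: "('m::{t2_space,second_countable_topology}, 'n::finite) chart set" and F :: "'m \<Rightarrow> real^('n + 1)" +
  assumes expander: "self_expander \<A> F"
begin

abbreviation Hsq :: "'m \<Rightarrow> real" where "Hsq p \<equiv> (mean_curvature \<A> F p)\<^sup>2"

lemma Hsq_eq: "Hsq p = (norm (mean_curvature_vector \<A> F p))\<^sup>2"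
  by (metis abs_mean_curvature power2_abs)

lemma mean_curvature_vector_eq: "mean_curvature_vector \<A> F p = (1/2) *\<^sub>R normal_part \<A> F p (F p)"
  using expander by (simp add: self_expander_def)

lemma position_inner_normal_part: "F p \<bullet> normal_part \<A> F p (F p) = 4 * Hsq p"
proof -
  let ?N = "normal_part \<A> F p (F p)"
  obtain c where c: "c \<in> \<A>" "p \<in> fst c" using chart_cover by blast
  obtain a where "tangential (deriv_at c F p) (F p) = deriv_at c F p a"
    using tangential_range[OF linear_dF[OF c], of "F p"] by blast
  then have "tangent_position p = deriv_at c F p a"
    by (simp add: tangent_position_def normal_part_chart[OF c])
  then have "tangent_position p \<bullet> ?N = 0"
    using normal_part_inner[OF c, of "F p" a] by (simp add: inner_commute)
  then have "F p \<bullet> ?N = ?N \<bullet> ?N" by (simp add: tangent_position_def inner_diff_left)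
  then show ?thesis by (simp add: Hsq_eq mean_curvature_vector_eq power_divide power2_norm_eq_inner)
qed

lemma position_inner_mean_curvature_vector: "F p \<bullet> mean_curvature_vector \<A> F p = 2 * Hsq p"
  by (simp add: mean_curvature_vector_eq position_inner_normal_part)

lemma tangent_position_sq: "(norm (tangent_position p))\<^sup>2 = (norm (F p))\<^sup>2 - 4 * Hsq p"
proof -
  let ?N = "normal_part \<A> F p (F p)"
  have "?N \<bullet> ?N = 4 * Hsq p" by (simp add: Hsq_eq mean_curvature_vector_eq power_divide power2_norm_eq_inner)
  then show ?thesis
    using position_inner_normal_part[of p]
    by (simp add: tangent_position_def power2_norm_eq_inner inner_diff_left inner_diff_right inner_commute)
qed

lemma first_variation_expander:
  assumes "smooth_map \<A> \<eta>"
  shows "first_variation \<eta> p = \<eta> p * (real CARD('n) + 2 * Hsq p) + gradient \<A> F \<eta> p \<bullet> tangent_position p"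
  by (simp add: first_variation_def position_inner_mean_curvature_vector gradient_inner_position[OF assms])

lemma continuous_Hsq: "continuous_on UNIV Hsq"
  unfolding Hsq_eq by (intro continuous_intros continuous_mean_curvature_vector)

lemma continuous_scalar_curvature: "continuous_on UNIV (scalar_curvature \<A> F)"
  unfolding scalar_curvature_def[abs_def] by (intro continuous_on_diff continuous_Hsq continuous_norm_A_sq)

lemma continuous_tangent_position: "continuous_on UNIV tangent_position"
proof -
  have "tangent_position = (\<lambda>p. F p - 2 *\<^sub>R mean_curvature_vector \<A> F p)"
    by (simp add: fun_eq_iff tangent_position_def mean_curvature_vector_eq)
  then show ?thesis by (simp, intro continuous_intros continuous_F continuous_mean_curvature_vector)
qed

abbreviation weight :: "'m \<Rightarrow> real" where "weight p \<equiv> exp ((norm (F p))\<^sup>2 / 4)"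

lemma smooth_map_weight: "smooth_map \<A> weight"
proof -
  have "smooth_on (\<lambda>s::real. exp (s / 4)) UNIV"
    by (intro smooth_intros open_UNIV) auto
  from smooth_map_compose[OF this smooth_map_norm_sq] show ?thesis .
qed

lemma gradient_weight: "gradient \<A> F weight p = (weight p / 2) *\<^sub>R tangent_position p"
proof -
  have "((\<lambda>s::real. exp (s / 4)) has_real_derivative weight p / 4) (at ((norm (F p))\<^sup>2))"
    by (auto intro!: derivative_eq_intros)
  from gradient_compose[OF smooth_map_norm_sq this] show ?thesis by (simp add: gradient_norm_sq)
qed

lemma test_functionD:
  assumes "f \<in> test_functions \<A>"
  shows "smooth_map \<A> f" "compact (closure {p. f p \<noteq> 0})" "\<And>p. p \<notin> closure {p. f p \<noteq> 0} \<Longrightarrow> f p = 0"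
  using assms closure_subset[of "{p. f p \<noteq> 0}"] by (auto simp: test_functions_def)

text \<open>All integrands below are continuous and vanish where \<open>f\<close> and its gradient vanish.\<close>

lemma integrable_test:
  fixes f h :: "'m \<Rightarrow> real"
  assumes f: "f \<in> test_functions \<A>" and h: "continuous_on UNIV h"
    and h0: "\<And>p. f p = 0 \<Longrightarrow> gradient \<A> F f p = 0 \<Longrightarrow> h p = 0"
  shows "integrable \<sigma> h"
proof (rule integrable_continuous_compact_support[OF h test_functionD(2)[OF f]])
  fix p assume p: "p \<notin> closure {p. f p \<noteq> 0}"
  have "gradient \<A> F f p = 0"
  proof (rule gradient_eq_0)
    show "open (- closure {p. f p \<noteq> 0})" by (simp add: open_Compl)
    show "p \<in> - closure {p. f p \<noteq> 0}" using p by simp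
    show "f q = 0" if "q \<in> - closure {p. f p \<noteq> 0}" for q
      by (rule test_functionD(3)[OF f]) (use that in simp)
  qed
  then show "h p = 0" by (rule h0[OF test_functionD(3)[OF f p]])
qed

text \<open>The integrands of the two sides differ by half of the first variation of \<open>\<eta> = f\<^sup>2 w\<close>, which integrates to \<open>0\<close>. The gradient of
  the weight is \<open>w x\<^sup>T / 2\<close>, so that \<open>\<langle>\<nabla>\<eta>, x\<rangle>\<close> consists of exactly the terms that complete the square in \<open>\<bar>\<nabla>f\<bar>\<^sup>2\<close>,
  and \<open>n + \<langle>x, H\<rangle> = n + 2 H\<^sup>2\<close> contributes the potential.\<close>

theorem stability_form_identity:
  assumes f: "f \<in> test_functions \<A>"
  shows "weighted_integral \<A> F (\<lambda>p. (norm (gradient \<A> F f p))\<^sup>2 - (norm_A_sq \<A> F p - 1/2) * (f p)\<^sup>2) =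
    (\<integral>p. (norm (gradient \<A> F f p + (f p / 2) *\<^sub>R tangent_position p))\<^sup>2 * weight p \<partial>\<sigma>) +
    (\<integral>p. ((real CARD('n) + 1) / 2 + scalar_curvature \<A> F p) * (f p)\<^sup>2 * weight p \<partial>\<sigma>)"
proof -
  let ?n = "real CARD('n)" and ?G = "gradient \<A> F f" and ?X = tangent_position
  let ?\<eta> = "\<lambda>p. (f p * f p) * weight p"
  note sf = test_functionD(1)[OF f]
  have \<eta>: "smooth_map \<A> ?\<eta>" by (intro smooth_map_mult sf smooth_map_weight)
  note cont = continuous_intros smooth_map_continuous[OF sf] continuous_gradient[OF sf] continuous_tangent_position
    continuous_scalar_curvature smooth_map_continuous[OF smooth_map_weight]
  have grad: "gradient \<A> F ?\<eta> p = weight p *\<^sub>R ((2 * f p) *\<^sub>R ?G p + ((f p)\<^sup>2 / 2) *\<^sub>R ?X p)" for p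
  proof -
    have "f p *\<^sub>R ?G p + f p *\<^sub>R ?G p = (2 * f p) *\<^sub>R ?G p"
      by (simp add: scaleR_add_left[symmetric])
    then show ?thesis
      unfolding gradient_mult[OF smooth_map_mult[OF sf sf] smooth_map_weight] gradient_mult[OF sf sf] gradient_weight
      by (simp add: power2_eq_square scaleR_add_right mult_ac)
  qed
  have pointwise: "((norm (?G p))\<^sup>2 - (norm_A_sq \<A> F p - 1/2) * (f p)\<^sup>2) * weight p =
     (norm (?G p + (f p / 2) *\<^sub>R ?X p))\<^sup>2 * weight p + ((?n + 1) / 2 + scalar_curvature \<A> F p) * (f p)\<^sup>2 * weight p -
     first_variation ?\<eta> p / 2" for p
  proof -
    have "(norm (?G p + (f p / 2) *\<^sub>R ?X p))\<^sup>2 = (norm (?G p))\<^sup>2 + f p * (?G p \<bullet> ?X p) + (f p)\<^sup>2 / 4 * (norm (?X p))\<^sup>2"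
      unfolding power2_norm_eq_inner
      by (simp add: inner_add_left inner_add_right inner_commute[of "?X p" "?G p"] power2_eq_square)
        (simp add: field_simps)
    moreover have "first_variation ?\<eta> p = ((f p)\<^sup>2 * (?n + 2 * Hsq p) + 2 * f p * (?G p \<bullet> ?X p) + (f p)\<^sup>2 / 2 * (norm (?X p))\<^sup>2) * weight p"
      unfolding first_variation_expander[OF \<eta>] grad unfolding power2_norm_eq_inner
      by (simp add: inner_add_left power2_eq_square algebra_simps)
    ultimately show ?thesis
      by (simp add: scalar_curvature_def) (simp add: field_simps)
  qed
  have i1: "integrable \<sigma> (\<lambda>p. (norm (?G p + (f p / 2) *\<^sub>R ?X p))\<^sup>2 * weight p)"
    by (rule integrable_test[OF f]) (auto intro!: cont)
  have i2: "integrable \<sigma> (\<lambda>p. ((?n + 1) / 2 + scalar_curvature \<A> F p) * (f p)\<^sup>2 * weight p)"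
    by (rule integrable_test[OF f]) (auto intro!: cont)
  have i3: "integrable \<sigma> (first_variation ?\<eta>)"
    by (rule integrable_test[OF f continuous_first_variation[OF \<eta>]])
      (auto simp: first_variation_expander[OF \<eta>] grad)
  have 0: "(\<integral>p. first_variation ?\<eta> p \<partial>\<sigma>) = 0"
    by (rule first_variation_formula[OF \<eta> test_functionD(2)[OF f]]) (drule test_functionD(3)[OF f], simp)
  show ?thesis unfolding weighted_integral_def pointwise using i1 i2 i3 0 by simp
qed

lemma weighted_square_integral_nonneg: "weighted_integral \<A> F (\<lambda>p. (f p)\<^sup>2) \<ge> 0"
  unfolding weighted_integral_def by (intro Bochner_Integration.integral_nonneg) simp

theorem bottom_spectrum_lower_bound:
  "bottom_spectrum \<A> F \<ge> ereal ((real CARD('n) + 1) / 2) + (INF p. ereal (scalar_curvature \<A> F p))"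
proof (cases "INF p. ereal (scalar_curvature \<A> F p)")
  case (real s)
  have s: "s \<le> scalar_curvature \<A> F p" for p
  proof -
    have "(INF p. ereal (scalar_curvature \<A> F p)) \<le> ereal (scalar_curvature \<A> F p)" by (rule INF_lower) simp
    then show ?thesis unfolding real by simp
  qed
  let ?L = "(real CARD('n) + 1) / 2 + s"
  show ?thesis
    unfolding bottom_spectrum_def real plus_ereal.simps
  proof (rule INF_greatest)
    fix f assume "f \<in> {f \<in> test_functions \<A>. weighted_integral \<A> F (\<lambda>p. (f p)\<^sup>2) \<noteq> 0}"
    then have f: "f \<in> test_functions \<A>" and pos: "weighted_integral \<A> F (\<lambda>p. (f p)\<^sup>2) > 0"
      using weighted_square_integral_nonneg[of f] by auto
    note cont = continuous_intros smooth_map_continuous[OF test_functionD(1)[OF f]]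
      continuous_scalar_curvature smooth_map_continuous[OF smooth_map_weight]
    have "?L * weighted_integral \<A> F (\<lambda>p. (f p)\<^sup>2) = (\<integral>p. ?L * (f p)\<^sup>2 * weight p \<partial>\<sigma>)"
      by (simp add: weighted_integral_def mult.assoc)
    also have "\<dots> \<le> (\<integral>p. ((real CARD('n) + 1) / 2 + scalar_curvature \<A> F p) * (f p)\<^sup>2 * weight p \<partial>\<sigma>)"
    proof (rule integral_mono)
      show "integrable \<sigma> (\<lambda>p. ?L * (f p)\<^sup>2 * weight p)" by (rule integrable_test[OF f]) (auto intro!: cont)
      show "integrable \<sigma> (\<lambda>p. ((real CARD('n) + 1) / 2 + scalar_curvature \<A> F p) * (f p)\<^sup>2 * weight p)"
        by (rule integrable_test[OF f]) (auto intro!: cont)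
      show "?L * (f p)\<^sup>2 * weight p \<le> ((real CARD('n) + 1) / 2 + scalar_curvature \<A> F p) * (f p)\<^sup>2 * weight p" for p
        using s[of p] by (intro mult_right_mono) auto
    qed
    also have "\<dots> \<le> weighted_integral \<A> F (\<lambda>p. (norm (gradient \<A> F f p))\<^sup>2 - (norm_A_sq \<A> F p - 1/2) * (f p)\<^sup>2)"
      unfolding stability_form_identity[OF f] by (simp add: Bochner_Integration.integral_nonneg)
    finally show "ereal ?L \<le> ereal (weighted_integral \<A> F (\<lambda>p. (norm (gradient \<A> F f p))\<^sup>2 - (norm_A_sq \<A> F p - 1/2) * (f p)\<^sup>2)
        / weighted_integral \<A> F (\<lambda>p. (f p)\<^sup>2))"
      using pos by (simp add: pos_le_divide_eq)
  qed
next
  case PInf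
  have "(INF p. ereal (scalar_curvature \<A> F p)) \<le> ereal (scalar_curvature \<A> F undefined)" by (rule INF_lower) simp
  then show ?thesis using PInf by simp
qed simp

end

section \<open>Cutoff functions and the equality case\<close>

text \<open>The hypothesis on \<open>a\<close> says that \<open>4 a\<^sup>2 < 1/2\<close>, so that the quadratic polynomial has a negative leading coefficient.\<close>

lemma quadratic_eventually_below:
  fixes a b n :: real
  assumes a: "0 \<le> a" "a < 1 / (2 * sqrt 2)" and b: "b > 0" and n: "n \<ge> 0"
  obtains \<rho> C where "\<rho> \<ge> 0" "C \<ge> 0"
    "\<And>r. r \<ge> 0 \<Longrightarrow> n + 4 * (a * r + b)\<^sup>2 - r\<^sup>2 / 2 \<le> (if r \<le> \<rho> then C else 0) - 1"
proof -
  \<comment> \<open>The polynomial is \<open>- \<kappa> r\<^sup>2 + 8 a b r + 4 b\<^sup>2 + n\<close>; from \<open>r \<ge> \<rho> \<ge> 1\<close> on, \<open>\<kappa> r\<^sup>2\<close> dominates all the rest plus 1.\<close>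
  define \<kappa> where "\<kappa> = 1/2 - 4 * a\<^sup>2"
  have "a\<^sup>2 < (1 / (2 * sqrt 2))\<^sup>2" using a by (intro power_strict_mono) auto
  also have "\<dots> = 1/8" by (simp add: power_divide power_mult_distrib)
  finally have \<kappa>: "\<kappa> > 0" by (simp add: \<kappa>_def)
  define m where "m = 8 * a * b + 4 * b\<^sup>2 + n + 1"
  have m: "m \<ge> 0" using a b n by (simp add: m_def)
  define \<rho> where "\<rho> = m / \<kappa> + 1"
  have \<rho>: "\<rho> \<ge> 1" "\<kappa> * \<rho> \<ge> m" using \<kappa> m by (auto simp: \<rho>_def distrib_left)
  have q: "n + 4 * (a * r + b)\<^sup>2 - r\<^sup>2 / 2 = - \<kappa> * r\<^sup>2 + 8 * a * b * r + 4 * b\<^sup>2 + n" for r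
    by (simp add: \<kappa>_def power2_eq_square algebra_simps)
  show ?thesis
  proof (rule that[of \<rho> "8 * a * b * \<rho> + 4 * b\<^sup>2 + n + 1"])
    show "\<rho> \<ge> 0" using \<rho> by simp
    show "8 * a * b * \<rho> + 4 * b\<^sup>2 + n + 1 \<ge> 0" using \<rho> a b n by simp
    fix r :: real assume r: "r \<ge> 0"
    show "n + 4 * (a * r + b)\<^sup>2 - r\<^sup>2 / 2 \<le> (if r \<le> \<rho> then 8 * a * b * \<rho> + 4 * b\<^sup>2 + n + 1 else 0) - 1"
    proof (cases "r \<le> \<rho>")
      case True
      have "8 * a * b * r \<le> 8 * a * b * \<rho>" using True a b by (intro mult_left_mono) auto
      moreover have "\<kappa> * r\<^sup>2 \<ge> 0" using \<kappa> by simp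
      ultimately show ?thesis unfolding q using True by simp
    next
      case False
      then have r1: "r \<ge> 1" "r \<ge> \<rho>" using \<rho> by auto
      have "m * r \<le> \<kappa> * \<rho> * r" using \<rho> r by (intro mult_right_mono) auto
      also have "\<dots> \<le> \<kappa> * r * r" using r1 r \<kappa> by (intro mult_right_mono mult_left_mono) auto
      finally have "m * r \<le> \<kappa> * r\<^sup>2" by (simp add: power2_eq_square mult.assoc)
      moreover have "8 * a * b * r + (4 * b\<^sup>2 + n + 1) * 1 \<le> 8 * a * b * r + (4 * b\<^sup>2 + n + 1) * r"
        using r1 n by (intro add_left_mono mult_left_mono) auto
      moreover have "m * r = 8 * a * b * r + (4 * b\<^sup>2 + n + 1) * r" by (simp add: m_def algebra_simps)
      ultimately show ?thesis unfolding q using False by simp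
    qed
  qed
qed

locale proper_self_expander = self_expander_hypersurface \<A> F
  for \<A> :: "('m::{t2_space,second_countable_topology}, 'n::finite) chart set" and F :: "'m \<Rightarrow> real^('n + 1)" +
  assumes proper: "properly_immersed F"
begin

text \<open>The square in \<open>stability_form_identity\<close> vanishes for \<open>exp (- \<bar>x\<bar>\<^sup>2 / 4)\<close>. This function is cut off smoothly at
  \<open>\<bar>x\<bar>\<^sup>2 = 2 R\<close>, by a decreasing function of \<open>\<bar>x\<bar>\<^sup>2\<close>.\<close>

definition cutoff :: "real \<Rightarrow> 'm \<Rightarrow> real" where
  "cutoff R p = flat_exp 0 (2 - (norm (F p))\<^sup>2 / R) * exp (- (norm (F p))\<^sup>2 / 4)"

lemma smooth_map_cutoff: "smooth_map \<A> (cutoff R)"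
proof -
  have "smooth_on (\<lambda>s::real. 2 - s / R) UNIV"
    unfolding divide_inverse by (intro smooth_intros open_UNIV)
  then have "smooth_on (\<lambda>s. flat_exp 0 (2 - s / R)) UNIV"
    by (rule smooth_on_compose[OF open_UNIV open_UNIV smooth_on_flat_exp]) simp
  then have "smooth_on (\<lambda>s. flat_exp 0 (2 - s / R) * exp (- s / 4)) UNIV"
    by (intro smooth_intros open_UNIV) auto
  from smooth_map_compose[OF this smooth_map_norm_sq] show ?thesis by (simp add: cutoff_def[abs_def])
qed

lemma gradient_cutoff:
  assumes "R > 0"
  shows "gradient \<A> F (cutoff R) p = - ((2 / R) * flat_exp 2 (2 - (norm (F p))\<^sup>2 / R) * exp (- (norm (F p))\<^sup>2 / 4) + cutoff R p / 2) *\<^sub>R tangent_position p"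
proof -
  let ?s = "(norm (F p))\<^sup>2"
  have "((\<lambda>s. flat_exp 0 (2 - s / R) * exp (- s / 4)) has_real_derivative
     (- flat_exp 2 (2 - ?s / R) / R * exp (- ?s / 4) - flat_exp 0 (2 - ?s / R) * exp (- ?s / 4) / 4)) (at ?s)"
  proof -
    have "((\<lambda>s. flat_exp 0 (2 - s / R)) has_real_derivative flat_exp 2 (2 - ?s / R) * (- (1 / R))) (at ?s)"
      by (rule DERIV_chain2[OF flat_exp_0_DERIV]) (use assms in \<open>auto intro!: derivative_eq_intros\<close>)
    moreover have "((\<lambda>s. exp (- s / 4)) has_real_derivative - exp (- ?s / 4) / 4) (at ?s)"
      by (auto intro!: derivative_eq_intros)
    ultimately have "((\<lambda>s. flat_exp 0 (2 - s / R) * exp (- s / 4)) has_real_derivative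
       flat_exp 2 (2 - ?s / R) * (- (1 / R)) * exp (- ?s / 4) + (- exp (- ?s / 4) / 4) * flat_exp 0 (2 - ?s / R)) (at ?s)"
      by (rule DERIV_mult)
    then show ?thesis by (rule DERIV_cong) simp
  qed
  from gradient_compose[OF smooth_map_norm_sq this]
  have "gradient \<A> F (cutoff R) p = (- flat_exp 2 (2 - ?s / R) / R * exp (- ?s / 4) -
      flat_exp 0 (2 - ?s / R) * exp (- ?s / 4) / 4) *\<^sub>R (2 *\<^sub>R tangent_position p)"
    unfolding gradient_norm_sq cutoff_def[abs_def] .
  moreover have "(- flat_exp 2 (2 - ?s / R) / R * exp (- ?s / 4) - flat_exp 0 (2 - ?s / R) * exp (- ?s / 4) / 4) * 2 =
      - ((2 / R) * flat_exp 2 (2 - ?s / R) * exp (- ?s / 4) + cutoff R p / 2)"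
    by (simp add: cutoff_def mult_ac)
  ultimately show ?thesis unfolding scaleR_scaleR by (simp only:)
qed

lemma compact_sublevel: "compact {p. norm (F p) \<le> r}"
proof -
  have "F -` cball 0 r = {p. norm (F p) \<le> r}" by auto
  then show ?thesis using proper compact_cball[of 0 r] by (metis properly_immersed_def)
qed

lemma cutoff_support:
  assumes "R > 0" "p \<notin> {p. norm (F p) \<le> sqrt (2 * R)}"
  shows "cutoff R p = 0"
proof -
  have "sqrt (2 * R) < norm (F p)" using assms(2) by simp
  then have "(sqrt (2 * R))\<^sup>2 < (norm (F p))\<^sup>2" using assms(1) by (intro power_strict_mono) auto
  then have "2 - (norm (F p))\<^sup>2 / R \<le> 0" using assms(1) by (simp add: field_simps)
  then show ?thesis by (simp add: cutoff_def flat_exp_def)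
qed

lemma cutoff_nonneg: "0 \<le> cutoff R p" by (simp add: cutoff_def flat_exp_nonneg)

lemma cutoff_le_1: "cutoff R p \<le> 1"
  unfolding cutoff_def by (rule mult_le_one[OF flat_exp_0_le_1]) auto

lemma cutoff_test_function:
  assumes "R > 0"
  shows "cutoff R \<in> test_functions \<A>"
proof -
  let ?K = "{p. norm (F p) \<le> sqrt (2 * R)}"
  have "{p. cutoff R p \<noteq> 0} \<subseteq> ?K" using cutoff_support[OF assms] by blast
  then have "closure {p. cutoff R p \<noteq> 0} \<subseteq> ?K"
    by (rule closure_minimal) (rule compact_imp_closed[OF compact_sublevel])
  then have "compact (?K \<inter> closure {p. cutoff R p \<noteq> 0})" "?K \<inter> closure {p. cutoff R p \<noteq> 0} = closure {p. cutoff R p \<noteq> 0}"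
    using compact_sublevel by (auto intro: compact_Int_closed)
  then show ?thesis by (simp add: test_functions_def smooth_map_cutoff)
qed

lemma integrable_cutoff: "R > 0 \<Longrightarrow> integrable \<sigma> (cutoff R)"
  by (rule integrable_continuous_compact_support[OF smooth_map_continuous[OF smooth_map_cutoff] compact_sublevel cutoff_support])

text \<open>Since the cutoff decreases in \<open>\<bar>x\<bar>\<^sup>2\<close>, its first variation is at most \<open>(n + 4 H\<^sup>2 - \<bar>x\<bar>\<^sup>2 / 2)\<close> times the cutoff. By the
  growth hypothesis this is at most \<open>- cutoff R\<close> outside of a ball that does not depend on \<open>R\<close>. As the first
  variation integrates to \<open>0\<close>, the mass outside of the ball is controlled by the volume of the ball.\<close>

lemma integral_cutoff_bounded:
  assumes a: "0 \<le> a" "a < 1 / (2 * sqrt 2)" and b: "b > 0"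
    and H: "\<And>p. \<bar>mean_curvature \<A> F p\<bar> \<le> a * norm (F p) + b"
  obtains M where "M \<ge> 0" "\<And>R. R > 0 \<Longrightarrow> (\<integral>p. cutoff R p \<partial>\<sigma>) \<le> M"
proof -
  obtain \<rho> C where \<rho>: "\<rho> \<ge> 0" "C \<ge> 0"
    "\<And>r. r \<ge> 0 \<Longrightarrow> real CARD('n) + 4 * (a * r + b)\<^sup>2 - r\<^sup>2 / 2 \<le> (if r \<le> \<rho> then C else 0) - 1"
    using quadratic_eventually_below[OF a b, of "real CARD('n)"] by auto
  let ?B = "{p. norm (F p) \<le> \<rho>}"
  have Bc: "compact ?B" by (rule compact_sublevel)
  then have B: "?B \<in> sets borel" by (simp add: borel_compact)
  have intB: "integrable \<sigma> (\<lambda>p. C * indicator ?B p)"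
    using emeasure_compact_finite[OF Bc] B by (intro integrable_mult_right integrable_real_indicator) auto
  have "(\<integral>p. cutoff R p \<partial>\<sigma>) \<le> C * measure \<sigma> ?B" if R: "R > 0" for R
  proof -
    have bound: "cutoff R p \<le> C * indicator ?B p - first_variation (cutoff R) p" for p
    proof -
      let ?r = "norm (F p)" and ?X = "(norm (tangent_position p))\<^sup>2"
      have "Hsq p \<le> (a * ?r + b)\<^sup>2"
        using H[of p] power_mono[OF H[of p], of 2] by simp
      then have "real CARD('n) + 4 * Hsq p - ?r\<^sup>2 / 2 \<le> C * indicator ?B p - 1"
        using \<rho>(3)[of ?r] by (auto simp: indicator_def split: if_splits)
      then have "cutoff R p * (real CARD('n) + 4 * Hsq p - ?r\<^sup>2 / 2) \<le> cutoff R p * (C * indicator ?B p - 1)"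
        by (rule mult_left_mono[OF _ cutoff_nonneg])
      moreover have "cutoff R p * (C * indicator ?B p) \<le> 1 * (C * indicator ?B p)"
        using \<rho>(2) by (intro mult_right_mono cutoff_le_1) auto
      moreover have "first_variation (cutoff R) p \<le> cutoff R p * (real CARD('n) + 4 * Hsq p - ?r\<^sup>2 / 2)"
      proof -
        have "first_variation (cutoff R) p = cutoff R p * (real CARD('n) + 2 * Hsq p) - cutoff R p / 2 * ?X -
            (2 / R) * flat_exp 2 (2 - ?r\<^sup>2 / R) * exp (- ?r\<^sup>2 / 4) * ?X"
          unfolding first_variation_expander[OF smooth_map_cutoff] gradient_cutoff[OF R]
          by (simp add: power2_norm_eq_inner algebra_simps)
        moreover have "(2 / R) * flat_exp 2 (2 - ?r\<^sup>2 / R) * exp (- ?r\<^sup>2 / 4) * ?X \<ge> 0"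
          using R flat_exp_nonneg by (intro mult_nonneg_nonneg) auto
        ultimately show ?thesis by (simp add: tangent_position_sq algebra_simps)
      qed
      ultimately show ?thesis by (simp add: algebra_simps)
    qed
    have fv: "integrable \<sigma> (first_variation (cutoff R))"
      by (rule integrable_continuous_compact_support[OF continuous_first_variation[OF smooth_map_cutoff] compact_sublevel])
        (rule first_variation_eq_0[OF compact_imp_closed[OF compact_sublevel] cutoff_support[OF R]])
    have "(\<integral>p. cutoff R p \<partial>\<sigma>) \<le> (\<integral>p. C * indicator ?B p - first_variation (cutoff R) p \<partial>\<sigma>)"
      using intB fv integrable_cutoff[OF R] bound by (intro integral_mono) auto
    also have "\<dots> = C * measure \<sigma> ?B - (\<integral>p. first_variation (cutoff R) p \<partial>\<sigma>)"
      using intB fv by simp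
    also have "(\<integral>p. first_variation (cutoff R) p \<partial>\<sigma>) = 0"
      by (rule first_variation_formula[OF smooth_map_cutoff compact_sublevel cutoff_support[OF R]])
    finally show ?thesis by simp
  qed
  then show ?thesis using that[of "C * measure \<sigma> ?B"] \<rho>(2) by simp
qed

text \<open>The gradient of \<open>exp (- \<bar>x\<bar>\<^sup>2 / 4)\<close> cancels, and what remains is \<open>(2 / R) \<zeta>' x\<^sup>T exp (- \<bar>x\<bar>\<^sup>2 / 4)\<close> with
  \<open>\<zeta> s = flat_exp 0 (2 - s)\<close>. On the support \<open>\<bar>\<zeta>'\<bar> \<le> 2\<close> and \<open>\<bar>x\<^sup>T\<bar>\<^sup>2 \<le> 2 R\<close>, so the square is at most \<open>32 / R\<close> times
  \<open>exp (- \<bar>x\<bar>\<^sup>2 / 4)\<close> after weighting, and \<open>cutoff (2 * R)\<close> is at least \<open>exp (- 1)\<close> times \<open>exp (- \<bar>x\<bar>\<^sup>2 / 4)\<close> there.\<close>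

lemma cutoff_energy:
  assumes R: "R > 0"
  shows "(\<integral>p. (norm (gradient \<A> F (cutoff R) p + (cutoff R p / 2) *\<^sub>R tangent_position p))\<^sup>2 * weight p \<partial>\<sigma>)
    \<le> 32 * exp 1 / R * (\<integral>p. cutoff (2 * R) p \<partial>\<sigma>)"
proof -
  have "(\<integral>p. (norm (gradient \<A> F (cutoff R) p + (cutoff R p / 2) *\<^sub>R tangent_position p))\<^sup>2 * weight p \<partial>\<sigma>)
    \<le> (\<integral>p. 32 * exp 1 / R * cutoff (2 * R) p \<partial>\<sigma>)"
  proof (rule integral_mono)
    show "integrable \<sigma> (\<lambda>p. (norm (gradient \<A> F (cutoff R) p + (cutoff R p / 2) *\<^sub>R tangent_position p))\<^sup>2 * weight p)"
      by (rule integrable_test[OF cutoff_test_function[OF R]])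
        (auto intro!: continuous_intros continuous_gradient[OF smooth_map_cutoff] smooth_map_continuous[OF smooth_map_cutoff]
          continuous_tangent_position smooth_map_continuous[OF smooth_map_weight])
    show "integrable \<sigma> (\<lambda>p. 32 * exp 1 / R * cutoff (2 * R) p)"
      using integrable_cutoff[of "2 * R"] R by (intro integrable_mult_right) auto
    fix p
    let ?s = "(norm (F p))\<^sup>2" and ?X = "(norm (tangent_position p))\<^sup>2"
    let ?z = "flat_exp 2 (2 - ?s / R)" and ?e = "exp (- ?s / 4)"
    have "gradient \<A> F (cutoff R) p + (cutoff R p / 2) *\<^sub>R tangent_position p = - ((2 / R) * ?z * ?e) *\<^sub>R tangent_position p"
      unfolding gradient_cutoff[OF R] by (simp add: algebra_simps)
    then have "(norm (gradient \<A> F (cutoff R) p + (cutoff R p / 2) *\<^sub>R tangent_position p))\<^sup>2 * weight p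
       = ((2 / R) * ?z * ?e)\<^sup>2 * ?X * weight p"
      by (simp only: norm_scaleR power_mult_distrib power2_abs power2_minus)
    also have "\<dots> = 4 / R\<^sup>2 * ?z\<^sup>2 * ?X * ?e * (?e * weight p)"
      by (simp add: power_mult_distrib power_divide power2_eq_square)
    also have "?e * weight p = 1" by (simp add: exp_add[symmetric])
    also have "4 / R\<^sup>2 * ?z\<^sup>2 * ?X * ?e * 1 \<le> 32 * exp 1 / R * cutoff (2 * R) p"
    proof (cases "?s < 2 * R")
      case False
      then have "2 - ?s / R \<le> 0" using R by (simp add: field_simps)
      then have "?z = 0" by (simp add: flat_exp_def)
      then show ?thesis using R cutoff_nonneg[of "2 * R" p] by simp
    next
      case True
      have "?z\<^sup>2 \<le> 2\<^sup>2" by (rule power_mono[OF flat_exp_2_le flat_exp_nonneg])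
      moreover have "?X \<le> 2 * R" using True zero_le_power2[of "mean_curvature \<A> F p"]
        unfolding tangent_position_sq by linarith
      ultimately have "?z\<^sup>2 * ?X \<le> 2\<^sup>2 * (2 * R)" by (intro mult_mono) auto
      then have "4 / R\<^sup>2 * (?z\<^sup>2 * ?X) * ?e \<le> 4 / R\<^sup>2 * (2\<^sup>2 * (2 * R)) * ?e"
        by (intro mult_right_mono mult_left_mono) auto
      also have "\<dots> = 32 / R * ?e" using R by (simp add: power2_eq_square)
      also have "\<dots> \<le> 32 / R * (exp 1 * cutoff (2 * R) p)"
      proof (rule mult_left_mono)
        have "?s / (2 * R) \<le> 1" using True R by simp
        then have "flat_exp 0 1 \<le> flat_exp 0 (2 - ?s / (2 * R))" by (intro flat_exp_0_mono) simp
        then have "exp 1 * (exp (-1) * ?e) \<le> exp 1 * cutoff (2 * R) p"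
          unfolding cutoff_def by (intro mult_left_mono mult_right_mono) (auto simp: flat_exp_0)
        then show "?e \<le> exp 1 * cutoff (2 * R) p" by (simp add: mult.assoc[symmetric] exp_minus)
      qed (use R in simp)
      finally show ?thesis by (simp add: mult.assoc)
    qed
    finally show "(norm (gradient \<A> F (cutoff R) p + (cutoff R p / 2) *\<^sub>R tangent_position p))\<^sup>2 * weight p
      \<le> 32 * exp 1 / R * cutoff (2 * R) p" .
  qed
  then show ?thesis by simp
qed

text \<open>For large \<open>R\<close> the cutoffs are bounded below on a fixed nonempty open set, which has positive volume.\<close>

lemma cutoff_mass:
  obtains R0 \<delta> where "R0 > 0" "\<delta> > 0" "\<And>R. R \<ge> R0 \<Longrightarrow> weighted_integral \<A> F (\<lambda>p. (cutoff R p)\<^sup>2) \<ge> \<delta>"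
proof -
  define R0 where "R0 = (norm (F undefined))\<^sup>2 + 1"
  have R0: "R0 > 0" by (simp add: R0_def add_nonneg_pos)
  define W where "W = {p. (norm (F p))\<^sup>2 < R0}"
  have W: "open W" unfolding W_def
    by (intro open_Collect_less continuous_intros continuous_F)
  \<comment> \<open>Any point of the manifold will do as the centre of the fixed open set.\<close>
  have "undefined \<in> W" by (simp add: W_def R0_def)
  then have "emeasure \<sigma> W > 0" using emeasure_open_pos[OF W] by auto
  moreover have sub: "W \<subseteq> {p. norm (F p) \<le> sqrt R0}"
    unfolding W_def by (auto intro: real_le_rsqrt)
  then have "emeasure \<sigma> W \<le> emeasure \<sigma> {p. norm (F p) \<le> sqrt R0}"
    using compact_sublevel[of "sqrt R0"] by (intro emeasure_mono) (auto intro: borel_compact)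
  then have fin: "emeasure \<sigma> W < \<infinity>" using emeasure_compact_finite[OF compact_sublevel[of "sqrt R0"]] by simp
  ultimately have mW: "measure \<sigma> W > 0" by (simp add: measure_def enn2real_positive_iff)
  let ?k = "exp (-2) * exp (- R0 / 4)"
  have intW: "integrable \<sigma> (\<lambda>p. ?k * indicator W p)"
    using fin W by (intro integrable_mult_right integrable_real_indicator) auto
  show ?thesis
  proof (rule that[OF R0])
    show "?k * measure \<sigma> W > 0" using mW by simp
    fix R assume R: "R \<ge> R0"
    then have R_pos: "R > 0" using R0 by simp
    have "?k * measure \<sigma> W = (\<integral>p. ?k * indicator W p \<partial>\<sigma>)" by simp
    also have "\<dots> \<le> (\<integral>p. (cutoff R p)\<^sup>2 * weight p \<partial>\<sigma>)"
    proof (rule integral_mono[OF intW])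
      show "integrable \<sigma> (\<lambda>p. (cutoff R p)\<^sup>2 * weight p)"
        by (rule integrable_test[OF cutoff_test_function[OF R_pos]])
          (auto intro!: continuous_intros smooth_map_continuous[OF smooth_map_cutoff] smooth_map_continuous[OF smooth_map_weight])
      fix p
      show "?k * indicator W p \<le> (cutoff R p)\<^sup>2 * weight p"
      proof (cases "p \<in> W")
        case True
        let ?s = "(norm (F p))\<^sup>2"
        let ?e = "exp (- ?s / 4)"
        have s: "?s < R0" using True by (simp add: W_def)
        then have "?s / R \<le> 1" using R R_pos by simp
        then have z: "exp (-1) \<le> flat_exp 0 (2 - ?s / R)"
          using flat_exp_0_mono[of 1 "2 - ?s / R"] by (simp add: flat_exp_0)
        have "(cutoff R p)\<^sup>2 * weight p = (flat_exp 0 (2 - ?s / R))\<^sup>2 * ?e * (?e * weight p)"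
          by (simp add: cutoff_def power_mult_distrib power2_eq_square)
        also have "?e * weight p = 1" by (simp add: exp_add[symmetric])
        finally have eq: "(cutoff R p)\<^sup>2 * weight p = (flat_exp 0 (2 - ?s / R))\<^sup>2 * ?e" by simp
        have "exp (-2) = (exp (-1 :: real))\<^sup>2" by (simp add: exp_double[symmetric])
        then have "exp (-2) \<le> (flat_exp 0 (2 - ?s / R))\<^sup>2" using power_mono[OF z, of 2] by simp
        moreover have "exp (- R0 / 4) \<le> ?e" using s by simp
        ultimately have "?k \<le> (flat_exp 0 (2 - ?s / R))\<^sup>2 * ?e" by (intro mult_mono) auto
        then show ?thesis using True eq by simp
      qed simp
    qed
    finally show "?k * measure \<sigma> W \<le> weighted_integral \<A> F (\<lambda>p. (cutoff R p)\<^sup>2)" by (simp add: weighted_integral_def)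
  qed
qed

text \<open>The quotient of \<open>cutoff R\<close> exceeds \<open>(n + 1) / 2 + c\<close> by \<open>cutoff_energy\<close> divided by \<open>cutoff_mass\<close>, which is of order
  \<open>1 / R\<close>.\<close>

theorem bottom_spectrum_upper_bound:
  assumes c: "\<And>p. scalar_curvature \<A> F p = c"
    and a: "0 \<le> a" "a < 1 / (2 * sqrt 2)" and b: "b > 0"
    and H: "\<And>p. \<bar>mean_curvature \<A> F p\<bar> \<le> a * norm (F p) + b"
  shows "bottom_spectrum \<A> F \<le> ereal ((real CARD('n) + 1) / 2 + c)"
proof (rule ereal_le_epsilon2)
  fix \<epsilon> :: real assume \<epsilon>: "\<epsilon> > 0"
  let ?L = "(real CARD('n) + 1) / 2 + c"
  obtain M where M: "M \<ge> 0" "\<And>R. R > 0 \<Longrightarrow> (\<integral>p. cutoff R p \<partial>\<sigma>) \<le> M"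
    using integral_cutoff_bounded[OF a b H] by blast
  obtain R0 \<delta> where \<delta>: "R0 > 0" "\<delta> > 0" "\<And>R. R \<ge> R0 \<Longrightarrow> weighted_integral \<A> F (\<lambda>p. (cutoff R p)\<^sup>2) \<ge> \<delta>"
    using cutoff_mass by blast
  \<comment> \<open>This radius makes the bound of \<open>cutoff_energy\<close> at most \<open>\<delta> \<epsilon>\<close>.\<close>
  define R where "R = max R0 (32 * exp 1 * M / (\<delta> * \<epsilon>))"
  have R: "R > 0" "R \<ge> R0" "R \<ge> 32 * exp 1 * M / (\<delta> * \<epsilon>)" using \<delta> by (auto simp: R_def)
  let ?f = "cutoff R" and ?D = "weighted_integral \<A> F (\<lambda>p. (cutoff R p)\<^sup>2)"
  let ?E = "\<integral>p. (norm (gradient \<A> F ?f p + (?f p / 2) *\<^sub>R tangent_position p))\<^sup>2 * weight p \<partial>\<sigma>"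
  have D: "?D \<ge> \<delta>" by (rule \<delta>(3)[OF R(2)])
  have "?E \<le> 32 * exp 1 / R * (\<integral>p. cutoff (2 * R) p \<partial>\<sigma>)" by (rule cutoff_energy[OF R(1)])
  also have "\<dots> \<le> 32 * exp 1 / R * M" using M(2)[of "2 * R"] R(1) by (intro mult_left_mono) auto
  also have "\<dots> \<le> \<delta> * \<epsilon>"
    using R \<delta>(2) \<epsilon> by (simp add: field_simps)
  also have "\<dots> \<le> ?D * \<epsilon>" using D \<epsilon> by (intro mult_right_mono) auto
  finally have E: "?E \<le> ?D * \<epsilon>" .
  note f = cutoff_test_function[OF R(1)]
  have "weighted_integral \<A> F (\<lambda>p. (norm (gradient \<A> F ?f p))\<^sup>2 - (norm_A_sq \<A> F p - 1/2) * (?f p)\<^sup>2) = ?E + ?L * ?D"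
    unfolding stability_form_identity[OF f] by (simp add: c weighted_integral_def mult.assoc)
  then have "weighted_integral \<A> F (\<lambda>p. (norm (gradient \<A> F ?f p))\<^sup>2 - (norm_A_sq \<A> F p - 1/2) * (?f p)\<^sup>2) / ?D \<le> ?L + \<epsilon>"
    using E D \<delta>(2) by (simp add: field_simps)
  moreover have "bottom_spectrum \<A> F \<le> ereal (weighted_integral \<A> F (\<lambda>p. (norm (gradient \<A> F ?f p))\<^sup>2 - (norm_A_sq \<A> F p - 1/2) * (?f p)\<^sup>2) / ?D)"
    unfolding bottom_spectrum_def by (rule INF_lower) (use f D \<delta>(2) in auto)
  ultimately have "bottom_spectrum \<A> F \<le> ereal (?L + \<epsilon>)"
    by (elim order_trans) simp
  then show "bottom_spectrum \<A> F \<le> ereal ?L + ereal \<epsilon>" by simp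
qed

end

section \<open>The theorem\<close>

theorem theorem1p6:
  fixes \<A> :: "('m::{t2_space,second_countable_topology}, 'n::finite) chart set"
    and F :: "'m \<Rightarrow> real^('n + 1)"
  assumes "immersed_hypersurface \<A> F"
    and "complete_immersion F"
    and "self_expander \<A> F"
  shows "bottom_spectrum \<A> F \<ge>
           ereal ((real CARD('n) + 1) / 2) + (INF p. ereal (scalar_curvature \<A> F p)) \<and>
         (properly_immersed F \<and>
          (\<exists>c. \<forall>p. scalar_curvature \<A> F p = c) \<and>
          (\<exists>a b. 0 \<le> a \<and> a < 1 / (2 * sqrt 2) \<and> b > 0 \<and>
                 (\<forall>p. \<bar>mean_curvature \<A> F p\<bar> \<le> a * norm (F p) + b)) \<longrightarrow>
          bottom_spectrum \<A> F =
            ereal ((real CARD('n) + 1) / 2) + (INF p. ereal (scalar_curvature \<A> F p)))"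
proof (intro conjI impI)
  interpret self_expander_hypersurface \<A> F by unfold_locales (fact assms)+
  show lower: "bottom_spectrum \<A> F \<ge>
      ereal ((real CARD('n) + 1) / 2) + (INF p. ereal (scalar_curvature \<A> F p))"
    by (rule bottom_spectrum_lower_bound)
  assume *: "properly_immersed F \<and> (\<exists>c. \<forall>p. scalar_curvature \<A> F p = c) \<and>
    (\<exists>a b. 0 \<le> a \<and> a < 1 / (2 * sqrt 2) \<and> b > 0 \<and> (\<forall>p. \<bar>mean_curvature \<A> F p\<bar> \<le> a * norm (F p) + b))"
  then obtain c a b where c: "\<And>p. scalar_curvature \<A> F p = c"
    and ab: "0 \<le> a" "a < 1 / (2 * sqrt 2)" "b > 0" "\<And>p. \<bar>mean_curvature \<A> F p\<bar> \<le> a * norm (F p) + b"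
    by auto
  interpret proper_self_expander \<A> F by unfold_locales (use * in simp)
  have "(INF p. ereal (scalar_curvature \<A> F p)) = ereal c" by (simp add: c)
  then show "bottom_spectrum \<A> F =
      ereal ((real CARD('n) + 1) / 2) + (INF p. ereal (scalar_curvature \<A> F p))"
    using lower bottom_spectrum_upper_bound[OF c ab] by (intro antisym) simp_all
qed

end
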